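(* Let $D$ be an $\mathcal{L}$-definable subset of $K^{n}$ and $m\ge 1$. Then the canonical projection $\pi:D\times R^{m}\to D$ is definably closed in the $K$-topology: for every $\mathcal{L}$-definable subset $B\subset D\times R^{m}$ which is closed in $D\times R^{m}$ (in the $K$-topology), the image $\pi(B)$ is closed in $D$.
   Context: Standing assumptions: $K$ is a Henselian valued field of equicharacteristic zero whose valuation $v:K\to\Gamma\cup\{\infty\}$ has rank one, i.e. the value group $\Gamma$ is a subgroup of $(\mathbb{R},+)$; $R=\{x: v(x)\ge 0\}$ is the valuation ring and $\Bbbk$ the residue field. The $K$-topology on $K^{n}$ (and on subsets, on $\mathbb{P}^{m}(K)$, and on $K$-points of $K$-varieties) is the topology induced by the absolute value of $K$. $\mathcal{L}$ is the three-sorted Denef–Pas language: sorts $K$ (language of rings), $\Gamma$ (language of ordered abelian groups with $\infty$, augmented by congruence relations $\equiv_N$ and a constant $1$), $\Bbbk$ (language of rings), with the valuation map $v$ and an angular component map $\overline{ac}:K\to\Bbbk$ (multiplicative, $\overline{ac}(0)=0$, equal to the residue map on units of $R$). "$\mathcal{L}$-definable" means definable with parameters. *)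

theory Defs
  imports "HOL-Library.Extended_Real" "HOL-Computational_Algebra.Polynomial"
begin

text \<open>The valuation takes values in ereal; rank one means the value group
  lies in the reals.  v x = \<infinity> iff x = 0.  The residue field is a type 'f
  (of characteristic zero), with residue map res defined on the valuation ring.\<close>

definition val_ring :: "('k \<Rightarrow> ereal) \<Rightarrow> 'k set" where
  "val_ring v = {x. v x \<ge> 0}"

definition value_group :: "('k::zero \<Rightarrow> ereal) \<Rightarrow> ereal set" where
  "value_group v = v ` (UNIV - {0})"

definition henselian_ac_field ::
  "('k::field_char_0 \<Rightarrow> ereal) \<Rightarrow> ('k \<Rightarrow> 'f::field_char_0) \<Rightarrow> ('k \<Rightarrow> 'f) \<Rightarrow> bool" where
  "henselian_ac_field v res ac \<longleftrightarrow>
     \<comment> \<open>valuation of rank one\<close>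
     (\<forall>x. v x = \<infinity> \<longleftrightarrow> x = 0) \<and>
     (\<forall>x. v x \<noteq> -\<infinity>) \<and>
     (\<forall>x y. v (x * y) = v x + v y) \<and>
     (\<forall>x y. v (x + y) \<ge> min (v x) (v y)) \<and>
     \<comment> \<open>residue map: surjective ring homomorphism R \<rightarrow> residue field with kernel the maximal ideal\<close>
     (\<forall>x\<in>val_ring v. \<forall>y\<in>val_ring v. res (x + y) = res x + res y \<and> res (x * y) = res x * res y) \<and>
     res 1 = 1 \<and>
     (\<forall>x\<in>val_ring v. res x = 0 \<longleftrightarrow> v x > 0) \<and>
     (\<forall>c. \<exists>x\<in>val_ring v. res x = c) \<and>
     \<comment> \<open>angular component map\<close>
     (\<forall>x y. ac (x * y) = ac x * ac y) \<and>
     ac 0 = 0 \<and>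
     (\<forall>x. v x = 0 \<longrightarrow> ac x = res x) \<and>
     \<comment> \<open>Henselian (Hensel's lemma for monic polynomials over R)\<close>
     (\<forall>p a. lead_coeff p = 1 \<and> (\<forall>i. v (coeff p i) \<ge> 0) \<and> v a \<ge> 0 \<and>
            v (poly p a) > 0 \<and> v (poly (pderiv p) a) = 0 \<longrightarrow>
            (\<exists>b. poly p b = 0 \<and> v (b - a) > 0))"

datatype kterm = KVar nat | KZero | KOne | KAdd kterm kterm | KNeg kterm | KMul kterm kterm

datatype gterm = GVar nat | GZero | GInf | GVal kterm | GAdd gterm gterm

datatype rterm = RVar nat | RZero | ROne | RAdd rterm rterm | RNeg rterm | RMul rterm rterm
  | RAc kterm

datatype dp_formula =
    KEq kterm kterm
  | GEq gterm gterm
  | GLess gterm gterm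
  | GCong nat gterm gterm
  | REq rterm rterm
  | FNot dp_formula
  | FConj dp_formula dp_formula
  | ExK nat dp_formula
  | ExG nat dp_formula
  | ExR nat dp_formula

primrec eval_k :: "(nat \<Rightarrow> 'k::field) \<Rightarrow> kterm \<Rightarrow> 'k" where
  "eval_k e (KVar i) = e i"
| "eval_k e KZero = 0"
| "eval_k e KOne = 1"
| "eval_k e (KAdd s t) = eval_k e s + eval_k e t"
| "eval_k e (KNeg s) = - eval_k e s"
| "eval_k e (KMul s t) = eval_k e s * eval_k e t"

primrec eval_g :: "('k::field \<Rightarrow> ereal) \<Rightarrow> (nat \<Rightarrow> 'k) \<Rightarrow> (nat \<Rightarrow> ereal) \<Rightarrow> gterm \<Rightarrow> ereal" where
  "eval_g v eK eG (GVar i) = eG i"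
| "eval_g v eK eG GZero = 0"
| "eval_g v eK eG GInf = \<infinity>"
| "eval_g v eK eG (GVal t) = v (eval_k eK t)"
| "eval_g v eK eG (GAdd s t) = eval_g v eK eG s + eval_g v eK eG t"

primrec eval_r :: "('k::field \<Rightarrow> 'f::field) \<Rightarrow> (nat \<Rightarrow> 'k) \<Rightarrow> (nat \<Rightarrow> 'f) \<Rightarrow> rterm \<Rightarrow> 'f" where
  "eval_r ac eK eR (RVar i) = eR i"
| "eval_r ac eK eR RZero = 0"
| "eval_r ac eK eR ROne = 1"
| "eval_r ac eK eR (RAdd s t) = eval_r ac eK eR s + eval_r ac eK eR t"
| "eval_r ac eK eR (RNeg s) = - eval_r ac eK eR s"
| "eval_r ac eK eR (RMul s t) = eval_r ac eK eR s * eval_r ac eK eR t"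
| "eval_r ac eK eR (RAc t) = ac (eval_k eK t)"

definition gcong :: "('k::field \<Rightarrow> ereal) \<Rightarrow> nat \<Rightarrow> ereal \<Rightarrow> ereal \<Rightarrow> bool" where
  "gcong v N a b \<longleftrightarrow> a = b \<or>
     (\<exists>x y g. a = ereal x \<and> b = ereal y \<and> ereal g \<in> value_group v \<and> x - y = real N * g)"

primrec sat :: "('k::field \<Rightarrow> ereal) \<Rightarrow> ('k \<Rightarrow> 'f::field) \<Rightarrow>
    (nat \<Rightarrow> 'k) \<Rightarrow> (nat \<Rightarrow> ereal) \<Rightarrow> (nat \<Rightarrow> 'f) \<Rightarrow> dp_formula \<Rightarrow> bool" where
  "sat v ac eK eG eR (KEq s t) = (eval_k eK s = eval_k eK t)"
| "sat v ac eK eG eR (GEq s t) = (eval_g v eK eG s = eval_g v eK eG t)"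
| "sat v ac eK eG eR (GLess s t) = (eval_g v eK eG s < eval_g v eK eG t)"
| "sat v ac eK eG eR (GCong N s t) = gcong v N (eval_g v eK eG s) (eval_g v eK eG t)"
| "sat v ac eK eG eR (REq s t) = (eval_r ac eK eR s = eval_r ac eK eR t)"
| "sat v ac eK eG eR (FNot \<phi>) = (\<not> sat v ac eK eG eR \<phi>)"
| "sat v ac eK eG eR (FConj \<phi> \<psi>) = (sat v ac eK eG eR \<phi> \<and> sat v ac eK eG eR \<psi>)"
| "sat v ac eK eG eR (ExK i \<phi>) = (\<exists>a. sat v ac (eK(i := a)) eG eR \<phi>)"
| "sat v ac eK eG eR (ExG i \<phi>) = (\<exists>g\<in>range v. sat v ac eK (eG(i := g)) eR \<phi>)"
| "sat v ac eK eG eR (ExR i \<phi>) = (\<exists>c. sat v ac eK eG (eR(i := c)) \<phi>)"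

text \<open>Points of K^n are lists of length n.  K-variables 0..n-1 are the coordinates;
  all other free variables are interpreted by parameter assignments (eK, eG, eR),
  where Gamma-parameters must lie in Gamma \<union> {\<infinity>}.\<close>
definition coord_env :: "(nat \<Rightarrow> 'k) \<Rightarrow> 'k list \<Rightarrow> nat \<Rightarrow> 'k" where
  "coord_env e xs = (\<lambda>i. if i < length xs then xs ! i else e i)"

definition dp_definable :: "('k::field \<Rightarrow> ereal) \<Rightarrow> ('k \<Rightarrow> 'f::field) \<Rightarrow> nat \<Rightarrow> 'k list set \<Rightarrow> bool" where
  "dp_definable v ac n S \<longleftrightarrow>
     (\<exists>\<phi> eK eG eR. range eG \<subseteq> range v \<and>
        S = {xs. length xs = n \<and> sat v ac (coord_env eK xs) eG eR \<phi>})"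

text \<open>The absolute value is |x| = exp(-v x); on K^n we take the (max-)product
  topology.  A basic neighbourhood of p is {q. \<forall>i. v(q_i - p_i) > \<gamma>}, \<gamma> real.
  A \<subseteq> S is closed in S iff every point of S adherent to A lies in A.\<close>
definition K_closed_in :: "('k::field \<Rightarrow> ereal) \<Rightarrow> 'k list set \<Rightarrow> 'k list set \<Rightarrow> bool" where
  "K_closed_in v S A \<longleftrightarrow> A \<subseteq> S \<and>
     (\<forall>p\<in>S. (\<forall>\<gamma>::real. \<exists>q\<in>A. length q = length p \<and>
                 (\<forall>i<length p. v (q ! i - p ! i) > ereal \<gamma>)) \<longrightarrow> p \<in> A)"

definition prod_Rm :: "('k::field \<Rightarrow> ereal) \<Rightarrow> 'k list set \<Rightarrow> nat \<Rightarrow> 'k list set" where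
  "prod_Rm v D m = {xs @ ys | xs ys. xs \<in> D \<and> length ys = m \<and> (\<forall>y\<in>set ys. v y \<ge> 0)}"

end

(*
Elimination of field quantifiers, in back-and-forth form and with explicit finite bounds. Two
assignments of the variables are regarded as similar if finitely many polynomials take values with
the same angular components, and if the valuations of these values satisfy the same linear
inequalities and congruences up to some level N. Given any formula, a sufficiently strong similarity
preserves its truth. The induction step for a field quantifier is the heart of the matter: by Hensel's
lemma, the leading terms of finitely many polynomials (closed under derivatives) at a point a are
determined by the leading term of a - c and the Taylor coefficients at a center c, where c is 0 or
a root of one of the polynomials; roots are transported from one side to the other by induction on
the degree, using pseudo-division and again Hensel's lemma. A quantifier over the value group is
treated by hand, using that a subgroup of the reals is either discrete or dense.

For the closedness theorem, the coordinates in R^m are found one at a time. For a point p adherent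
to the projection, the possible next coordinates of points of B whose previous coordinates are
approximated with precision gamma form a decreasing definable family of nonempty subsets of R, and
it suffices that such a family has a common adherent point.
*)
theory Submission
  imports Defs "HOL-Library.FuncSet"
begin

section \<open>Valuations and leading terms\<close>

text \<open>Since \<open>K\<close> need not be locally compact, bounded sequences need not
  accumulate anywhere. What replaces compactness is that a definable family cannot distinguish
  indices that are congruent and far larger than all other values involved. For this, an equivalent
  quantifier-free formula is more than is required; what counts is that finitely many polynomials
  and one level \<open>N\<close>, both independent of the assignments compared, control the truth of
  a formula. Hence the recurring shape "for every \<open>N\<close> there is \<open>N'\<close>": each
  step says how strong a similarity must be granted in order to keep strength \<open>N\<close>
  afterwards. Both assignments live in the same field and share the residue variables, so a residue
  quantifier has the same witness on both sides. Residue characteristic zero makes all positive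
  integers units, so differentiation changes Taylor terms only by known factors. Besides the
  dichotomy for the value group, rank one provides that the multiples of a positive value are
  cofinal, which yields indices in a single congruence class tending to infinity. For a trivial
  valuation the topology is discrete and the claim is immediate.\<close>

locale henselian_ac =
  fixes v :: "'k::field_char_0 \<Rightarrow> ereal" and res :: "'k \<Rightarrow> 'f::field_char_0" and ac :: "'k \<Rightarrow> 'f"
  assumes henselian: "henselian_ac_field v res ac"
begin

lemma v_eq_inf_iff [simp]: "v x = \<infinity> \<longleftrightarrow> x = 0"
  and v_not_minf [simp]: "v x \<noteq> -\<infinity>"
  and v_mult: "v (x * y) = v x + v y"
  and v_add: "min (v x) (v y) \<le> v (x + y)"
  and ac_mult: "ac (x * y) = ac x * ac y"
  and ac_0 [simp]: "ac 0 = 0"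
  and ac_unit: "v x = 0 \<Longrightarrow> ac x = res x"
  and res_1 [simp]: "res 1 = 1"
  using henselian unfolding henselian_ac_field_def by blast+

lemma res_add: "v x \<ge> 0 \<Longrightarrow> v y \<ge> 0 \<Longrightarrow> res (x + y) = res x + res y"
  and res_eq_0_iff: "v x \<ge> 0 \<Longrightarrow> res x = 0 \<longleftrightarrow> v x > 0"
  and res_surj: "\<exists>x. v x \<ge> 0 \<and> res x = c"
  using henselian unfolding henselian_ac_field_def val_ring_def by blast+

lemma hensel_monic:
  assumes "lead_coeff p = 1" "\<And>i. v (coeff p i) \<ge> 0" "v a \<ge> 0" "v (poly p a) > 0"
    "v (poly (pderiv p) a) = 0"
  shows "\<exists>b. poly p b = 0 \<and> v (b - a) > 0"
  using henselian assms unfolding henselian_ac_field_def by blast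

lemma v_0 [simp]: "v 0 = \<infinity>"
  by simp

text \<open>The default \<open>w 0 = 0\<close> loses nothing in comparisons of two sides: angular
  components vanish only at \<open>0\<close>, so their equality already matches zeros with zeros,
  and such a pair contributes only \<open>(0, 0)\<close>.\<close>

definition w :: "'k \<Rightarrow> real" where "w x = real_of_ereal (v x)"

lemma v_eq_w: "x \<noteq> 0 \<Longrightarrow> v x = ereal (w x)"
  unfolding w_def by (metis ereal_infinity_cases ereal_real' v_eq_inf_iff v_not_minf)

lemma w_0 [simp]: "w 0 = 0"
  by (simp add: w_def)

lemma w_mult: "x \<noteq> 0 \<Longrightarrow> y \<noteq> 0 \<Longrightarrow> w (x * y) = w x + w y"
  using v_mult[of x y] by (simp add: v_eq_w)

lemma w_1 [simp]: "w 1 = 0"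
  using w_mult[of 1 1] by simp

lemma v_1 [simp]: "v 1 = 0"
  by (simp add: v_eq_w zero_ereal_def)

lemma w_uminus [simp]: "w (- x) = w x"
proof (cases "x = 0")
  case False
  have "w (-1) = 0"
    using w_mult[of "-1" "-1"] by simp
  thus ?thesis
    using w_mult[of "-1" x] False by simp
qed simp

lemma v_uminus [simp]: "v (- x) = v x"
  by (cases "x = 0") (simp_all add: v_eq_w)

lemma v_diff: "min (v x) (v y) \<le> v (x - y)"
  using v_add[of x "- y"] by simp

lemma w_power: "x \<noteq> 0 \<Longrightarrow> w (x ^ n) = n * w x"
  by (induction n) (simp_all add: w_mult algebra_simps)

lemma w_inverse: "w (inverse x) = - w x"
  by (cases "x = 0") (use w_mult[of x "inverse x"] in auto)

lemma w_divide: "x \<noteq> 0 \<Longrightarrow> y \<noteq> 0 \<Longrightarrow> w (x / y) = w x - w y"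
  by (simp add: divide_inverse w_mult w_inverse)

lemma v_divide_ge_0: "z \<noteq> 0 \<Longrightarrow> v z \<le> v x \<Longrightarrow> v (x / z) \<ge> 0"
  by (cases "x = 0") (simp_all add: v_eq_w w_divide)

lemma v_divide_gt_0: "z \<noteq> 0 \<Longrightarrow> v (x / z) > 0 \<longleftrightarrow> v z < v x"
  by (cases "x = 0") (simp_all add: v_eq_w w_divide)

lemma v_divide_eq_0: "z \<noteq> 0 \<Longrightarrow> v (x / z) = 0 \<longleftrightarrow> v x = v z"
  by (cases "x = 0") (simp_all add: v_eq_w w_divide zero_ereal_def)

lemma ac_1 [simp]: "ac 1 = 1"
  by (simp add: ac_unit)

lemma ac_eq_0_iff [simp]: "ac x = 0 \<longleftrightarrow> x = 0"
proof
  assume "ac x = 0"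
  hence "ac (x * inverse x) = 0"
    by (simp add: ac_mult)
  thus "x = 0"
    by (metis ac_1 right_inverse zero_neq_one)
qed simp

lemma ac_power: "ac (x ^ n) = ac x ^ n"
  by (induction n) (simp_all add: ac_mult)

lemma ac_divide: "ac (x / y) = ac x / ac y"
  by (metis ac_0 ac_eq_0_iff ac_mult divide_eq_0_iff eq_divide_eq nonzero_eq_divide_eq)

lemma res_0 [simp]: "res 0 = 0"
  by (simp add: res_eq_0_iff)

lemma v_of_nat_ge_0: "v (of_nat n) \<ge> 0" and res_of_nat [simp]: "res (of_nat n) = of_nat n"
proof -
  have "v (of_nat n) \<ge> 0 \<and> res (of_nat n) = of_nat n"
  proof (induction n)
    case (Suc n)
    have "v (of_nat (Suc n)) \<ge> 0"
      using v_add[of 1 "of_nat n"] Suc by (simp add: min_def split: if_splits)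
    thus ?case
      using Suc res_add[of 1 "of_nat n"] by simp
  qed simp
  thus "v (of_nat n) \<ge> 0" "res (of_nat n) = of_nat n"
    by auto
qed

lemma v_of_nat [simp]: "n > 0 \<Longrightarrow> v (of_nat n) = 0"
  using v_of_nat_ge_0[of n] res_eq_0_iff[of "of_nat n"] by fastforce

lemma w_of_nat [simp]: "w (of_nat n) = 0"
  by (cases "n = 0") (simp_all add: w_def)

lemma ac_of_nat [simp]: "ac (of_nat n) = of_nat n"
  by (cases "n = 0") (simp_all add: ac_unit)

lemma w_fact [simp]: "w (fact n) = 0"
  by (metis of_nat_fact w_of_nat)

lemma ac_fact [simp]: "ac (fact n) = fact n"
  by (metis of_nat_fact ac_of_nat)

lemma v_of_nat_mult: "n > 0 \<Longrightarrow> v (of_nat n * x) = v x"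
  by (simp add: v_mult)

lemma v_sum_ge: "finite I \<Longrightarrow> (\<And>i. i \<in> I \<Longrightarrow> m \<le> v (x i)) \<Longrightarrow> m \<le> v (\<Sum>i\<in>I. x i)"
proof (induction I rule: finite_induct)
  case (insert i I)
  thus ?case
    using v_add[of "x i" "\<Sum>i\<in>I. x i"] by (metis insert_iff min.boundedI order.trans sum.insert)
qed simp

lemma res_sum:
  "finite I \<Longrightarrow> (\<And>i. i \<in> I \<Longrightarrow> 0 \<le> v (x i)) \<Longrightarrow> res (\<Sum>i\<in>I. x i) = (\<Sum>i\<in>I. res (x i))"
proof (induction I rule: finite_induct)
  case (insert i I)
  thus ?case
    using res_add[of "x i" "\<Sum>i\<in>I. x i"] v_sum_ge[of I 0 x] by simp
qed simp

lemma res_divide: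
  assumes "z \<noteq> 0" "v z \<le> v x"
  shows "res (x / z) = (if v x = v z then ac x / ac z else 0)"
proof (cases "v x = v z")
  case True
  thus ?thesis
    using assms ac_unit[of "x / z"] by (simp add: v_divide_eq_0 ac_divide)
next
  case False
  hence "v (x / z) > 0"
    using assms by (simp add: v_divide_gt_0)
  thus ?thesis
    using res_eq_0_iff[of "x / z"] False by simp
qed

text \<open>After division by \<open>z\<close> all terms are integral, and the residue of the sum is
  \<open>A / ac z\<close>, because only terms of valuation \<open>v z\<close> have a nonzero
  residue.\<close>

lemma
  assumes "finite I" "z \<noteq> 0" "\<And>i. i \<in> I \<Longrightarrow> v z \<le> v (x i)"
  defines "A \<equiv> (\<Sum>i | i \<in> I \<and> v (x i) = v z. ac (x i))"
  shows v_sum_eq_iff: "v (\<Sum>i\<in>I. x i) = v z \<longleftrightarrow> A \<noteq> 0"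
    and ac_sum: "v (\<Sum>i\<in>I. x i) = v z \<Longrightarrow> ac (\<Sum>i\<in>I. x i) = A"
proof -
  let ?s = "\<Sum>i\<in>I. x i"
  have ge: "v z \<le> v ?s"
    using assms by (intro v_sum_ge)
  have "res (?s / z) = (\<Sum>i\<in>I. res (x i / z))"
    unfolding sum_divide_distrib using assms by (intro res_sum v_divide_ge_0)
  also have "\<dots> = (\<Sum>i\<in>I. if v (x i) = v z then ac (x i) / ac z else 0)"
    using assms by (intro sum.cong) (simp_all add: res_divide)
  also have "\<dots> = (\<Sum>i | i \<in> I \<and> v (x i) = v z. ac (x i) / ac z)"
    using assms(1) by (simp add: sum.If_cases Int_def)
  also have "\<dots> = A / ac z"
    by (simp add: A_def sum_divide_distrib)
  finally have r: "res (?s / z) = A / ac z" .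
  thus "v ?s = v z \<longleftrightarrow> A \<noteq> 0"
    using res_divide[OF assms(2) ge] assms(2) ge res_eq_0_iff[of "?s / z"]
      v_divide_ge_0[OF assms(2) ge] v_divide_gt_0[OF assms(2), of ?s] by auto
  show "ac ?s = A" if "v ?s = v z"
    using r res_divide[OF assms(2) ge] assms(2) that by simp
qed

section \<open>Cancellation of leading terms in finite sums\<close>

definition no_cancel :: "(nat \<Rightarrow> 'k) \<Rightarrow> nat \<Rightarrow> bool" where
  "no_cancel x d \<longleftrightarrow> (\<forall>i\<le>d. v (\<Sum>i\<le>d. x i) \<le> v (x i))"

text \<open>By the ultrametric inequality, \<open>no_cancel\<close> means that the sum has the
  minimal valuation of its terms. Whether this happens is decided by the sum of the angular
  components over the terms of minimal valuation, and the hypotheses give both sides the same set of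
  such terms.\<close>

lemma cancel_transfer:
  assumes ac: "\<And>i. i \<le> d \<Longrightarrow> ac (x i) = ac (y i)"
    and le: "\<And>i j. i \<le> d \<Longrightarrow> j \<le> d \<Longrightarrow> v (x i) \<le> v (x j) \<longleftrightarrow> v (y i) \<le> v (y j)"
  shows "no_cancel x d \<longleftrightarrow> no_cancel y d"
    and "no_cancel x d \<Longrightarrow> ac (\<Sum>i\<le>d. x i) = ac (\<Sum>i\<le>d. y i)"
    and "no_cancel x d \<Longrightarrow> \<exists>i\<le>d. v (\<Sum>i\<le>d. x i) = v (x i) \<and> v (\<Sum>i\<le>d. y i) = v (y i)"
proof -
  define m where "m = Min ((\<lambda>i. v (x i)) ` {..d})"
  have "m \<in> (\<lambda>i. v (x i)) ` {..d}"
    unfolding m_def by (intro Min_in) auto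
  then obtain k where k: "k \<le> d" "m = v (x k)" by auto
  have xk: "v (x k) \<le> v (x j)" if "j \<le> d" for j
    using that unfolding k(2)[symmetric] m_def by auto
  hence yk: "v (y k) \<le> v (y j)" if "j \<le> d" for j
    using le[OF k(1) that] that by simp
  have z: "x k = 0 \<longleftrightarrow> y k = 0"
    using ac[OF k(1)] by (metis ac_eq_0_iff)
  have nc: "no_cancel x d \<longleftrightarrow> v (\<Sum>i\<le>d. x i) = v (x k)" "no_cancel y d \<longleftrightarrow> v (\<Sum>i\<le>d. y i) = v (y k)"
    using k(1) xk yk v_sum_ge[of "{..d}" "v (x k)" x] v_sum_ge[of "{..d}" "v (y k)" y]
    unfolding no_cancel_def by (auto intro: order.antisym)
  show *: "no_cancel x d \<longleftrightarrow> no_cancel y d" and "no_cancel x d \<Longrightarrow> ac (\<Sum>i\<le>d. x i) = ac (\<Sum>i\<le>d. y i)"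
  proof -
    consider "x k = 0" | "x k \<noteq> 0" by blast
    hence "(no_cancel x d \<longleftrightarrow> no_cancel y d) \<and>
      (no_cancel x d \<longrightarrow> ac (\<Sum>i\<le>d. x i) = ac (\<Sum>i\<le>d. y i))"
    proof cases
      \<comment> \<open>A minimum of infinity forces all terms to vanish on both sides.\<close>
      case 1
      have "x j = 0" "y j = 0" if "j \<le> d" for j
        using xk[OF that] yk[OF that] 1 z by auto
      hence "(\<Sum>i\<le>d. x i) = 0" "(\<Sum>i\<le>d. y i) = 0"
        by (auto intro!: sum.neutral)
      thus ?thesis
        using 1 z nc by simp
    next
      case 2
      have yk0: "y k \<noteq> 0" using 2 z by simp
      have "{i. i \<in> {..d} \<and> v (x i) = v (x k)} = {i. i \<in> {..d} \<and> v (y i) = v (y k)}"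
        using le[OF _ k(1)] xk yk by (auto intro: order.antisym simp: order.eq_iff)
      hence A: "(\<Sum>i | i \<in> {..d} \<and> v (x i) = v (x k). ac (x i)) =
          (\<Sum>i | i \<in> {..d} \<and> v (y i) = v (y k). ac (y i))"
        using ac by (intro sum.cong) auto
      have s: "v (\<Sum>i\<le>d. x i) = v (x k) \<longleftrightarrow> (\<Sum>i | i \<in> {..d} \<and> v (x i) = v (x k). ac (x i)) \<noteq> 0"
        "v (\<Sum>i\<le>d. y i) = v (y k) \<longleftrightarrow> (\<Sum>i | i \<in> {..d} \<and> v (y i) = v (y k). ac (y i)) \<noteq> 0"
        using 2 yk0 xk yk by (intro v_sum_eq_iff; simp)+
      have "ac (\<Sum>i\<le>d. x i) = ac (\<Sum>i\<le>d. y i)"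
        if "v (\<Sum>i\<le>d. x i) = v (x k)" "v (\<Sum>i\<le>d. y i) = v (y k)"
        using ac_sum[OF _ 2 _ that(1)] ac_sum[OF _ yk0 _ that(2)] xk yk A by simp
      thus ?thesis
        using nc s A by simp
    qed
    thus "no_cancel x d \<longleftrightarrow> no_cancel y d" and "no_cancel x d \<Longrightarrow> ac (\<Sum>i\<le>d. x i) = ac (\<Sum>i\<le>d. y i)"
      by auto
  qed
  show "no_cancel x d \<Longrightarrow> \<exists>i\<le>d. v (\<Sum>i\<le>d. x i) = v (x i) \<and> v (\<Sum>i\<le>d. y i) = v (y i)"
    using nc * k(1) by metis
qed

section \<open>Hensel's lemma and centers\<close>

lemma v_power_ge_0: "v x \<ge> 0 \<Longrightarrow> v (x ^ n) \<ge> 0"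
  by (induction n) (simp_all add: v_mult)

lemma v_add_gt_0: "v x > 0 \<Longrightarrow> v y > 0 \<Longrightarrow> v (x + y) > 0"
  using v_add[of x y] by (simp add: min_def split: if_splits)

lemma v_add_unit: "v x = 0 \<Longrightarrow> v y > 0 \<Longrightarrow> v (x + y) = 0"
  using v_add[of x y] v_diff[of "x + y" y] by (auto simp: min_def split: if_splits)

lemma v_sum_gt_0: "finite I \<Longrightarrow> (\<And>i. i \<in> I \<Longrightarrow> v (x i) > 0) \<Longrightarrow> v (\<Sum>i\<in>I. x i) > 0"
  by (induction I rule: finite_induct) (simp_all add: v_add_gt_0)

lemma v_poly_gt_0:
  assumes "\<And>i. v (coeff g i) > 0" "v a \<ge> 0"
  shows "v (poly g a) > 0"
  unfolding poly_altdef using assms v_power_ge_0[OF assms(2)]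
  by (intro v_sum_gt_0) (auto simp: v_mult intro: add_pos_nonneg)

lemma v_neg1_power [simp]: "v ((-1) ^ n) = 0"
  by (induction n) auto

text \<open>The substitution \<open>b = q\<^sub>0 / (q\<^sub>1 u)\<close> turns \<open>q\<close> into a monic polynomial in \<open>u\<close>
  close to \<open>u\<^sup>n + u\<^bsup>n-1\<^esup>\<close>, which has a simple residual root at \<open>-1\<close>.\<close>

lemma hensel_at_0:
  assumes q: "\<And>i. v (coeff q i) \<ge> 0" "v (coeff q 0) > 0" "v (coeff q 1) = 0"
  shows "\<exists>b. poly q b = 0 \<and> v b > 0"
proof (cases "coeff q 0 = 0")
  case True
  thus ?thesis
    by (intro exI[of _ 0]) (simp add: poly_0_coeff_0)
next
  case False
  define q0 q1 where "q0 = coeff q 0" and "q1 = coeff q 1"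
  have q1: "q1 \<noteq> 0" "v q1 = 0" and q0: "q0 \<noteq> 0" "v q0 > 0"
    using q False by (auto simp: q0_def q1_def)
  obtain m where m: "degree q = Suc m"
    using q1(1) le_degree[of q 1] by (cases "degree q") (auto simp: q1_def)
  \<comment> \<open>With \<open>b = q0 / (q1 * u)\<close> and \<open>n = Suc m\<close>, the value of
    \<open>q\<close> at \<open>b\<close> is \<open>q0 / u ^ n\<close> times the sum of
    \<open>r i * u ^ (n - i)\<close>. From \<open>i = 2\<close> on, a factor \<open>q0\<close> of
    positive valuation is left over in \<open>r i\<close>.\<close>
  define r where "r i = coeff q i * q0 ^ i / (q0 * q1 ^ i)" for i
  have r01: "r 0 = 1" "r 1 = 1"
    using q0 q1 by (auto simp: r_def q0_def q1_def)
  have r: "v (r i) > 0" if "i \<ge> 2" for i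
  proof -
    define j where "j = i - 2"
    have "q0 ^ i = q0 * (q0 * q0 ^ j)"
      using that unfolding j_def by (metis power_Suc add_2_eq_Suc le_add_diff_inverse)
    hence "r i = coeff q i * q0 * q0 ^ j * (inverse q1 ^ i)"
      using q0 by (simp add: r_def divide_inverse power_inverse)
    moreover have "v (inverse q1) \<ge> 0"
      using v_divide_ge_0[of q1 1] q1 by (simp add: divide_inverse)
    hence "v (inverse q1 ^ i) \<ge> 0"
      by (rule v_power_ge_0)
    moreover have "v (q0 ^ j) \<ge> 0"
      using q0 by (simp add: v_power_ge_0)
    ultimately show ?thesis
      using q(1)[of i] q0(2) by (simp add: v_mult add_pos_nonneg add_nonneg_pos)
  qed
  define g where "g = (\<Sum>i\<in>{2..Suc m}. monom (r i) (Suc m - i))"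
  define p where "p = monom 1 (Suc m) + monom 1 m + g"
  have cg: "coeff g j = (if j < m then r (Suc m - j) else 0)" for j
  proof -
    have "(Suc m - i = j) = (i = Suc m - j)" if "i \<in> {2..Suc m}" "j \<le> Suc m" for i
      using that by auto
    moreover have "Suc m - i \<noteq> j" if "j > Suc m" for i
      using that by auto
    ultimately have "coeff g j = (\<Sum>i\<in>{2..Suc m}. if i = Suc m - j then if j \<le> Suc m then r i else 0 else 0)"
      unfolding g_def coeff_sum coeff_monom by (intro sum.cong refl) (metis not_le)
    also have "\<dots> = (if Suc m - j \<in> {2..Suc m} then if j \<le> Suc m then r (Suc m - j) else 0 else 0)"
      by (rule sum.delta) simp
    also have "\<dots> = (if j < m then r (Suc m - j) else 0)"
      by auto
    finally show ?thesis .
  qed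
  have vg: "v (coeff g j) > 0" for j
    using r[of "Suc m - j"] by (auto simp: cg)
  have cp: "coeff p j = (if j = Suc m then 1 else if j = m then 1 else if j < m then r (Suc m - j) else 0)" for j
    by (auto simp: p_def cg)
  have dp: "degree p = Suc m"
    by (intro antisym degree_le le_degree) (auto simp: cp)
  have vp: "v (coeff p j) \<ge> 0" for j
    using r[of "Suc m - j"] by (auto simp: cp intro: less_imp_le)
  have vg': "v (coeff (pderiv g) j) > 0" for j
    using vg[of "Suc j"] v_of_nat_mult[of "Suc j" "coeff g (Suc j)"] by (simp add: coeff_pderiv)
  have "poly p (-1) = poly g (-1)"
    by (simp add: p_def poly_monom)
  hence p1: "v (poly p (-1)) > 0"
    using v_poly_gt_0[of g "-1"] vg by simp
  have "poly (monom (of_nat (Suc m)) m + monom (of_nat m) (m - 1)) (-1 :: 'k) = (-1) ^ m"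
    by (cases m) (simp_all add: poly_monom algebra_simps)
  hence "poly (pderiv p) (-1) = (-1) ^ m + poly (pderiv g) (-1)"
    by (simp add: p_def pderiv_add pderiv_monom)
  hence p2: "v (poly (pderiv p) (-1)) = 0"
    using v_poly_gt_0[of "pderiv g" "-1"] vg' by (simp add: v_add_unit)
  obtain u where u: "poly p u = 0" "v (u - (-1)) > 0"
    using hensel_monic[of p "-1"] dp cp vp p1 p2 by auto
  have "v u = 0"
    using v_add_unit[of "-1" "u - (-1)"] u(2) by simp
  hence u0: "u \<noteq> 0" by auto
  define b where "b = q0 / (q1 * u)"
  have "v b = v q0"
    unfolding b_def using \<open>v u = 0\<close> q0 q1 u0 by (simp add: v_eq_w w_divide w_mult zero_ereal_def)
  have "poly q b = (\<Sum>i\<le>Suc m. coeff q i * b ^ i)"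
    by (simp add: poly_altdef m)
  also have "\<dots> = (\<Sum>i\<le>Suc m. q0 / u ^ Suc m * (r i * u ^ (Suc m - i)))"
  proof (intro sum.cong refl)
    fix i assume "i \<in> {..Suc m}"
    hence "u ^ Suc m = u ^ (Suc m - i) * u ^ i"
      by (simp flip: power_add)
    thus "coeff q i * b ^ i = q0 / u ^ Suc m * (r i * u ^ (Suc m - i))"
      using q0 q1 u0 by (simp add: b_def r_def power_divide power_mult_distrib)
  qed
  also have "\<dots> = q0 / u ^ Suc m * (\<Sum>i\<le>Suc m. r i * u ^ (Suc m - i))"
    by (rule sum_distrib_left [symmetric])
  also have "(\<Sum>i\<le>Suc m. r i * u ^ (Suc m - i)) = (\<Sum>j\<le>Suc m. r (Suc m - j) * u ^ j)"
    by (rule sum.reindex_bij_witness[of _ "\<lambda>i. Suc m - i" "\<lambda>i. Suc m - i"]) auto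
  also have "\<dots> = (\<Sum>j\<le>Suc m. coeff p j * u ^ j)"
    using r01 by (intro sum.cong refl) (auto simp: cp Suc_diff_le)
  also have "\<dots> = 0"
    using u(1) by (simp add: poly_altdef dp)
  finally show ?thesis
    using \<open>v b = v q0\<close> q0 by auto
qed

lemma v_coeff_shift_ge_0:
  "(\<And>i. v (coeff q i) \<ge> 0) \<Longrightarrow> v (coeff (pcompose q [:1, 1:]) i) \<ge> 0"
proof (induction q arbitrary: i rule: pCons_induct)
  case (pCons c q)
  have c: "v c \<ge> 0"
    using pCons(3)[of 0] by simp
  have "v (coeff q i) \<ge> 0" for i
    using pCons(3)[of "Suc i"] by simp
  hence IH: "v (coeff (pcompose q [:1,1:]) i) \<ge> 0" for i
    using pCons.IH by blast
  have plus: "v x \<ge> 0 \<Longrightarrow> v y \<ge> 0 \<Longrightarrow> v (x + y) \<ge> 0" for x y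
    using v_add[of x y] by (simp add: min_def split: if_splits)
  have "pcompose (pCons c q) [:1,1:] = [:c:] + (pcompose q [:1,1:] + pCons 0 (pcompose q [:1,1:]))"
    by (simp add: pcompose_pCons)
  hence eq: "coeff (pcompose (pCons c q) [:1,1:]) i =
      (if i = 0 then c else 0) + (coeff (pcompose q [:1,1:]) i +
        (if i = 0 then 0 else coeff (pcompose q [:1,1:]) (i - 1)))"
    by (cases i) simp_all
  show ?case
    unfolding eq using IH c by (intro plus) auto
qed simp

lemma hensel:
  assumes "\<And>i. v (coeff q i) \<ge> 0" "v (poly q 1) > 0" "v (poly (pderiv q) 1) = 0"
  shows "\<exists>b. poly q b = 0 \<and> v (b - 1) > 0"
proof -
  define p where "p = pcompose q [:1, 1:]"
  have "v (coeff p i) \<ge> 0" for i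
    unfolding p_def using assms(1) by (rule v_coeff_shift_ge_0)
  moreover have "coeff p 0 = poly q 1"
    by (simp add: p_def flip: poly_0_coeff_0 add: poly_pcompose)
  moreover have "coeff p 1 = poly (pderiv q) 1"
  proof -
    have "coeff p 1 = poly (pderiv p) 0"
      by (simp add: poly_0_coeff_0 coeff_pderiv)
    thus ?thesis
      by (simp add: p_def pderiv_pcompose poly_pcompose pderiv_pCons)
  qed
  ultimately obtain b where "poly p b = 0" "v b > 0"
    using hensel_at_0[of p] assms by auto
  thus ?thesis
    by (intro exI[of _ "1 + b"]) (simp add: p_def poly_pcompose)
qed

section \<open>Taylor coefficients and centers\<close>

definition tay :: "'k poly \<Rightarrow> 'k \<Rightarrow> nat \<Rightarrow> 'k" where
  "tay f c i = coeff (pcompose f [:c, 1:]) i"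

lemma poly_tay: "degree f \<le> d \<Longrightarrow> poly f a = (\<Sum>i\<le>d. tay f c i * (a - c) ^ i)"
proof -
  assume "degree f \<le> d"
  hence "degree (pcompose f [:c, 1:]) \<le> d"
    by (simp add: degree_pcompose)
  hence "poly (pcompose f [:c, 1:]) (a - c) = (\<Sum>i\<le>d. tay f c i * (a - c) ^ i)"
    unfolding tay_def poly_altdef by (intro sum.mono_neutral_left) (auto simp: coeff_eq_0)
  thus ?thesis
    by (simp add: poly_pcompose)
qed

lemma tay_eq_0: "degree f < i \<Longrightarrow> tay f c i = 0"
  by (simp add: tay_def coeff_eq_0 degree_pcompose)

lemma tay_pderiv: "tay (pderiv f) c i = of_nat (Suc i) * tay f c (Suc i)"
proof -
  have "tay (pderiv f) c i = coeff (pderiv (pcompose f [:c, 1:])) i"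
    by (simp add: tay_def pderiv_pcompose pderiv_pCons)
  thus ?thesis
    by (simp only: coeff_pderiv tay_def)
qed

lemma tay_0: "tay f c 0 = poly f c"
  by (simp add: tay_def poly_pcompose flip: poly_0_coeff_0)

text \<open>Turns data on the values of iterated derivatives into data on Taylor coefficients, since
  \<open>fact i\<close> has valuation zero and a known angular component.\<close>

lemma fact_tay: "fact i * tay f c i = poly ((pderiv ^^ i) f) c"
proof (induction i arbitrary: f)
  case (Suc i)
  have "fact (Suc i) * tay f c (Suc i) = fact i * tay (pderiv f) c i"
    by (simp add: tay_pderiv algebra_simps)
  thus ?case
    using Suc[of "pderiv f"] by (simp add: funpow_swap1)
qed (simp add: tay_0)

text \<open>As a polynomial in \<open>y\<close>, \<open>f (c + b * y)\<close> has the coefficients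
  \<open>x i\<close>. Divided by one of minimal valuation it becomes integral; cancellation makes
  \<open>1\<close> a residual root, and the absence of cancellation in the derivative makes this
  root simple.\<close>

lemma simple_residual_root:
  assumes b: "b \<noteq> 0" and d: "degree f \<le> d"
    and can: "\<not> no_cancel (\<lambda>i. tay f c i * b ^ i) d"
    and nc: "no_cancel (\<lambda>i. tay (pderiv f) c i * b ^ i) d"
  shows "\<exists>y. poly f (c + b * y) = 0 \<and> v (y - 1) > 0"
proof -
  define x where "x i = tay f c i * b ^ i" for i
  define q where "q = pcompose (pcompose f [:c, 1:]) [:0, b:]"
  have cq: "coeff q i = x i" for i
    by (simp add: q_def x_def tay_def coeff_pcompose_linear)
  have pq: "poly q y = poly f (c + b * y)" for y
    by (simp add: q_def poly_pcompose algebra_simps)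
  have x0: "x i = 0" if "i > d" for i
    using that d by (simp add: x_def tay_eq_0)
  have sum_x: "(\<Sum>i\<le>d. x i) = poly f (c + b)"
    using poly_tay[OF d, of "c + b" c] by (simp add: x_def)
  define m where "m = Min ((\<lambda>i. v (x i)) ` {..d})"
  have "m \<in> (\<lambda>i. v (x i)) ` {..d}"
    unfolding m_def by (intro Min_in) auto
  then obtain k where k: "k \<le> d" "m = v (x k)" by auto
  have xk: "v (x k) \<le> v (x j)" for j
  proof (cases "j \<le> d")
    case True
    thus ?thesis unfolding k(2)[symmetric] m_def by auto
  qed (simp add: x0)
  have s_gt: "v (\<Sum>i\<le>d. x i) > v (x k)"
  proof (rule ccontr)
    assume "\<not> ?thesis"
    hence "no_cancel x d"
      unfolding no_cancel_def using xk by (meson not_le order.trans)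
    thus False
      using can unfolding x_def by blast
  qed
  hence xk0: "x k \<noteq> 0" by auto
  \<comment> \<open>A single minimal term could not cancel, so there is one of positive index;
    unlike the term of index \<open>0\<close>, it survives differentiation.\<close>
  have "\<exists>i. 0 < i \<and> i \<le> d \<and> v (x i) = v (x k)"
  proof (rule ccontr)
    assume *: "\<not> ?thesis"
    hence "{i. i \<in> {..d} \<and> v (x i) = v (x k)} = {k}" "k = 0"
      using k(1) by (auto simp: neq0_conv)
    hence "v (\<Sum>i\<le>d. x i) = v (x k)"
      using xk xk0 by (subst v_sum_eq_iff) auto
    thus False
      using s_gt by simp
  qed
  then obtain i where i: "0 < i" "i \<le> d" "v (x i) = v (x k)"
    by blast
  have d': "degree (pderiv f) \<le> d"
    using d by (simp add: degree_pderiv)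
  define z where "z j = tay (pderiv f) c j * b ^ j" for j
  \<comment> \<open>Multiplication by \<open>b\<close> aligns the Taylor terms of the derivative
    with the terms of \<open>f\<close>, up to the units \<open>Suc j\<close>.\<close>
  have bz: "b * z j = of_nat (Suc j) * x (Suc j)" for j
    by (simp add: z_def x_def tay_pderiv)
  have sum_z: "(\<Sum>j\<le>d. z j) = poly (pderiv f) (c + b)"
    using poly_tay[OF d', of "c + b" c] by (simp add: z_def)
  have "v (\<Sum>j\<le>d. z j) \<le> v (z (i - 1))"
    using nc i(2) unfolding no_cancel_def z_def by simp
  hence "v (b * (\<Sum>j\<le>d. z j)) \<le> v (b * z (i - 1))"
    unfolding v_mult by (rule add_left_mono)
  also have "v (b * z (i - 1)) = v (x i)"
    unfolding bz using i(1) v_of_nat_mult[of i] by simp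
  finally have le: "v (b * poly (pderiv f) (c + b)) \<le> v (x k)"
    using i(3) sum_z by simp
  have "v (x k) \<le> v (\<Sum>j\<le>d. b * z j)"
    unfolding bz using v_of_nat_mult[of "Suc _" "x (Suc _)"] xk by (intro v_sum_ge) (simp_all del: of_nat_Suc)
  hence eq: "v (b * poly (pderiv f) (c + b)) = v (x k)"
    using le sum_z by (simp flip: sum_distrib_left)
  define p where "p = smult (inverse (x k)) q"
  have "v (coeff p j) \<ge> 0" for j
    using v_divide_ge_0[OF xk0 xk, of j] by (simp add: p_def cq divide_inverse mult.commute)
  moreover have "v (poly p 1) > 0"
  proof -
    have "poly p 1 = (\<Sum>i\<le>d. x i) / x k"
      by (simp add: p_def pq sum_x divide_inverse mult.commute)
    thus ?thesis
      using s_gt xk0 by (simp add: v_divide_gt_0)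
  qed
  moreover have "v (poly (pderiv p) 1) = 0"
  proof -
    have "poly (pderiv p) 1 = b * poly (pderiv f) (c + b) / x k"
      by (simp add: p_def pderiv_smult q_def pderiv_pcompose poly_pcompose pderiv_pCons divide_inverse mult_ac)
    thus ?thesis
      using eq xk0 by (simp add: v_divide_eq_0)
  qed
  ultimately obtain y where "poly p y = 0" "v (y - 1) > 0"
    using hensel[of p] by blast
  thus ?thesis
    using xk0 by (auto simp: p_def pq)
qed

text \<open>Padding with zero terms is harmless, so one formal degree can serve a whole
  family.\<close>

lemma no_cancel_degree:
  assumes "degree f \<le> d"
  shows "no_cancel (\<lambda>i. tay f c i * b ^ i) d \<longleftrightarrow> no_cancel (\<lambda>i. tay f c i * b ^ i) (degree f)"
proof -
  have "(\<Sum>i\<le>d. tay f c i * b ^ i) = (\<Sum>i\<le>degree f. tay f c i * b ^ i)"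
    using assms by (intro sum.mono_neutral_right) (auto simp: tay_eq_0)
  moreover have "v (tay f c i * b ^ i) = \<infinity>" if "i > degree f" for i
    using that by (simp add: tay_eq_0)
  ultimately show ?thesis
    using assms unfolding no_cancel_def by (metis ereal_less_eq(1) le_trans not_le)
qed

text \<open>Among \<open>0\<close> and the roots of members of \<open>F\<close>, a point \<open>c\<close> nearest to \<open>a\<close> works: if the
  Taylor expansion of some \<open>f \<in> F\<close> at \<open>c\<close> cancelled at \<open>a\<close>, then, for \<open>f\<close> of minimal degree,
  Hensel's lemma would give a root of \<open>f\<close> nearer to \<open>a\<close>.\<close>

lemma center:
  assumes fin: "finite F" and closed: "\<And>f. f \<in> F \<Longrightarrow> pderiv f \<in> F"
  shows "\<exists>c. (c = 0 \<or> (\<exists>g\<in>F. g \<noteq> 0 \<and> poly g c = 0)) \<and>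
    (\<forall>f\<in>F. \<forall>d\<ge>degree f. no_cancel (\<lambda>i. tay f c i * (a - c) ^ i) d)"
proof -
  \<comment> \<open>The point \<open>0\<close> makes \<open>C\<close> nonempty and is easily
    transported: its Taylor coefficients are the coefficients themselves.\<close>
  define C where "C = insert 0 (\<Union>g\<in>F - {0}. {c. poly g c = 0})"
  have C: "finite C" "C \<noteq> {}"
    using fin by (auto simp: C_def poly_roots_finite)
  have "Max ((\<lambda>c. v (a - c)) ` C) \<in> (\<lambda>c. v (a - c)) ` C"
    using C by (intro Max_in) auto
  then obtain c where c: "c \<in> C" "Max ((\<lambda>c. v (a - c)) ` C) = v (a - c)"
    by auto
  have max: "v (a - c') \<le> v (a - c)" if "c' \<in> C" for c'
    unfolding c(2)[symmetric] using C that by auto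
  have "no_cancel (\<lambda>i. tay f c i * (a - c) ^ i) (degree f)" if "f \<in> F" for f
    using that
  proof (induction "degree f" arbitrary: f rule: less_induct)
    case less
    show ?case
    proof (rule ccontr)
      assume can: "\<not> ?case"
      have "a \<noteq> c"
      proof
        assume "a = c"
        hence "no_cancel (\<lambda>i. tay f c i * (a - c) ^ i) (degree f)"
          unfolding no_cancel_def using poly_tay[of f "degree f" a c]
          by (auto simp: power_0_left tay_0)
        with can show False by simp
      qed
      have "degree f = 0 \<Longrightarrow> ?case"
        by (simp add: no_cancel_def)
      hence "degree f \<noteq> 0"
        using can by blast
      hence "no_cancel (\<lambda>i. tay (pderiv f) c i * (a - c) ^ i) (degree (pderiv f))"
        using less.hyps[of "pderiv f"] closed less.prems by (simp add: degree_pderiv)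
      hence "no_cancel (\<lambda>i. tay (pderiv f) c i * (a - c) ^ i) (degree f)"
        by (subst no_cancel_degree) (simp_all add: degree_pderiv)
      then obtain y where y: "poly f (c + (a - c) * y) = 0" "v (y - 1) > 0"
        using simple_residual_root[of "a - c" f "degree f" c] can \<open>a \<noteq> c\<close> by auto
      have "f \<noteq> 0"
        using \<open>degree f \<noteq> 0\<close> by auto
      hence "c + (a - c) * y \<in> C"
        using less.prems y by (auto simp: C_def)
      hence "v (a - (c + (a - c) * y)) \<le> v (a - c)"
        by (rule max)
      moreover have "a - (c + (a - c) * y) = - ((a - c) * (y - 1))"
        by (simp add: algebra_simps)
      ultimately have "v (a - c) + v (y - 1) \<le> v (a - c)"
        by (simp add: v_mult)
      thus False
        using y(2) \<open>a \<noteq> c\<close> by (cases "v (y - 1)") (auto simp: v_eq_w)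
    qed
  qed
  moreover have "c = 0 \<or> (\<exists>g\<in>F. g \<noteq> 0 \<and> poly g c = 0)"
    using c(1) by (auto simp: C_def)
  ultimately show ?thesis
    using no_cancel_degree[of _ _ c "a - c", THEN iffD2] by (intro exI[of _ c] conjI ballI allI impI) auto
qed

section \<open>The value group\<close>

definition VG :: "real set" where "VG = range w"

lemma w_in_VG [simp]: "w x \<in> VG"
  by (simp add: VG_def)

lemma VG_0 [simp]: "0 \<in> VG"
  by (metis w_0 w_in_VG)

lemma VG_add: "x \<in> VG \<Longrightarrow> y \<in> VG \<Longrightarrow> x + y \<in> VG"
proof -
  assume "x \<in> VG" "y \<in> VG"
  then obtain a b where ab: "x = w a" "y = w b"
    by (auto simp: VG_def)
  show ?thesis
  proof (cases "a = 0 \<or> b = 0")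
    case False
    thus ?thesis
      using w_mult[of a b] ab by (metis w_in_VG)
  qed (auto simp: ab)
qed

lemma VG_uminus: "x \<in> VG \<Longrightarrow> - x \<in> VG"
  by (auto simp: VG_def simp flip: w_inverse)

lemma VG_diff: "x \<in> VG \<Longrightarrow> y \<in> VG \<Longrightarrow> x - y \<in> VG"
  using VG_add[of x "- y"] VG_uminus[of y] by simp

lemma VG_of_nat_mult: "x \<in> VG \<Longrightarrow> of_nat n * x \<in> VG"
  by (induction n) (simp_all add: VG_add algebra_simps)

lemma VG_of_int_mult: "x \<in> VG \<Longrightarrow> of_int n * x \<in> VG"
  using VG_of_nat_mult[of x "nat n"] VG_uminus[OF VG_of_nat_mult[of x "nat (- n)"]]
  by (cases "n \<ge> 0") auto

lemma VG_sum: "(\<And>i. i \<in> I \<Longrightarrow> f i \<in> VG) \<Longrightarrow> (\<Sum>i\<in>I. f i) \<in> VG"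
  by (induction I rule: infinite_finite_induct) (simp_all add: VG_add)

text \<open>Value and angular component can be prescribed independently: an element of value
  \<open>g\<close> is corrected by a unit with the required residue. This realises in
  \<open>K\<close> what has been found at the level of values.\<close>

lemma ex_w_ac:
  assumes "g \<in> VG" "b \<noteq> 0"
  shows "\<exists>x. x \<noteq> 0 \<and> w x = g \<and> ac x = ac b"
proof -
  obtain z where z: "z \<noteq> 0" "w z = g"
    using assms(1) by (metis VG_def imageE w_0 w_1 zero_neq_one)
  obtain u where u: "v u \<ge> 0" "res u = ac b / ac z"
    using res_surj by blast
  have "ac b / ac z \<noteq> 0"
    using assms z by simp
  hence vu: "v u = 0"
    using u res_eq_0_iff[of u] by force
  hence "u \<noteq> 0" by auto
  have "w u = 0"
    using vu by (simp add: w_def)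
  thus ?thesis
    using z u vu \<open>u \<noteq> 0\<close> by (intro exI[of _ "z * u"]) (simp add: w_mult ac_mult ac_unit)
qed

text \<open>Linear terms with coefficients of size at most \<open>B\<close>, evaluated with the same
  coefficients on both sides. \<open>S\<close> is a relation rather than a function, so one value
  may occur in several pairs.\<close>

definition comb :: "nat \<Rightarrow> (real \<times> real) set \<Rightarrow> (real \<times> real) set" where
  "comb B S = {(\<Sum>s\<in>S. of_int (c s) * fst s, \<Sum>s\<in>S. of_int (c s) * snd s) | c :: real \<times> real \<Rightarrow> int.
     \<forall>s\<in>S. \<bar>c s\<bar> \<le> int B}"

lemma combI:
  "(\<And>s. s \<in> S \<Longrightarrow> \<bar>c s\<bar> \<le> int B) \<Longrightarrow> x = (\<Sum>s\<in>S. of_int (c s) * fst s) \<Longrightarrow>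
    y = (\<Sum>s\<in>S. of_int (c s) * snd s) \<Longrightarrow> (x, y) \<in> comb B S"
  unfolding comb_def by blast

lemma combE:
  assumes "(x, y) \<in> comb B S"
  obtains c where "\<forall>s\<in>S. \<bar>c s\<bar> \<le> int B" "x = (\<Sum>s\<in>S. of_int (c s) * fst s)"
    "y = (\<Sum>s\<in>S. of_int (c s) * snd s)"
  using assms unfolding comb_def by auto

lemma comb_0: "(0, 0) \<in> comb B S"
  by (rule combI[of _ "\<lambda>_. 0"]) auto

lemma comb_mono: "A \<le> B \<Longrightarrow> comb A S \<subseteq> comb B S"
  unfolding comb_def by fastforce

lemma comb_mono_set:
  assumes "finite S'" "S \<subseteq> S'"
  shows "comb B S \<subseteq> comb B S'"
proof clarify
  fix x y assume "(x, y) \<in> comb B S"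
  then obtain c where c: "\<forall>s\<in>S. \<bar>c s\<bar> \<le> int B" "x = (\<Sum>s\<in>S. of_int (c s) * fst s)"
    "y = (\<Sum>s\<in>S. of_int (c s) * snd s)"
    unfolding comb_def by auto
  show "(x, y) \<in> comb B S'"
    using c assms by (intro combI[of _ "\<lambda>s. if s \<in> S then c s else 0"])
      (auto simp: sum.mono_neutral_cong_left[OF assms])
qed

lemma comb_member: "finite S \<Longrightarrow> s \<in> S \<Longrightarrow> B \<ge> 1 \<Longrightarrow> s \<in> comb B S"
  using combI[of S "\<lambda>t. if t = s then 1 else 0" B "fst s" "snd s"]
  by (simp add: if_distrib if_distribR sum.delta' cong: if_cong)

lemma comb_add:
  assumes "(x, x') \<in> comb A S" "(y, y') \<in> comb B S"
  shows "(x + y, x' + y') \<in> comb (A + B) S"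
proof -
  obtain c where c: "\<forall>s\<in>S. \<bar>c s\<bar> \<le> int A" "x = (\<Sum>s\<in>S. of_int (c s) * fst s)"
    "x' = (\<Sum>s\<in>S. of_int (c s) * snd s)"
    using assms(1) by (rule combE)
  obtain d where d: "\<forall>s\<in>S. \<bar>d s\<bar> \<le> int B" "y = (\<Sum>s\<in>S. of_int (d s) * fst s)"
    "y' = (\<Sum>s\<in>S. of_int (d s) * snd s)"
    using assms(2) by (rule combE)
  have "\<bar>c s + d s\<bar> \<le> int (A + B)" if "s \<in> S" for s
    using c(1) d(1) that by fastforce
  thus ?thesis
    using c d by (intro combI[of _ "\<lambda>s. c s + d s"]) (auto simp: sum.distrib algebra_simps)
qed

lemma comb_scale:
  assumes "(x, x') \<in> comb A S" "\<bar>k\<bar> \<le> int B"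
  shows "(of_int k * x, of_int k * x') \<in> comb (B * A) S"
proof -
  obtain c where c: "\<forall>s\<in>S. \<bar>c s\<bar> \<le> int A" "x = (\<Sum>s\<in>S. of_int (c s) * fst s)"
    "x' = (\<Sum>s\<in>S. of_int (c s) * snd s)"
    using assms(1) by (rule combE)
  have "\<bar>k * c s\<bar> \<le> int (B * A)" if "s \<in> S" for s
    unfolding abs_mult of_nat_mult using c(1) that assms(2) by (intro mult_mono) auto
  thus ?thesis
    using c by (intro combI[of _ "\<lambda>s. k * c s"]) (auto simp: sum_distrib_left algebra_simps)
qed

lemma comb_uminus: "(x, x') \<in> comb A S \<Longrightarrow> (- x, - x') \<in> comb A S"
  using comb_scale[of x x' A S "-1" 1] by simp

lemma comb_diff:
  "(x, x') \<in> comb A S \<Longrightarrow> (y, y') \<in> comb B S \<Longrightarrow> (x - y, x' - y') \<in> comb (A + B) S"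
  using comb_add[of x x' A S "- y" "- y'" B] comb_uminus by simp

lemma comb_insert:
  assumes "finite S" "(y, y') \<in> comb N (insert (h, h') S)"
  shows "\<exists>k z z'. \<bar>k\<bar> \<le> int N \<and> (z, z') \<in> comb N S \<and> y = of_int k * h + z \<and> y' = of_int k * h' + z'"
proof (cases "(h, h') \<in> S")
  case True
  thus ?thesis
    using assms by (intro exI[of _ 0] exI[of _ y] exI[of _ y']) (simp add: insert_absorb)
next
  case False
  obtain c where c: "\<forall>s\<in>insert (h, h') S. \<bar>c s\<bar> \<le> int N"
    "y = (\<Sum>s\<in>insert (h, h') S. of_int (c s) * fst s)"
    "y' = (\<Sum>s\<in>insert (h, h') S. of_int (c s) * snd s)"
    using assms(2) by (rule combE)
  show ?thesis
    using c False assms(1)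
    by (intro exI[of _ "c (h, h')"] exI[of _ "\<Sum>s\<in>S. of_int (c s) * fst s"]
        exI[of _ "\<Sum>s\<in>S. of_int (c s) * snd s"]) (auto intro: combI)
qed

lemma finite_comb:
  assumes "finite S"
  shows "finite (comb B S)"
proof -
  have "comb B S \<subseteq> (\<lambda>c. (\<Sum>s\<in>S. of_int (c s) * fst s, \<Sum>s\<in>S. of_int (c s) * snd s)) `
      (S \<rightarrow>\<^sub>E {- int B .. int B})"
  proof clarify
    fix x y assume "(x, y) \<in> comb B S"
    then obtain c where c: "\<forall>s\<in>S. \<bar>c s\<bar> \<le> int B" "x = (\<Sum>s\<in>S. of_int (c s) * fst s)"
      "y = (\<Sum>s\<in>S. of_int (c s) * snd s)"
      unfolding comb_def by auto
    have "restrict c S \<in> S \<rightarrow>\<^sub>E {- int B .. int B}"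
      using c(1) by (fastforce simp: abs_le_iff)
    moreover have "(x, y) = (\<Sum>s\<in>S. of_int (restrict c S s) * fst s, \<Sum>s\<in>S. of_int (restrict c S s) * snd s)"
      using c by simp
    ultimately show "(x, y) \<in> (\<lambda>c. (\<Sum>s\<in>S. of_int (c s) * fst s, \<Sum>s\<in>S. of_int (c s) * snd s)) `
      (S \<rightarrow>\<^sub>E {- int B .. int B})"
      by (intro image_eqI[of _ _ "restrict c S"])
  qed
  thus ?thesis
    by (rule finite_subset) (intro finite_imageI finite_PiE assms, simp)
qed

text \<open>The modulus \<open>fact N\<close> allows division by all positive integers up to \<open>N\<close>; corresponding
  elements are congruent to each other, which is stronger than satisfying the same congruences.\<close>

definition compat :: "nat \<Rightarrow> (real \<times> real) set \<Rightarrow> bool" where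
  "compat N S \<longleftrightarrow> finite S \<and> S \<subseteq> VG \<times> VG \<and> (\<forall>(x, y)\<in>comb N S. x > 0 \<longleftrightarrow> y > 0) \<and>
     (\<forall>(x, y)\<in>S. \<exists>u\<in>VG. x - y = fact N * u)"

lemma compat_finite: "compat N S \<Longrightarrow> finite S"
  by (simp add: compat_def)

lemma compat_cong: "compat N S \<Longrightarrow> (x, y) \<in> S \<Longrightarrow> \<exists>u\<in>VG. x - y = fact N * u"
  by (auto simp: compat_def)

lemma compat_pos: "compat N S \<Longrightarrow> (x, y) \<in> comb B S \<Longrightarrow> B \<le> N \<Longrightarrow> x > 0 \<longleftrightarrow> y > 0"
  unfolding compat_def using comb_mono[of B N S] by blast

lemma compat_neg: "compat N S \<Longrightarrow> (x, y) \<in> comb B S \<Longrightarrow> B \<le> N \<Longrightarrow> x < 0 \<longleftrightarrow> y < 0"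
  using compat_pos[of N S "- x" "- y" B] comb_uminus by simp

lemma compat_eq_0: "compat N S \<Longrightarrow> (x, y) \<in> comb B S \<Longrightarrow> B \<le> N \<Longrightarrow> x = 0 \<longleftrightarrow> y = 0"
  using compat_pos compat_neg by (metis not_less_iff_gr_or_eq)

lemma compat_le:
  assumes "compat N S" "(x, x') \<in> comb A S" "(y, y') \<in> comb B S" "A + B \<le> N"
  shows "x \<le> y \<longleftrightarrow> x' \<le> y'"
  using compat_pos[OF assms(1) comb_diff[OF assms(2,3)] assms(4)] by auto

lemma comb_VG: "S \<subseteq> VG \<times> VG \<Longrightarrow> (x, y) \<in> comb B S \<Longrightarrow> x \<in> VG \<and> y \<in> VG"
  unfolding comb_def by (auto intro!: VG_sum VG_of_int_mult)

lemma comb_cong: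
  assumes "compat N S" "(x, y) \<in> comb B S"
  shows "\<exists>u\<in>VG. x - y = fact N * u"
proof -
  obtain c where c: "x = (\<Sum>s\<in>S. of_int (c s) * fst s)" "y = (\<Sum>s\<in>S. of_int (c s) * snd s)"
    using assms(2) by (rule combE)
  have "\<forall>s\<in>S. \<exists>u\<in>VG. fst s - snd s = fact N * u"
    using assms(1) unfolding compat_def by auto
  then obtain u where u: "\<And>s. s \<in> S \<Longrightarrow> u s \<in> VG \<and> fst s - snd s = fact N * u s"
    by metis
  have "x - y = (\<Sum>s\<in>S. of_int (c s) * (fst s - snd s))"
    by (simp add: c sum_subtractf algebra_simps)
  also have "\<dots> = (\<Sum>s\<in>S. fact N * (of_int (c s) * u s))"
    using u by (intro sum.cong) auto
  finally show ?thesis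
    using u by (intro bexI[of _ "\<Sum>s\<in>S. of_int (c s) * u s"])
      (auto simp: sum_distrib_left intro!: VG_sum VG_of_int_mult)
qed

lemma fact_cong:
  assumes "M \<le> N" "u \<in> VG"
  shows "\<exists>u'\<in>VG. fact N * u = fact M * u'"
proof -
  have "(fact M :: nat) dvd fact N"
    using assms(1) by (rule fact_dvd)
  then obtain k where "fact N = fact M * (k :: nat)"
    by blast
  hence "(fact N :: real) = fact M * of_nat k"
    by (metis of_nat_fact of_nat_mult)
  thus ?thesis
    using assms(2) VG_of_nat_mult by (intro bexI[of _ "of_nat k * u"]) auto
qed

lemma compat_mono:
  assumes "compat N' S'" "S \<subseteq> S'" "N \<le> N'"
  shows "compat N S"
proof -
  have "finite S'" using assms(1) by (rule compat_finite)
  have "finite S" using \<open>finite S'\<close> assms(2) by (rule finite_subset[rotated])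
  moreover have "\<forall>(x, y)\<in>comb N S. x > 0 \<longleftrightarrow> y > 0"
    using compat_pos[OF assms(1) _ assms(3)] comb_mono_set[OF \<open>finite S'\<close> assms(2)] by blast
  moreover have "\<exists>u\<in>VG. x - y = fact N * u" if xy: "(x, y) \<in> S" for x y
  proof -
    obtain u where u: "u \<in> VG" "x - y = fact N' * u"
      using compat_cong[OF assms(1)] assms(2) xy by blast
    thus ?thesis
      using fact_cong[OF assms(3) u(1)] by simp
  qed
  ultimately show ?thesis
    using assms unfolding compat_def by blast
qed

lemma compat_converse:
  assumes "compat N S"
  shows "compat N (prod.swap ` S)"
proof -
  have "(y, x) \<in> comb N S" if xy: "(x, y) \<in> comb N (prod.swap ` S)" for x y
  proof -
    obtain c where c: "\<forall>s\<in>prod.swap ` S. \<bar>c s\<bar> \<le> int N"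
      "x = (\<Sum>s\<in>prod.swap ` S. of_int (c s) * fst s)" "y = (\<Sum>s\<in>prod.swap ` S. of_int (c s) * snd s)"
      using xy by (rule combE)
    show ?thesis
      using c by (intro combI[of _ "\<lambda>s. c (prod.swap s)"]) (auto simp: sum.reindex)
  qed
  moreover have "\<exists>u\<in>VG. x - y = fact N * u" if xy: "(y, x) \<in> S" for x y
  proof -
    obtain u where "u \<in> VG" "y - x = fact N * u"
      using compat_cong[OF assms xy] by blast
    hence "x - y = fact N * (- u)"
      by simp
    thus ?thesis
      using VG_uminus[OF \<open>u \<in> VG\<close>] by blast
  qed
  hence "\<forall>(x, y)\<in>prod.swap ` S. \<exists>u\<in>VG. x - y = fact N * u"
    by auto
  moreover have "finite (prod.swap ` S)" "prod.swap ` S \<subseteq> VG \<times> VG"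
    using assms unfolding compat_def by auto
  moreover have "\<forall>(x, y)\<in>comb N S. x > 0 \<longleftrightarrow> y > 0"
    using assms unfolding compat_def by blast
  ultimately show ?thesis
    unfolding compat_def by blast
qed

text \<open>A combination at level \<open>N\<close> uses \<open>p\<close> at most \<open>N\<close>
  times, hence unfolds into one over \<open>S\<close> with coefficients up to
  \<open>N * B + N\<close>.\<close>

lemma compat_insert_comb:
  assumes S: "compat (N + N * B) S" and p: "p \<in> comb B S"
  shows "compat N (insert p S)"
proof -
  obtain h h' where hh: "p = (h, h')" by (cases p)
  have "x > 0 \<longleftrightarrow> y > 0" if xy: "(x, y) \<in> comb N (insert p S)" for x y
  proof -
    obtain k z z' where kz: "\<bar>k\<bar> \<le> int N" "(z, z') \<in> comb N S" "x = of_int k * h + z" "y = of_int k * h' + z'"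
      using comb_insert[OF compat_finite[OF S] xy[unfolded hh]] by auto
    have "(x, y) \<in> comb (N * B + N) S"
      unfolding kz(3,4) using p kz by (intro comb_add comb_scale) (auto simp: hh)
    thus ?thesis
      using compat_pos[OF S] by (simp add: add.commute)
  qed
  moreover have "\<exists>u\<in>VG. x - y = fact N * u" if xy: "(x, y) \<in> insert p S" for x y
  proof -
    have "(x, y) \<in> comb (max B 1) S"
      using xy p comb_mono[of B "max B 1" S] comb_member[OF compat_finite[OF S], of "(x, y)" "max B 1"] by auto
    then obtain u where "u \<in> VG" "x - y = fact (N + N * B) * u"
      using comb_cong[OF S] by blast
    thus ?thesis
      using fact_cong[of N "N + N * B" u] by auto
  qed
  moreover have "p \<in> VG \<times> VG"
    using comb_VG[of S h h' B] p S by (auto simp: hh compat_def)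
  ultimately show ?thesis
    using S unfolding compat_def by blast
qed

text \<open>In the applications \<open>W\<close> varies with the assignments; therefore
  \<open>N'\<close> may depend only on the number of added pairs and on the size of their
  coefficients.\<close>

lemma compat_union_comb:
  "\<exists>N'\<ge>N. \<forall>S W. compat N' S \<longrightarrow> W \<subseteq> comb B S \<longrightarrow> finite W \<longrightarrow> card W \<le> k \<longrightarrow> compat N (S \<union> W)"
proof (induction k arbitrary: N)
  case 0
  show ?case by (intro exI[of _ N]) auto
next
  case (Suc k)
  obtain N' where N': "N' \<ge> N" "\<And>S W. compat N' S \<Longrightarrow> W \<subseteq> comb B S \<Longrightarrow> finite W \<Longrightarrow> card W \<le> k \<Longrightarrow> compat N (S \<union> W)"
    using Suc[of N] by blast
  have "compat N (S \<union> W)" if g: "compat (N' + N' * B) S" "W \<subseteq> comb B S" "finite W" "card W \<le> Suc k" for S W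
  proof (cases "W = {}")
    case True
    thus ?thesis
      using compat_mono[OF g(1)] N'(1) by simp
  next
    case False
    then obtain p V where pV: "W = insert p V" "p \<notin> V"
      by (metis all_not_in_conv mk_disjoint_insert)
    have "compat N' (insert p S)"
      using g(1) by (rule compat_insert_comb) (use g pV in auto)
    moreover have "V \<subseteq> comb B (insert p S)"
      using comb_mono_set[of "insert p S" S B] compat_finite[OF g(1)] g(2) pV by blast
    ultimately have "compat N (insert p S \<union> V)"
      using g pV by (intro N') auto
    thus ?thesis
      using pV by simp
  qed
  thus ?case
    using N'(1) by (intro exI[of _ "N' + N' * B"]) auto
qed

end

section \<open>Discrete and dense value groups; extension by one value\<close>

locale nontrivial_henselian_ac = henselian_ac v res ac
  for v :: "'k::field_char_0 \<Rightarrow> ereal" and res :: "'k \<Rightarrow> 'f::field_char_0" and ac :: "'k \<Rightarrow> 'f" +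
  assumes nontrivial: "\<exists>x. w x \<noteq> 0"
begin

text \<open>\<open>eps\<close> is the least positive element of the value group if there is one, and \<open>0\<close> otherwise.
  The two properties below treat discrete and dense value groups uniformly.\<close>

definition is_eps :: "real \<Rightarrow> bool" where
  "is_eps e \<longleftrightarrow> e \<in> VG \<and> e \<ge> 0 \<and>
     (\<forall>x\<in>VG. \<forall>J::nat. 0 < x \<and> x \<le> real J * e \<longrightarrow> (\<exists>j\<le>J. x = real j * e)) \<and>
     (\<forall>p q r. \<forall>J::nat. J \<ge> 1 \<and> q - p > real J * e \<longrightarrow> (\<exists>u\<in>VG. p < real J * u + r \<and> real J * u + r < q))"

lemma VG_pos_ex: "\<exists>g\<in>VG. g > 0"
proof -
  obtain x where "w x \<noteq> 0" using nontrivial by blast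
  thus ?thesis
    using VG_uminus[of "w x"] w_in_VG[of x] by (cases "w x > 0") (auto intro: bexI[of _ "- w x"])
qed

text \<open>Let \<open>u\<close> run through the integral multiples of \<open>g\<close>: the
  resulting progression has step \<open>J * g\<close>, which is shorter than the interval.\<close>

lemma coset_meets_interval:
  fixes p q r g :: real and J :: nat
  assumes g: "g \<in> VG" "g > 0" and J: "J \<ge> 1" "q - p > real J * g"
  shows "\<exists>u\<in>VG. p < J * u + r \<and> J * u + r < q"
proof -
  define k where "k = \<lfloor>(p - r) / (real J * g)\<rfloor> + 1"
  have Jg: "real J * g > 0" using g J by simp
  have "(p - r) / (real J * g) < k" "real_of_int k - 1 \<le> (p - r) / (real J * g)"
    unfolding k_def by linarith+
  hence "p - r < k * (real J * g)" "k * (real J * g) \<le> p - r + J * g"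
    unfolding pos_divide_less_eq[OF Jg] pos_le_divide_eq[OF Jg] by (auto simp: algebra_simps)
  thus ?thesis
    using J(2) by (intro bexI[of _ "of_int k * g"] VG_of_int_mult g(1)) (auto simp: algebra_simps)
qed

lemma ex_eps: "\<exists>e. is_eps e"
proof (cases "\<exists>e\<in>VG. e > 0 \<and> (\<forall>g\<in>VG. g > 0 \<longrightarrow> e \<le> g)")
  case True
  then obtain e where e: "e \<in> VG" "e > 0" "\<And>g. g \<in> VG \<Longrightarrow> g > 0 \<Longrightarrow> e \<le> g"
    by blast
  have "\<exists>j\<le>J. x = real j * e" if x: "x \<in> VG" "0 < x" "x \<le> J * e" for x :: real and J :: nat
  proof -
    define k where "k = \<lfloor>x / e\<rfloor>"
    have k: "k \<le> x / e" "x / e < k + 1"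
      unfolding k_def by linarith+
    hence k': "k * e \<le> x" "x < k * e + e"
      using e(2) by (simp_all add: field_simps)
    have "x - of_int k * e \<in> VG"
      using x e by (intro VG_diff VG_of_int_mult)
    hence "x = of_int k * e"
      using e(3)[of "x - of_int k * e"] k' by force
    moreover have "k \<ge> 0"
      unfolding k_def using x(2) e(2) by simp
    ultimately have "x = real (nat k) * e"
      by simp
    moreover from this have "nat k \<le> J"
      using x(3) e(2) by simp
    ultimately show ?thesis by blast
  qed
  thus ?thesis
    using e coset_meets_interval[OF e(1,2)] unfolding is_eps_def by (intro exI[of _ e]) auto
next
  case False
  \<comment> \<open>If the positive values had an infimum above \<open>0\<close>, two distinct ones
    below twice that infimum would have a positive difference below the infimum.\<close>
  have small: "\<exists>g\<in>VG. 0 < g \<and> g < t" if "t > 0" for t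
  proof (rule ccontr)
    assume no: "\<not> ?thesis"
    define P where "P = {g \<in> VG. g > 0}"
    have P: "P \<noteq> {}" "bdd_below P"
      using VG_pos_ex by (auto simp: P_def intro!: bdd_belowI[of _ 0])
    have "t \<le> Inf P"
      using P no by (intro cInf_greatest) (auto simp: P_def)
    hence "Inf P < 2 * Inf P"
      using that by simp
    then obtain g where g: "g \<in> P" "g < 2 * Inf P"
      using cInf_lessD[OF P(1)] by blast
    then obtain h where h: "h \<in> P" "h < g"
      using False by (auto simp: P_def not_le)
    have "g - h \<in> P"
      using g h by (auto simp: P_def intro: VG_diff)
    hence "Inf P \<le> g - h" "Inf P \<le> h"
      using P h by (auto intro: cInf_lower)
    thus False
      using g by simp
  qed
  have "\<exists>u\<in>VG. p < J * u + r \<and> J * u + r < q" if "J \<ge> 1" "q - p > 0" for p q r and J :: nat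
  proof -
    obtain g where "g \<in> VG" "0 < g" "g < (q - p) / J"
      using small[of "(q - p) / J"] \<open>J \<ge> 1\<close> \<open>q - p > 0\<close> by auto
    thus ?thesis
      using \<open>J \<ge> 1\<close> by (intro coset_meets_interval[of g]) (auto simp: field_simps)
  qed
  thus ?thesis
    unfolding is_eps_def by (intro exI[of _ 0]) auto
qed

definition eps :: real where "eps = (SOME e. is_eps e)"

lemma is_eps_eps: "is_eps eps"
  unfolding eps_def using ex_eps by (rule someI_ex)

lemma eps_multiple: "x \<in> VG \<Longrightarrow> 0 < x \<Longrightarrow> x \<le> real J * eps \<Longrightarrow> \<exists>j\<le>J. x = real j * eps"
  and eps_interval: "J \<ge> 1 \<Longrightarrow> q - p > real J * eps \<Longrightarrow> \<exists>u\<in>VG. p < real J * u + r \<and> real J * u + r < q"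
  and eps_ge_0: "eps \<ge> 0" and eps_VG: "eps \<in> VG"
  using is_eps_eps unfolding is_eps_def by blast+

lemma finite_gap:
  fixes A B :: "real set"
  assumes "finite A" "finite B" "\<And>a b. a \<in> A \<Longrightarrow> b \<in> B \<Longrightarrow> b - a > t"
  shows "\<exists>P Q. Q - P > t \<and> (\<forall>a\<in>A. a \<le> P) \<and> (\<forall>b\<in>B. Q \<le> b)"
proof (cases "A = {}"; cases "B = {}")
  assume "A \<noteq> {}" "B \<noteq> {}"
  thus ?thesis
    using assms by (intro exI[of _ "Max A"] exI[of _ "Min B"]) auto
next
  assume "A \<noteq> {}" "B = {}"
  thus ?thesis
    using assms by (intro exI[of _ "Max A"] exI[of _ "Max A + t + 1"]) auto
next
  assume "A = {}" "B \<noteq> {}"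
  thus ?thesis
    using assms by (intro exI[of _ "Min B - t - 1"] exI[of _ "Min B"]) auto
next
  assume "A = {}" "B = {}"
  thus ?thesis
    by (intro exI[of _ 0] exI[of _ "t + 1"]) auto
qed

text \<open>Combinations omitting the new pair are covered by \<open>S\<close>, and negation
  exchanges the signs of its coefficient, so only positive coefficients \<open>k\<close> have to be
  examined.\<close>

lemma compat_insertI:
  assumes S: "compat N' S" "N \<le> N'" and h: "h \<in> VG" "h' \<in> VG" and cong: "h' - h = fact N * u" "u \<in> VG"
    and pos: "\<And>k z z'. 0 < k \<Longrightarrow> k \<le> int N \<Longrightarrow> (z, z') \<in> comb N S \<Longrightarrow>
      (0 < of_int k * h + z \<longleftrightarrow> 0 < of_int k * h' + z') \<and> (of_int k * h + z < 0 \<longleftrightarrow> of_int k * h' + z' < 0)"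
  shows "compat N (insert (h, h') S)"
proof -
  have "x > 0 \<longleftrightarrow> y > 0" if xy: "(x, y) \<in> comb N (insert (h, h') S)" for x y
  proof -
    obtain k z z' where kz: "\<bar>k\<bar> \<le> int N" "(z, z') \<in> comb N S" "x = of_int k * h + z" "y = of_int k * h' + z'"
      using comb_insert[OF compat_finite[OF S(1)] xy] by blast
    consider "k = 0" | "k > 0" | "k < 0" by linarith
    thus ?thesis
    proof cases
      case 1
      thus ?thesis using kz compat_pos[OF S(1) kz(2) S(2)] by simp
    next
      case 2
      thus ?thesis using kz pos[of k z z'] by simp
    next
      case 3
      hence "(0 < of_int (- k) * h + - z \<longleftrightarrow> 0 < of_int (- k) * h' + - z') \<and>
          (of_int (- k) * h + - z < 0 \<longleftrightarrow> of_int (- k) * h' + - z' < 0)"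
        using kz(1) comb_uminus[OF kz(2)] by (intro pos) auto
      moreover have "of_int (- k) * h + - z = - x" "of_int (- k) * h' + - z' = - y"
        using kz by simp_all
      ultimately have "(0 < - x \<longleftrightarrow> 0 < - y) \<and> (- x < 0 \<longleftrightarrow> - y < 0)"
        by (simp only:)
      thus ?thesis by simp
    qed
  qed
  moreover have "h - h' = fact N * (- u)"
    using cong(1) by simp
  ultimately show ?thesis
    using compat_mono[OF S(1) order.refl S(2)] h VG_uminus[OF cong(2)]
    unfolding compat_def by blast
qed

text \<open>After clearing denominators, each condition on \<open>h\<close> compares
  \<open>L * h\<close> with a combination of \<open>S\<close>. If \<open>L * h\<close> equals one,
  its counterpart dictates \<open>L * h'\<close>. Otherwise \<open>L * h\<close> lies in a gap
  between finitely many combinations, and the corresponding gap on the other side is wide enough to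
  contain some \<open>L * h'\<close> with \<open>h'\<close> in the right congruence class.\<close>

lemma compat_extend:
  "\<exists>N'\<ge>N. \<forall>S h. compat N' S \<longrightarrow> (eps, eps) \<in> S \<longrightarrow> h \<in> VG \<longrightarrow> (\<exists>h'\<in>VG. compat N (insert (h, h') S))"
proof -
  \<comment> \<open>\<open>L\<close> is divisible by every \<open>k \<le> N\<close>, and
    \<open>M\<close> bounds the combinations \<open>(L / k) * z\<close> that arise. Changing
    \<open>h\<close> by a multiple of \<open>fact N\<close> changes \<open>L * h\<close> by a
    multiple of \<open>J\<close>; \<open>M'\<close> leaves room for shifts by up to \<open>J\<close>
    copies of \<open>eps\<close>, and \<open>N'\<close> dominates the levels of all comparisons
    below.\<close>
  define L :: nat where "L = fact N"
  define M where "M = N * L"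
  define J where "J = L * fact N"
  define M' where "M' = M + J"
  define N' where "N' = N * M' + L * N + 2 * M + J + 2 * N"
  have L: "real L > 0" "L > 0" by (auto simp: L_def)
  have "\<exists>h'\<in>VG. compat N (insert (h, h') S)"
    if S: "compat N' S" "(eps, eps) \<in> S" and h: "h \<in> VG" for S h
  proof (cases "\<exists>(x, x')\<in>comb M' S. L * h = x")
    case True
    then obtain x x' where x: "(x, x') \<in> comb M' S" "L * h = x"
      by blast
    have "\<exists>u\<in>VG. x - x' = fact N' * u"
      using S(1) x(1) by (rule comb_cong)
    \<comment> \<open>The difference \<open>x - x'\<close> must be divisible by
      \<open>L * fact N\<close>, so that the congruence modulo \<open>fact N\<close> survives
      division by \<open>L\<close>.\<close>
    moreover have "fact (N + N) dvd (fact N' :: nat)"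
      by (intro fact_dvd) (simp add: N'_def)
    then obtain m where "fact N' = (fact N * fact N * m :: nat)"
      using fact_fact_dvd_fact[of N N, where 'a = nat] by (meson dvd_trans dvdE)
    hence "(fact N' :: real) = fact N * fact N * m"
      by (metis of_nat_fact of_nat_mult)
    ultimately obtain u where u: "u \<in> VG" "x - x' = real L * fact N * real m * u"
      by (auto simp: L_def)
    define h' where "h' = h + fact N * (- (m * u))"
    have mu: "- (m * u) \<in> VG"
      using u by (intro VG_uminus VG_of_nat_mult)
    have h': "h' \<in> VG"
      using VG_add[OF h VG_of_nat_mult[OF mu, of "fact N"]] by (simp add: h'_def)
    have Lh': "L * h' = x'"
      using u(2) x(2) by (simp add: h'_def algebra_simps)
    have "compat N (insert (h, h') S)"
    proof (rule compat_insertI[OF S(1) _ h h' _ mu])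
      fix k z z' assume k: "0 < k" "k \<le> int N" and z: "(z, z') \<in> comb N S"
      have "(of_int k * x + of_int (int L) * z, of_int k * x' + of_int (int L) * z') \<in> comb (N * M' + L * N) S"
        using k by (intro comb_add comb_scale x z) auto
      moreover have "of_int k * x + of_int (int L) * z = L * (of_int k * h + z)"
        "of_int k * x' + of_int (int L) * z' = L * (of_int k * h' + z')"
        using x(2) Lh' by (simp_all add: algebra_simps flip: x(2) Lh')
      ultimately have "(L * (of_int k * h + z), L * (of_int k * h' + z')) \<in> comb (N * M' + L * N) S"
        by simp
      thus "(0 < of_int k * h + z \<longleftrightarrow> 0 < of_int k * h' + z') \<and> (of_int k * h + z < 0 \<longleftrightarrow> of_int k * h' + z' < 0)"
        using compat_pos[OF S(1)] compat_neg[OF S(1)] L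
        by (fastforce simp: N'_def zero_less_mult_iff mult_less_0_iff)
    qed (simp_all add: N'_def h'_def)
    thus ?thesis
      using h' by blast
  next
    case False
    define A where "A = {p \<in> comb M S. fst p < L * h}"
    define B where "B = {p \<in> comb M S. fst p > L * h}"
    have fin: "finite A" "finite B"
      using finite_comb[OF compat_finite[OF S(1)], of M] by (auto simp: A_def B_def)
    have MM': "comb M S \<subseteq> comb M' S"
      by (intro comb_mono) (simp add: M'_def)
    have AB: "p \<in> A \<or> p \<in> B" if "p \<in> comb M S" for p
    proof -
      have "fst p \<noteq> L * h"
        using False that MM' by force
      thus ?thesis
        using that by (auto simp: A_def B_def)
    qed
    have eps_comb: "(real j * eps, real j * eps) \<in> comb J S" if "j \<le> J" for j
      using comb_scale[OF comb_member[OF compat_finite[OF S(1)] S(2), of 1], of "int j" J] that by simp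
    \<comment> \<open>If \<open>L * h\<close> exceeded a lower combination by at most
      \<open>J * eps\<close>, the difference would be a multiple of \<open>eps\<close> and
      \<open>L * h\<close> itself a combination in \<open>comb M' S\<close>, which is excluded here.
      This is why \<open>(eps, eps)\<close> belongs to \<open>S\<close>: both the shift and the
      width of the gap then carry over.\<close>
    have gap: "b - a > J * eps" if "a \<in> snd ` A" "b \<in> snd ` B" for a b
    proof -
      obtain a0 b0 where ab: "(a0, a) \<in> comb M S" "(b0, b) \<in> comb M S" "a0 < L * h" "L * h < b0"
        using \<open>a \<in> snd ` A\<close> \<open>b \<in> snd ` B\<close> by (auto simp: A_def B_def)
      have "L * h - a0 > J * eps"
      proof (rule ccontr)
        assume "\<not> ?thesis"
        moreover have "a0 \<in> VG"
          using comb_VG[OF _ ab(1)] S(1) unfolding compat_def by blast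
        hence "L * h - a0 \<in> VG"
          using h by (intro VG_diff VG_of_nat_mult)
        ultimately obtain j where j: "j \<le> J" "L * h - a0 = real j * eps"
          using eps_multiple[of "L * h - a0" J] ab(3) by auto
        have "(a0 + real j * eps, a + real j * eps) \<in> comb M' S"
          unfolding M'_def using ab(1) eps_comb[OF j(1)] by (rule comb_add)
        thus False
          using False j(2) by force
      qed
      hence "b0 - a0 - J * eps > 0"
        using ab by linarith
      moreover have "(b0 - a0 - J * eps, b - a - J * eps) \<in> comb (M + M + J) S"
        using ab eps_comb[of J] by (intro comb_diff) auto
      ultimately have "b - a - J * eps > 0"
        using compat_pos[OF S(1)] by (fastforce simp: N'_def)
      thus ?thesis by simp
    qed
    have "\<exists>P Q. Q - P > J * eps \<and> (\<forall>a\<in>snd ` A. a \<le> P) \<and> (\<forall>b\<in>snd ` B. Q \<le> b)"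
      by (rule finite_gap[OF finite_imageI[OF fin(1)] finite_imageI[OF fin(2)] gap])
    then obtain P Q where PQ: "Q - P > J * eps" "\<forall>a\<in>snd ` A. a \<le> P" "\<forall>b\<in>snd ` B. Q \<le> b"
      by (elim exE conjE)
    \<comment> \<open>A gap wider than \<open>J * eps\<close> meets every coset of
      \<open>J * VG\<close>, in particular that of \<open>L * h\<close>.\<close>
    obtain u where u: "u \<in> VG" "P < real J * u + L * h" "real J * u + L * h < Q"
      using eps_interval[of J Q P "L * h"] PQ(1) by (auto simp: J_def L_def)
    define h' where "h' = h + fact N * u"
    have h': "h' \<in> VG"
      using VG_add[OF h VG_of_nat_mult[OF u(1), of "fact N"]] by (simp add: h'_def)
    have Lh': "L * h' = J * u + L * h"
      by (simp add: h'_def J_def algebra_simps)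
    have "compat N (insert (h, h') S)"
    proof (rule compat_insertI[OF S(1) _ h h' _ u(1)])
      fix k z z' assume k: "0 < k" "k \<le> int N" and z: "(z, z') \<in> comb N S"
      \<comment> \<open>Multiplication by \<open>t = L / k\<close> brings every condition to the
        same multiple \<open>L * h\<close>, compared with the combination
        \<open>- (t * z)\<close>.\<close>
      have "nat k dvd L"
        unfolding L_def using k by (intro dvd_fact) auto
      then obtain t where t: "L = nat k * t" by blast
      hence kt: "real L = of_int k * real t"
        using k by simp
      have t0: "t > 0"
        using t L(2) by (cases "t = 0") auto
      have "t \<le> L"
        using L(2) t by (intro dvd_imp_le) auto
      have "(of_int (- int t) * z, of_int (- int t) * z') \<in> comb (L * N) S"
        using z \<open>t \<le> L\<close> by (intro comb_scale) auto
      hence zt: "(- (t * z), - (t * z')) \<in> comb M S"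
        by (simp add: M_def mult.commute)
      have eq: "t * (of_int k * h + z) = L * h - (- (t * z))" "t * (of_int k * h' + z') = L * h' - (- (t * z'))"
        using kt by (simp_all add: algebra_simps)
      have iff: "0 < t * y \<longleftrightarrow> 0 < y" "t * y < 0 \<longleftrightarrow> y < 0" for y :: real
        using t0 by (auto simp: zero_less_mult_iff mult_less_0_iff)
      from AB[OF zt] show "(0 < of_int k * h + z \<longleftrightarrow> 0 < of_int k * h' + z') \<and>
          (of_int k * h + z < 0 \<longleftrightarrow> of_int k * h' + z' < 0)"
      proof
        assume A: "(- (t * z), - (t * z')) \<in> A"
        hence "- (t * z') \<le> P"
          using PQ(2) by force
        hence "0 < t * (of_int k * h' + z')"
          using u unfolding eq Lh' by simp
        moreover have "0 < t * (of_int k * h + z)"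
          using A unfolding eq by (simp add: A_def)
        ultimately show ?thesis
          unfolding iff by simp
      next
        assume B: "(- (t * z), - (t * z')) \<in> B"
        hence "Q \<le> - (t * z')"
          using PQ(3) by force
        hence "t * (of_int k * h' + z') < 0"
          using u unfolding eq Lh' by simp
        moreover have "t * (of_int k * h + z) < 0"
          using B unfolding eq by (simp add: B_def)
        ultimately show ?thesis
          unfolding iff by simp
      qed
    qed (simp_all add: N'_def h'_def)
    thus ?thesis
      using h' by blast
  qed
  thus ?thesis
    by (intro exI[of _ N']) (auto simp: N'_def)
qed

end

section \<open>Families of polynomials\<close>

inductive_set polyfun :: "((nat \<Rightarrow> 'a::comm_ring_1) \<Rightarrow> 'a) set" where
  const: "(\<lambda>e. a) \<in> polyfun"
| var: "(\<lambda>e. e i) \<in> polyfun"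
| add: "f \<in> polyfun \<Longrightarrow> g \<in> polyfun \<Longrightarrow> (\<lambda>e. f e + g e) \<in> polyfun"
| mult: "f \<in> polyfun \<Longrightarrow> g \<in> polyfun \<Longrightarrow> (\<lambda>e. f e * g e) \<in> polyfun"

lemma polyfun_uminus: "f \<in> polyfun \<Longrightarrow> (\<lambda>e. - f e) \<in> polyfun"
  using polyfun.mult[OF polyfun.const[of "-1"], of f] by simp

lemma polyfun_diff: "f \<in> polyfun \<Longrightarrow> g \<in> polyfun \<Longrightarrow> (\<lambda>e. f e - g e) \<in> polyfun"
  using polyfun.add[OF _ polyfun_uminus, of f g] by simp

lemma polyfun_sum: "(\<And>i. i \<in> I \<Longrightarrow> f i \<in> polyfun) \<Longrightarrow> (\<lambda>e. \<Sum>i\<in>I. f i e) \<in> polyfun"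
  by (induction I rule: infinite_finite_induct) (simp_all add: polyfun.const polyfun.add)

text \<open>Polynomials in one distinguished variable over the polynomial functions of the others.
  The uniform \<open>d\<close> is only a bound, since leading coefficients may vanish at particular
  assignments.\<close>

definition polyfam :: "nat \<Rightarrow> ((nat \<Rightarrow> 'a::comm_ring_1) \<Rightarrow> 'a poly) set" where
  "polyfam d = {p. (\<forall>k. (\<lambda>e. coeff (p e) k) \<in> polyfun) \<and> (\<forall>e. degree (p e) \<le> d)}"

lemma polyfamI:
  "(\<And>k. (\<lambda>e. coeff (p e) k) \<in> polyfun) \<Longrightarrow> (\<And>e. degree (p e) \<le> d) \<Longrightarrow> p \<in> polyfam d"
  by (simp add: polyfam_def)

lemma polyfam_coeff: "p \<in> polyfam d \<Longrightarrow> (\<lambda>e. coeff (p e) k) \<in> polyfun"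
  and polyfam_degree: "p \<in> polyfam d \<Longrightarrow> degree (p e) \<le> d"
  by (simp_all add: polyfam_def)

lemma polyfam_mono: "d \<le> d' \<Longrightarrow> polyfam d \<subseteq> polyfam d'"
  by (auto simp: polyfam_def intro: order.trans)

lemma polyfam_const: "t \<in> polyfun \<Longrightarrow> (\<lambda>e. [:t e:]) \<in> polyfam d"
proof (rule polyfamI)
  assume "t \<in> polyfun"
  thus "(\<lambda>e. coeff [:t e:] k) \<in> polyfun" for k
    by (cases k) (simp_all add: polyfun.const)
qed simp

lemma polyfam_pderiv:
  fixes p :: "(nat \<Rightarrow> 'a::{idom, semiring_char_0}) \<Rightarrow> 'a poly"
  shows "p \<in> polyfam d \<Longrightarrow> (\<lambda>e. pderiv (p e)) \<in> polyfam (d - 1)"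
  by (rule polyfamI)
    (auto simp: coeff_pderiv degree_pderiv diff_le_mono polyfam_degree polyfam_coeff
      intro!: polyfun.mult polyfun.const)

lemma polyfam_cutoff: "p \<in> polyfam d \<Longrightarrow> (\<lambda>e. poly_cutoff (Suc n) (p e)) \<in> polyfam n"
proof (rule polyfamI)
  assume "p \<in> polyfam d"
  thus "(\<lambda>e. coeff (poly_cutoff (Suc n) (p e)) k) \<in> polyfun" for k
    by (cases "k < Suc n") (simp_all add: coeff_poly_cutoff polyfam_coeff polyfun.const)
qed (auto simp: coeff_poly_cutoff intro!: degree_le)

lemma polyfam_add: "p \<in> polyfam d \<Longrightarrow> q \<in> polyfam d \<Longrightarrow> (\<lambda>e. p e + q e) \<in> polyfam d"
  by (rule polyfamI) (auto simp: polyfam_coeff polyfam_degree intro: polyfun.add degree_add_le)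

lemma polyfam_mult: "p \<in> polyfam d \<Longrightarrow> q \<in> polyfam d' \<Longrightarrow> (\<lambda>e. p e * q e) \<in> polyfam (d + d')"
  by (rule polyfamI)
    (auto simp: coeff_mult polyfam_coeff intro!: polyfun_sum polyfun.mult
      intro: order.trans[OF degree_mult_le] add_mono polyfam_degree)

text \<open>Division without inverses keeps the coefficients polynomial in the assignment, at the
  price of powers of the formal leading coefficient. It is recorded only at roots of
  \<open>f\<close>, where the quotient disappears.\<close>

lemma pseudo_remainder:
  assumes f: "f \<in> polyfam (Suc D)" and "g \<in> polyfam m"
  shows "\<exists>k. \<exists>r\<in>polyfam D. \<forall>e c. poly (f e) c = 0 \<longrightarrow> coeff (f e) (Suc D) ^ k * poly (g e) c = poly (r e) c"
  using assms(2)
proof (induction m arbitrary: g)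
  case 0
  thus ?case
    using polyfam_mono[of 0 D] by (intro exI[of _ 0] bexI[of _ g]) auto
next
  case (Suc m)
  show ?case
  proof (cases "Suc m \<le> D")
    case True
    thus ?thesis
      using polyfam_mono[of "Suc m" D] Suc.prems by (intro exI[of _ 0] bexI[of _ g]) auto
  next
    case False
    define l where "l e = coeff (f e) (Suc D)" for e
    define g1 where "g1 e = smult (l e) (g e) - monom (coeff (g e) (Suc m)) (m - D) * f e" for e
    have c: "coeff (g1 e) j = l e * coeff (g e) j -
        (if j < m - D then 0 else coeff (g e) (Suc m) * coeff (f e) (j - (m - D)))" for e j
      by (simp add: g1_def coeff_monom_mult)
    have "g1 \<in> polyfam m"
    proof (rule polyfamI)
      fix j show "(\<lambda>e. coeff (g1 e) j) \<in> polyfun"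
        unfolding c l_def using polyfam_coeff[OF f] polyfam_coeff[OF Suc.prems]
        by (cases "j < m - D") (auto intro!: polyfun_diff polyfun.mult polyfun.const)
    next
      fix e
      have "coeff (g1 e) j = 0" if "j > m" for j
      proof (cases "j = Suc m")
        case True
        thus ?thesis using False by (simp add: c l_def Suc_diff_diff)
      next
        case False
        hence "degree (g e) < j" "degree (f e) < j - (m - D)"
          using that \<open>\<not> Suc m \<le> D\<close> polyfam_degree[OF Suc.prems, of e] polyfam_degree[OF f, of e] by linarith+
        thus ?thesis by (simp add: c coeff_eq_0)
      qed
      thus "degree (g1 e) \<le> m"
        by (intro degree_le) auto
    qed
    then obtain k r where r: "r \<in> polyfam D"
      "\<And>e c. poly (f e) c = 0 \<Longrightarrow> coeff (f e) (Suc D) ^ k * poly (g1 e) c = poly (r e) c"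
      using Suc.IH by blast
    thus ?thesis
      by (intro exI[of _ "Suc k"] bexI[of _ r]) (auto simp: g1_def l_def mult_ac)
  qed
qed

definition pderiv_closed :: "('e \<Rightarrow> 'a::{comm_semiring_1,semiring_no_zero_divisors} poly) set \<Rightarrow> bool" where
  "pderiv_closed H \<longleftrightarrow> (\<forall>h\<in>H. (\<lambda>e. pderiv (h e)) \<in> H)"

lemma higher_pderiv_closed: "pderiv_closed H \<Longrightarrow> h \<in> H \<Longrightarrow> (\<lambda>e. (pderiv ^^ i) (h e)) \<in> H"
  by (induction i) (auto simp: pderiv_closed_def)

lemma higher_pderiv_eq_0:
  fixes p :: "'a::{idom, semiring_char_0} poly"
  shows "degree p \<le> d \<Longrightarrow> (pderiv ^^ Suc d) p = 0"
proof (induction d arbitrary: p)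
  case (Suc d)
  hence "(pderiv ^^ Suc d) (pderiv p) = 0"
    by (intro Suc.IH) (simp add: degree_pderiv)
  thus ?case
    by (simp add: funpow_swap1)
qed (simp add: pderiv_eq_0_iff)

lemma pderiv_closure:
  fixes F :: "((nat \<Rightarrow> 'a::{idom, semiring_char_0}) \<Rightarrow> 'a poly) set"
  assumes "finite F" "F \<subseteq> polyfam d"
  shows "\<exists>H. finite H \<and> F \<subseteq> H \<and> H \<subseteq> polyfam d \<and> pderiv_closed H"
proof -
  \<comment> \<open>The derivative of order \<open>Suc d\<close> is zero and hence its own
    derivative, which closes this finite list.\<close>
  define H where "H = (\<lambda>(j, f). \<lambda>e. (pderiv ^^ j) (f e)) ` ({..Suc d} \<times> F)"
  have pd: "(\<lambda>e. (pderiv ^^ j) (f e)) \<in> polyfam d" if "f \<in> F" for j f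
  proof (induction j)
    case (Suc j)
    show ?case
      using polyfam_pderiv[OF Suc.IH] polyfam_mono[of "d - 1" d] by auto
  qed (use assms that in auto)
  have H: "(\<lambda>e. (pderiv ^^ j) (f e)) \<in> H" if "f \<in> F" "j \<le> Suc d" for j f
    unfolding H_def using that by (intro image_eqI[of _ _ "(j, f)"]) auto
  have "pderiv_closed H"
    unfolding pderiv_closed_def
  proof
    fix h assume "h \<in> H"
    then obtain j f where jf: "h = (\<lambda>e. (pderiv ^^ j) (f e))" "j \<le> Suc d" "f \<in> F"
      by (auto simp: H_def)
    show "(\<lambda>e. pderiv (h e)) \<in> H"
    proof (cases "j = Suc d")
      case True
      have "(pderiv ^^ Suc d) (f e) = 0" for e
        using assms jf by (intro higher_pderiv_eq_0) (auto intro: polyfam_degree)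
      hence "(\<lambda>e. pderiv (h e)) = h"
        by (simp add: jf True)
      thus ?thesis using \<open>h \<in> H\<close> by simp
    next
      case False
      thus ?thesis
        using H[of f "Suc j"] jf by simp
    qed
  qed
  moreover have "F \<subseteq> H"
    using H[of _ 0] by auto
  moreover have "finite H"
    using assms by (simp add: H_def)
  moreover have "H \<subseteq> polyfam d"
    using pd by (auto simp: H_def)
  ultimately show ?thesis by blast
qed

context nontrivial_henselian_ac
begin

section \<open>Extension by field elements\<close>

definition w_pair :: "'k \<times> 'k \<Rightarrow> real \<times> real" where "w_pair p = (w (fst p), w (snd p))"

definition matched :: "nat \<Rightarrow> (real \<times> real) set \<Rightarrow> ('k \<times> 'k) set \<Rightarrow> bool" where
  "matched N G Z \<longleftrightarrow> finite Z \<and> (\<forall>(x, y)\<in>Z. ac x = ac y) \<and> compat N (G \<union> w_pair ` Z)"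

lemma matched_ac: "matched N G Z \<Longrightarrow> (x, y) \<in> Z \<Longrightarrow> ac x = ac y"
  by (auto simp: matched_def)

lemma matched_eq_0_iff: "matched N G Z \<Longrightarrow> (x, y) \<in> Z \<Longrightarrow> x = 0 \<longleftrightarrow> y = 0"
  using matched_ac by (metis ac_eq_0_iff)

lemma matched_good: "matched N G Z \<Longrightarrow> compat N (G \<union> w_pair ` Z)"
  by (simp add: matched_def)

lemma matched_mono: "matched N' G Z' \<Longrightarrow> Z \<subseteq> Z' \<Longrightarrow> N \<le> N' \<Longrightarrow> matched N G Z"
  unfolding matched_def by (blast intro: compat_mono finite_subset)

lemma matched_extend:
  "\<exists>N'\<ge>N. \<forall>G Z b. matched N' G Z \<longrightarrow> (eps, eps) \<in> G \<longrightarrow>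
     (\<exists>h'\<in>VG. \<forall>b'. w b' = h' \<longrightarrow> ac b' = ac b \<longrightarrow> matched N G (insert (b, b') Z))"
proof -
  obtain N' where N': "N' \<ge> N"
    "\<And>S h. compat N' S \<Longrightarrow> (eps, eps) \<in> S \<Longrightarrow> h \<in> VG \<Longrightarrow> \<exists>h'\<in>VG. compat N (insert (h, h') S)"
    using compat_extend[of N] by blast
  have "\<exists>h'\<in>VG. \<forall>b'. w b' = h' \<longrightarrow> ac b' = ac b \<longrightarrow> matched N G (insert (b, b') Z)"
    if Z: "matched N' G Z" "(eps, eps) \<in> G" for G Z b
  proof -
    obtain h' where h': "h' \<in> VG" "compat N (insert (w b, h') (G \<union> w_pair ` Z))"
      using N'(2)[OF matched_good[OF Z(1)], of "w b"] Z(2) by auto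
    have "matched N G (insert (b, b') Z)" if "w b' = h'" "ac b' = ac b" for b'
      using h'(2) Z(1) that by (auto simp: matched_def w_pair_def)
    thus ?thesis
      using h'(1) by blast
  qed
  thus ?thesis
    using N'(1) by blast
qed

lemma matched_union:
  "\<exists>N'\<ge>N. \<forall>G Z W. matched N' G Z \<longrightarrow> finite W \<longrightarrow> card W \<le> k \<longrightarrow> (\<forall>(x, y)\<in>W. ac x = ac y) \<longrightarrow>
     w_pair ` W \<subseteq> comb B (G \<union> w_pair ` Z) \<longrightarrow> matched N G (Z \<union> W)"
proof -
  obtain N' where N': "N' \<ge> N" "\<And>S W. compat N' S \<Longrightarrow> W \<subseteq> comb B S \<Longrightarrow> finite W \<Longrightarrow> card W \<le> k \<Longrightarrow> compat N (S \<union> W)"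
    using compat_union_comb[of N B k] by blast
  have "matched N G (Z \<union> W)" if "matched N' G Z" "finite W" "card W \<le> k" "\<forall>(x, y)\<in>W. ac x = ac y"
     "w_pair ` W \<subseteq> comb B (G \<union> w_pair ` Z)" for G Z W
  proof -
    have "compat N (G \<union> w_pair ` Z \<union> w_pair ` W)"
      using that card_image_le[of W w_pair] by (intro N') (auto intro: matched_good)
    thus ?thesis
      using that by (auto simp: matched_def image_Un Un_assoc)
  qed
  thus ?thesis
    using N'(1) by blast
qed

definition value_pairs :: "((nat \<Rightarrow> 'k) \<Rightarrow> 'k poly) set \<Rightarrow> (nat \<Rightarrow> 'k) \<Rightarrow> 'k \<Rightarrow> (nat \<Rightarrow> 'k) \<Rightarrow> 'k \<Rightarrow> ('k \<times> 'k) set" where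
  "value_pairs F e c e' c' = (\<lambda>g. (poly (g e) c, poly (g e') c')) ` F"

definition fun_pairs :: "((nat \<Rightarrow> 'k) \<Rightarrow> 'k) set \<Rightarrow> (nat \<Rightarrow> 'k) \<Rightarrow> (nat \<Rightarrow> 'k) \<Rightarrow> ('k \<times> 'k) set" where
  "fun_pairs T e e' = (\<lambda>t. (t e, t e')) ` T"

lemma value_pairsI: "g \<in> F \<Longrightarrow> (poly (g e) c, poly (g e') c') \<in> value_pairs F e c e' c'"
  unfolding value_pairs_def by blast

lemma w_unit_mult: "x \<noteq> 0 \<Longrightarrow> w x = 0 \<Longrightarrow> w (x * y) = w y"
  by (cases "y = 0") (simp_all add: w_mult)

lemma tay_pair:
  assumes "matched N G Z" "value_pairs H e c e' c' \<subseteq> Z" "pderiv_closed H" "h \<in> H"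
  shows "ac (tay (h e) c i) = ac (tay (h e') c' i)"
    and "(w (tay (h e) c i), w (tay (h e') c' i)) \<in> w_pair ` Z"
proof -
  have "(poly ((pderiv ^^ i) (h e)) c, poly ((pderiv ^^ i) (h e')) c') \<in> value_pairs H e c e' c'"
    using value_pairsI[OF higher_pderiv_closed[OF assms(3,4)]] .
  hence Z: "(fact i * tay (h e) c i, fact i * tay (h e') c' i) \<in> Z"
    using assms(2) unfolding fact_tay by blast
  show "ac (tay (h e) c i) = ac (tay (h e') c' i)"
    using matched_ac[OF assms(1) Z] by (simp add: ac_mult)
  show "(w (tay (h e) c i), w (tay (h e') c' i)) \<in> w_pair ` Z"
    using imageI[OF Z, of w_pair] by (simp add: w_pair_def w_unit_mult)
qed

lemma v_le_transfer:
  assumes "compat N S" "(w x, w x') \<in> comb A S" "(w y, w y') \<in> comb A S" "A + A \<le> N"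
    and "ac x = ac x'" "ac y = ac y'"
  shows "v x \<le> v y \<longleftrightarrow> v x' \<le> v y'"
proof -
  have "x = 0 \<longleftrightarrow> x' = 0" "y = 0 \<longleftrightarrow> y' = 0"
    using assms(5,6) by (metis ac_eq_0_iff)+
  thus ?thesis
    using compat_le[OF assms(1-4)] by (cases "x = 0"; cases "y = 0") (auto simp: v_eq_w)
qed

text \<open>The term of index \<open>i\<close> has value \<open>w (tay ...) + i * w b\<close>, a
  combination with coefficients at most \<open>Suc d\<close>. Comparing two such terms requires
  level \<open>2 * Suc d\<close>.\<close>

lemma tay_transfer:
  assumes matched: "matched N G Z" "value_pairs H e c e' c' \<subseteq> Z" "(b, b') \<in> Z" and b: "b \<noteq> 0"
    and H: "pderiv_closed H" "h \<in> H" and N: "2 * Suc d \<le> N"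
    and d: "degree (h e) \<le> d" "degree (h e') \<le> d"
  shows "no_cancel (\<lambda>i. tay (h e) c i * b ^ i) d \<longleftrightarrow> no_cancel (\<lambda>i. tay (h e') c' i * b' ^ i) d"
    and "no_cancel (\<lambda>i. tay (h e) c i * b ^ i) d \<Longrightarrow>
      ac (poly (h e) (c + b)) = ac (poly (h e') (c' + b')) \<and>
      (w (poly (h e) (c + b)), w (poly (h e') (c' + b'))) \<in> comb (Suc d) (G \<union> w_pair ` Z)"
proof -
  define x where "x i = tay (h e) c i * b ^ i" for i
  define y where "y i = tay (h e') c' i * b' ^ i" for i
  have fin: "finite (G \<union> w_pair ` Z)"
    using matched_good[OF matched(1)] by (rule compat_finite)
  have b': "b' \<noteq> 0"
    using matched_eq_0_iff[OF matched(1,3)] b by simp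
  have ac_xy: "ac (x i) = ac (y i)" for i
    using tay_pair(1)[OF matched(1,2) H, of i] matched_ac[OF matched(1,3)] by (simp add: x_def y_def ac_mult ac_power)
  have comb_xy: "(w (x i), w (y i)) \<in> comb (Suc d) (G \<union> w_pair ` Z)" if "i \<le> d" for i
  proof (cases "tay (h e) c i = 0")
    case True
    moreover from this have "tay (h e') c' i = 0"
      using tay_pair(1)[OF matched(1,2) H, of i] by (metis ac_eq_0_iff)
    ultimately show ?thesis
      by (simp add: x_def y_def comb_0)
  next
    case False
    moreover from this have "tay (h e') c' i \<noteq> 0"
      using tay_pair(1)[OF matched(1,2) H, of i] by (metis ac_eq_0_iff)
    ultimately have eq: "w (x i) = w (tay (h e) c i) + of_int (int i) * w b"
      "w (y i) = w (tay (h e') c' i) + of_int (int i) * w b'"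
      using b b' by (simp_all add: x_def y_def w_mult w_power)
    have "(w b, w b') \<in> w_pair ` Z"
      using imageI[OF matched(3), of w_pair] by (simp add: w_pair_def)
    hence "(w (x i), w (y i)) \<in> comb (1 + d * 1) (G \<union> w_pair ` Z)"
      unfolding eq using tay_pair(2)[OF matched(1,2) H, of i] fin that
      by (intro comb_add comb_scale comb_member) auto
    thus ?thesis by simp
  qed
  have le: "v (x i) \<le> v (x j) \<longleftrightarrow> v (y i) \<le> v (y j)" if "i \<le> d" "j \<le> d" for i j
    using that N comb_xy ac_xy by (intro v_le_transfer[OF matched_good[OF matched(1)]]) auto
  have px: "poly (h e) (c + b) = (\<Sum>i\<le>d. x i)" and py: "poly (h e') (c' + b') = (\<Sum>i\<le>d. y i)"
    using poly_tay[OF d(1), of "c + b" c] poly_tay[OF d(2), of "c' + b'" c'] by (simp_all add: x_def y_def)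
  show "no_cancel (\<lambda>i. tay (h e) c i * b ^ i) d \<longleftrightarrow> no_cancel (\<lambda>i. tay (h e') c' i * b' ^ i) d"
    using cancel_transfer(1)[of d x y, OF ac_xy le] unfolding x_def y_def by blast
  assume "no_cancel (\<lambda>i. tay (h e) c i * b ^ i) d"
  hence nc: "no_cancel x d"
    unfolding x_def .
  obtain i where i: "i \<le> d" "v (\<Sum>i\<le>d. x i) = v (x i)" "v (\<Sum>i\<le>d. y i) = v (y i)"
    using cancel_transfer(3)[of d x y, OF ac_xy le nc] by blast
  hence "w (\<Sum>i\<le>d. x i) = w (x i)" "w (\<Sum>i\<le>d. y i) = w (y i)"
    by (simp_all add: w_def)
  thus "ac (poly (h e) (c + b)) = ac (poly (h e') (c' + b')) \<and>
      (w (poly (h e) (c + b)), w (poly (h e') (c' + b'))) \<in> comb (Suc d) (G \<union> w_pair ` Z)"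
    unfolding px py using comb_xy[OF i(1)] cancel_transfer(2)[of d x y, OF ac_xy le nc] by simp
qed

text \<open>\<open>J\<close> is what must be known at the center, \<open>H\<close> what is then
  known at the point \<open>c + b\<close>. They differ when a root of \<open>f\<close> is lifted:
  \<open>f\<close> belongs to \<open>J\<close>, but its Taylor terms do cancel at the root.\<close>

lemma matched_move:
  assumes "finite H" "H \<subseteq> J" "J \<subseteq> polyfam d" "pderiv_closed J"
  shows "\<exists>N'\<ge>N. 2 * Suc d \<le> N' \<and> (\<forall>G Z e e' c c' b b'. matched N' G Z \<longrightarrow> value_pairs J e c e' c' \<subseteq> Z \<longrightarrow> (b, b') \<in> Z \<longrightarrow>
    b \<noteq> 0 \<longrightarrow> (\<forall>h\<in>H. no_cancel (\<lambda>i. tay (h e) c i * b ^ i) d) \<longrightarrow>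
    matched N G (value_pairs H e (c + b) e' (c' + b')))"
proof -
  obtain N' where N': "N' \<ge> N" "\<And>G Z W. matched N' G Z \<Longrightarrow> finite W \<Longrightarrow> card W \<le> card H \<Longrightarrow>
      \<forall>(x, y)\<in>W. ac x = ac y \<Longrightarrow> w_pair ` W \<subseteq> comb (Suc d) (G \<union> w_pair ` Z) \<Longrightarrow> matched N G (Z \<union> W)"
    using matched_union[of N "card H" "Suc d"] by blast
  define N2 where "N2 = max N' (2 * Suc d)"
  have "matched N G (value_pairs H e (c + b) e' (c' + b'))"
    if matched: "matched N2 G Z" "value_pairs J e c e' c' \<subseteq> Z" "(b, b') \<in> Z" "b \<noteq> 0"
      and nc: "\<forall>h\<in>H. no_cancel (\<lambda>i. tay (h e) c i * b ^ i) d" for G Z e e' c c' b b'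
  proof -
    have *: "ac (poly (h e) (c + b)) = ac (poly (h e') (c' + b')) \<and>
      (w (poly (h e) (c + b)), w (poly (h e') (c' + b'))) \<in> comb (Suc d) (G \<union> w_pair ` Z)" if "h \<in> H" for h
      using that assms nc polyfam_degree[of h d]
      by (intro tay_transfer(2)[OF matched assms(4)]) (auto simp: N2_def)
    have "matched N G (Z \<union> value_pairs H e (c + b) e' (c' + b'))"
      using matched_mono[OF matched(1) order.refl] assms(1) *
      by (intro N') (auto simp: N2_def value_pairs_def w_pair_def card_image_le)
    thus ?thesis
      by (rule matched_mono) auto
  qed
  thus ?thesis
    using N'(1) by (intro exI[of _ N2]) (auto simp: N2_def)
qed

text \<open>\<open>N'\<close> and \<open>T\<close> must not depend on \<open>e\<close>, so that \<open>D\<close> is only a formal degree; the condition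
  \<open>coeff (f e) D \<noteq> 0\<close> singles out the assignments for which it is the actual one.\<close>

definition root_lift :: "nat \<Rightarrow> bool" where
  "root_lift D \<longleftrightarrow> (\<forall>f\<in>polyfam D. \<forall>F N d. finite F \<longrightarrow> F \<subseteq> polyfam d \<longrightarrow>
     (\<exists>N' T. finite T \<and> T \<subseteq> polyfun \<and>
       (\<forall>G e e' c. (eps, eps) \<in> G \<longrightarrow> matched N' G (fun_pairs T e e') \<longrightarrow> coeff (f e) D \<noteq> 0 \<longrightarrow> poly (f e) c = 0 \<longrightarrow>
         (\<exists>c'. matched N G (value_pairs F e c e' c')))))"

lemma root_liftD:
  assumes "root_lift D" "f \<in> polyfam D" "finite F" "F \<subseteq> polyfam d"
  shows "\<exists>N' T. finite T \<and> T \<subseteq> polyfun \<and>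
       (\<forall>G e e' c. (eps, eps) \<in> G \<longrightarrow> matched N' G (fun_pairs T e e') \<longrightarrow> coeff (f e) D \<noteq> 0 \<longrightarrow> poly (f e) c = 0 \<longrightarrow>
         (\<exists>c'. matched N G (value_pairs F e c e' c')))"
  by (rule assms(1)[unfolded root_lift_def, rule_format, OF assms(2-4)])

text \<open>A center is \<open>0\<close> or a root of a member of \<open>H\<close>, whose degree is
  at most \<open>D\<close>; lifting roots up to this degree therefore transports it, together with
  the values of any prescribed family \<open>J\<close>.\<close>

lemma center_lift:
  assumes lift: "\<And>D'. D' \<le> D \<Longrightarrow> root_lift D'"
    and H: "finite H" "H \<subseteq> polyfam D" "pderiv_closed H" and J: "finite J" "J \<subseteq> polyfam d"
  shows "\<exists>N' T. finite T \<and> T \<subseteq> polyfun \<and> (\<forall>G e e' a. (eps, eps) \<in> G \<longrightarrow> matched N' G (fun_pairs T e e') \<longrightarrow>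
    (\<exists>c c'. (\<forall>h\<in>H. no_cancel (\<lambda>i. tay (h e) c i * (a - c) ^ i) D) \<and> matched N G (value_pairs J e c e' c')))"
proof -
  \<comment> \<open>The actual degree of \<open>h e\<close> varies with \<open>e\<close>, so the
    truncations at all degrees up to \<open>D\<close> are prepared; the one at the actual degree
    leaves \<open>h e\<close> unchanged and has nonzero leading coefficient.\<close>
  define K where "K = H \<times> {..D}"
  have "\<forall>p\<in>K. \<exists>N' T. finite T \<and> T \<subseteq> polyfun \<and>
       (\<forall>G e e' c. (eps, eps) \<in> G \<longrightarrow> matched N' G (fun_pairs T e e') \<longrightarrow>
         coeff (poly_cutoff (Suc (snd p)) (fst p e)) (snd p) \<noteq> 0 \<longrightarrow>
         poly (poly_cutoff (Suc (snd p)) (fst p e)) c = 0 \<longrightarrow> (\<exists>c'. matched N G (value_pairs J e c e' c')))"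
  proof
    fix p assume "p \<in> K"
    hence rl: "root_lift (snd p)" "(\<lambda>e. poly_cutoff (Suc (snd p)) (fst p e)) \<in> polyfam (snd p)"
      using lift polyfam_cutoff[OF subsetD[OF H(2)]] by (auto simp: K_def)
    show "\<exists>N' T. finite T \<and> T \<subseteq> polyfun \<and>
       (\<forall>G e e' c. (eps, eps) \<in> G \<longrightarrow> matched N' G (fun_pairs T e e') \<longrightarrow>
         coeff (poly_cutoff (Suc (snd p)) (fst p e)) (snd p) \<noteq> 0 \<longrightarrow>
         poly (poly_cutoff (Suc (snd p)) (fst p e)) c = 0 \<longrightarrow> (\<exists>c'. matched N G (value_pairs J e c e' c')))"
      by (rule root_liftD[OF rl J])
  qed
  then obtain N' T where NT: "\<And>p. p \<in> K \<Longrightarrow> finite (T p) \<and> T p \<subseteq> polyfun \<and>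
       (\<forall>G e e' c. (eps, eps) \<in> G \<longrightarrow> matched (N' p) G (fun_pairs (T p) e e') \<longrightarrow>
         coeff (poly_cutoff (Suc (snd p)) (fst p e)) (snd p) \<noteq> 0 \<longrightarrow>
         poly (poly_cutoff (Suc (snd p)) (fst p e)) c = 0 \<longrightarrow> (\<exists>c'. matched N G (value_pairs J e c e' c')))"
    by metis
  define N1 where "N1 = N + (\<Sum>p\<in>K. N' p)"
  \<comment> \<open>These constant coefficients are the values of \<open>J\<close> at the center
    \<open>0\<close>.\<close>
  define T0 where "T0 = (\<lambda>j e. coeff (j e) 0) ` J"
  define T1 where "T1 = T0 \<union> (\<Union>p\<in>K. T p)"
  have K: "finite K"
    using H(1) by (simp add: K_def)
  have "finite T1"
    using K J NT by (auto simp: T1_def T0_def)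
  moreover have "T1 \<subseteq> polyfun"
    using J(2) NT by (auto simp: T1_def T0_def intro: polyfam_coeff)
  moreover have "\<exists>c c'. (\<forall>h\<in>H. no_cancel (\<lambda>i. tay (h e) c i * (a - c) ^ i) D) \<and> matched N G (value_pairs J e c e' c')"
    if G: "(eps, eps) \<in> G" and matched: "matched N1 G (fun_pairs T1 e e')" for G e e' a
  proof -
    define F where "F = (\<lambda>h. h e) ` H"
    have "\<exists>c. (c = 0 \<or> (\<exists>g\<in>F. g \<noteq> 0 \<and> poly g c = 0)) \<and>
      (\<forall>f\<in>F. \<forall>d\<ge>degree f. no_cancel (\<lambda>i. tay f c i * (a - c) ^ i) d)"
    proof (rule center)
      show "finite F" using H by (simp add: F_def)
      show "pderiv f \<in> F" if "f \<in> F" for f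
        using that H(3) unfolding F_def pderiv_closed_def by fastforce
    qed
    then obtain c where c: "c = 0 \<or> (\<exists>g\<in>F. g \<noteq> 0 \<and> poly g c = 0)"
      "\<forall>f\<in>F. \<forall>d\<ge>degree f. no_cancel (\<lambda>i. tay f c i * (a - c) ^ i) d"
      by blast
    have nc: "\<forall>h\<in>H. no_cancel (\<lambda>i. tay (h e) c i * (a - c) ^ i) D"
      using c(2) H(2) by (auto simp: F_def intro: polyfam_degree)
    have "\<exists>c'. matched N G (value_pairs J e c e' c')"
    proof (cases "c = 0")
      case True
      have "value_pairs J e 0 e' 0 \<subseteq> fun_pairs T1 e e'"
        by (auto simp: value_pairs_def fun_pairs_def T1_def T0_def poly_0_coeff_0)
      hence "matched N G (value_pairs J e 0 e' 0)"
        by (rule matched_mono[OF matched]) (simp add: N1_def)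
      thus ?thesis
        using True by blast
    next
      case False
      then obtain h where h: "h \<in> H" "h e \<noteq> 0" "poly (h e) c = 0"
        using c(1) by (auto simp: F_def)
      define p where "p = (h, degree (h e))"
      have p: "p \<in> K"
        using h H(2) by (auto simp: p_def K_def intro: polyfam_degree)
      have "poly_cutoff (Suc (degree (h e))) (h e) = h e"
        by (intro poly_eqI) (simp add: coeff_poly_cutoff coeff_eq_0)
      moreover have "N' p \<le> N1"
        using member_le_sum[OF p, of N'] K by (simp add: N1_def)
      moreover have "fun_pairs (T p) e e' \<subseteq> fun_pairs T1 e e'"
        using p by (auto simp: fun_pairs_def T1_def)
      ultimately show ?thesis
        using NT[OF p] G matched_mono[OF matched, of "fun_pairs (T p) e e'" "N' p"] h by (simp add: p_def)
    qed
    thus ?thesis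
      using nc by blast
  qed
  ultimately show ?thesis
    by blast
qed

text \<open>At a root of \<open>f\<close>, the values of \<open>F\<close> are those of
  pseudo-remainders of degree at most \<open>D\<close>, up to powers of the leading coefficient. For
  a center of this lower-degree family, the Taylor terms of \<open>f\<close> cancel at the root
  while those of its derivative do not. Both facts pass to the other side, where Hensel's lemma
  produces the root.\<close>

lemma root_lift_Suc:
  assumes lift: "\<And>D'. D' \<le> D \<Longrightarrow> root_lift D'"
  shows "root_lift (Suc D)"
  unfolding root_lift_def
proof (intro ballI allI impI)
  fix f :: "(nat \<Rightarrow> 'k) \<Rightarrow> 'k poly" and F :: "((nat \<Rightarrow> 'k) \<Rightarrow> 'k poly) set" and N d
  assume f: "f \<in> polyfam (Suc D)" and F: "finite F" "F \<subseteq> polyfam d"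
  define l where "l e = coeff (f e) (Suc D)" for e
  have "\<forall>g\<in>F. \<exists>k r. r \<in> polyfam D \<and> (\<forall>e c. poly (f e) c = 0 \<longrightarrow> l e ^ k * poly (g e) c = poly (r e) c)"
    using pseudo_remainder[OF f] F(2) unfolding l_def by blast
  then obtain k r where r: "\<And>g. g \<in> F \<Longrightarrow> r g \<in> polyfam D \<and>
      (\<forall>e c. poly (f e) c = 0 \<longrightarrow> l e ^ k g * poly (g e) c = poly (r g e) c)"
    by metis
  \<comment> \<open>The derivative guarantees that the root is residually simple; the leading
    coefficient is included because its powers have to be divided out.\<close>
  define R where "R = r ` F \<union> {\<lambda>e. pderiv (f e), \<lambda>e. [:l e:]}"
  have "R \<subseteq> polyfam D"
    using r polyfam_pderiv[OF f] polyfam_const[OF polyfam_coeff[OF f]] by (auto simp: R_def l_def)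
  moreover have "finite R"
    using F by (simp add: R_def)
  ultimately obtain H where H: "finite H" "R \<subseteq> H" "H \<subseteq> polyfam D" "pderiv_closed H"
    using pderiv_closure[of R D] by blast
  define J where "J = insert f H"
  have f'_H: "(\<lambda>e. pderiv (f e)) \<in> H" and l_H: "(\<lambda>e. [:l e:]) \<in> H" and r_H: "\<And>g. g \<in> F \<Longrightarrow> r g \<in> H"
    using H(2) by (auto simp: R_def)
  have J: "finite J" "H \<subseteq> J" "J \<subseteq> polyfam (Suc D)" "pderiv_closed J"
    using H f f'_H polyfam_mono[of D "Suc D"] by (auto simp: J_def pderiv_closed_def)
  \<comment> \<open>The sum is a bound for every exponent \<open>k g\<close>, so a quotient by
    \<open>l e ^ k g\<close> has coefficients at most \<open>B\<close> over remainder and leading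
    coefficient.\<close>
  define K where "K = (\<Sum>g\<in>F. k g)"
  define B where "B = 1 + K * 1"
  obtain N3 where N3: "N3 \<ge> N" "\<And>G Z W. matched N3 G Z \<Longrightarrow> finite W \<Longrightarrow> card W \<le> card F \<Longrightarrow>
      \<forall>(x, y)\<in>W. ac x = ac y \<Longrightarrow> w_pair ` W \<subseteq> comb B (G \<union> w_pair ` Z) \<Longrightarrow> matched N G (Z \<union> W)"
    using matched_union[of N "card F" B] by blast
  obtain N2 where N2: "N2 \<ge> N3" "2 * Suc (Suc D) \<le> N2"
    "\<And>G Z e e' c c' b b'. matched N2 G Z \<Longrightarrow> value_pairs J e c e' c' \<subseteq> Z \<Longrightarrow> (b, b') \<in> Z \<Longrightarrow>
      b \<noteq> 0 \<Longrightarrow> \<forall>h\<in>H. no_cancel (\<lambda>i. tay (h e) c i * b ^ i) (Suc D) \<Longrightarrow>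
      matched N3 G (value_pairs H e (c + b) e' (c' + b'))"
    using matched_move[OF H(1) J(2-4), of N3] by blast
  obtain N1 where N1: "N1 \<ge> N2" "\<And>G Z b. matched N1 G Z \<Longrightarrow> (eps, eps) \<in> G \<Longrightarrow>
     \<exists>h'\<in>VG. \<forall>b'. w b' = h' \<longrightarrow> ac b' = ac b \<longrightarrow> matched N2 G (insert (b, b') Z)"
    using matched_extend[of N2] by blast
  obtain N0 T where T: "finite T" "T \<subseteq> polyfun" "\<And>G e e' a. (eps, eps) \<in> G \<Longrightarrow> matched N0 G (fun_pairs T e e') \<Longrightarrow>
    \<exists>c c'. (\<forall>h\<in>H. no_cancel (\<lambda>i. tay (h e) c i * (a - c) ^ i) D) \<and> matched N1 G (value_pairs J e c e' c')"
    using center_lift[OF lift H(1,3,4) J(1,3), of N1] by blast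
  have reduce: "matched N G (value_pairs F e c e' c')"
    if matched: "matched N3 G (value_pairs H e c e' c')" and l: "l e \<noteq> 0" and c: "poly (f e) c = 0" "poly (f e') c' = 0"
    for G e e' c c'
  proof -
    define S where "S = G \<union> w_pair ` value_pairs H e c e' c'"
    have S: "finite S"
      unfolding S_def using matched_good[OF matched] by (rule compat_finite)
    have lS: "(l e, l e') \<in> value_pairs H e c e' c'"
      using value_pairsI[OF l_H, of e c e' c'] by simp
    have l': "l e' \<noteq> 0" and acl: "ac (l e) = ac (l e')"
      using matched_eq_0_iff[OF matched lS] matched_ac[OF matched lS] l by auto
    have "ac (poly (g e) c) = ac (poly (g e') c') \<and> (w (poly (g e) c), w (poly (g e') c')) \<in> comb B S"
      if g: "g \<in> F" for g
    proof -
      have rS: "(poly (r g e) c, poly (r g e') c') \<in> value_pairs H e c e' c'"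
        by (rule value_pairsI[OF r_H[OF g]])
      have eq: "poly (g e) c = poly (r g e) c / l e ^ k g" "poly (g e') c' = poly (r g e') c' / l e' ^ k g"
        using r[OF g] c l l' by (simp_all add: field_simps)
      have acr: "ac (poly (r g e) c) = ac (poly (r g e') c')"
        using matched_ac[OF matched rS] .
      have "(w (poly (g e) c), w (poly (g e') c')) \<in> comb B S"
      proof (cases "poly (r g e) c = 0")
        case True
        moreover from this have "poly (r g e') c' = 0"
          using acr by (metis ac_eq_0_iff)
        ultimately show ?thesis
          by (simp add: eq comb_0)
      next
        case False
        moreover from this have "poly (r g e') c' \<noteq> 0"
          using acr by (metis ac_eq_0_iff)
        ultimately have weq: "w (poly (g e) c) = w (poly (r g e) c) + of_int (- int (k g)) * w (l e)"
          "w (poly (g e') c') = w (poly (r g e') c') + of_int (- int (k g)) * w (l e')"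
          using l l' by (simp_all add: eq w_divide w_power)
        have "(w (poly (r g e) c), w (poly (r g e') c')) \<in> S" "(w (l e), w (l e')) \<in> S"
          using imageI[OF rS, of w_pair] imageI[OF lS, of w_pair] by (simp_all add: w_pair_def S_def)
        moreover have "k g \<le> K"
          unfolding K_def using g F(1) by (intro member_le_sum) auto
        ultimately show ?thesis
          unfolding weq B_def using S by (intro comb_add comb_scale comb_member) auto
      qed
      thus ?thesis
        using acr acl by (simp add: eq ac_divide ac_power)
    qed
    hence "matched N G (value_pairs H e c e' c' \<union> value_pairs F e c e' c')"
      using matched F(1) unfolding S_def by (intro N3(2)) (auto simp: value_pairs_def w_pair_def card_image_le)
    thus ?thesis
      by (rule matched_mono) auto
  qed
  have "\<exists>c'. matched N G (value_pairs F e c e' c')"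
    if G: "(eps, eps) \<in> G" and mt0: "matched N0 G (fun_pairs T e e')" and l: "l e \<noteq> 0" and c: "poly (f e) c = 0"
    for G e e' c
  proof -
    obtain c1 c1' where c1: "\<forall>h\<in>H. no_cancel (\<lambda>i. tay (h e) c1 i * (c - c1) ^ i) D"
      "matched N1 G (value_pairs J e c1 e' c1')"
      using T(3)[OF G mt0, of c] by blast
    have "\<exists>c'. poly (f e') c' = 0 \<and> matched N3 G (value_pairs H e c e' c')"
    proof (cases "c = c1")
      case True
      \<comment> \<open>At the center itself, vanishing is transported because \<open>f\<close>
        belongs to \<open>J\<close>.\<close>
      have "(poly (f e) c1, poly (f e') c1') \<in> value_pairs J e c1 e' c1'"
        by (rule value_pairsI) (simp add: J_def)
      hence "poly (f e') c1' = 0"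
        using matched_eq_0_iff[OF c1(2)] c True by blast
      moreover have "matched N3 G (value_pairs H e c1 e' c1')"
        using N1(1) N2(1) by (intro matched_mono[OF c1(2)]) (auto simp: J_def value_pairs_def)
      ultimately show ?thesis
        using True by blast
    next
      case False
      define b where "b = c - c1"
      have b: "b \<noteq> 0" "c1 + b = c"
        using False by (simp_all add: b_def)
      obtain h' where h': "h' \<in> VG"
        "\<And>b'. w b' = h' \<Longrightarrow> ac b' = ac b \<Longrightarrow> matched N2 G (insert (b, b') (value_pairs J e c1 e' c1'))"
        using N1(2)[OF c1(2) G, of b] by blast
      obtain b0 where b0: "b0 \<noteq> 0" "w b0 = h'" "ac b0 = ac b"
        using ex_w_ac[OF h'(1) b(1)] by blast
      have mt2: "matched N2 G (insert (b, b0) (value_pairs J e c1 e' c1'))"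
        using h'(2) b0 by blast
      have nc: "no_cancel (\<lambda>i. tay (h e) c1 i * b ^ i) (Suc D)" if "h \<in> H" for h
        using that c1(1) H(3) no_cancel_degree[of "h e" D c1 b] no_cancel_degree[of "h e" "Suc D" c1 b]
          polyfam_degree[of h D e] by (auto simp: b_def)
      have degf: "degree (f e) \<le> Suc D" for e
        using f by (rule polyfam_degree)
      \<comment> \<open>Here \<open>f e\<close> vanishes at \<open>c\<close>; without cancellation
        all its Taylor terms would vanish, contrary to \<open>l e \<noteq> 0\<close>.\<close>
      have "\<not> no_cancel (\<lambda>i. tay (f e) c1 i * b ^ i) (Suc D)"
      proof
        assume "no_cancel (\<lambda>i. tay (f e) c1 i * b ^ i) (Suc D)"
        moreover have "(\<Sum>i\<le>Suc D. tay (f e) c1 i * b ^ i) = 0"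
          using poly_tay[OF degf, of e c c1] c by (simp add: b_def)
        ultimately have "tay (f e) c1 i = 0" if "i \<le> Suc D" for i
          using that b unfolding no_cancel_def by auto
        moreover have "tay (f e) c1 i = 0" if "i > Suc D" for i
          using that degf[of e] by (intro tay_eq_0) auto
        ultimately have "pcompose (f e) [:c1, 1:] = 0"
          by (intro poly_eqI) (metis coeff_0 not_le tay_def)
        hence "f e = 0"
          by (rule pcompose_eq_0) simp
        thus False
          using l by (simp add: l_def)
      qed
      hence "\<not> no_cancel (\<lambda>i. tay (f e') c1' i * b0 ^ i) (Suc D)"
        using tay_transfer(1)[where h = f and c = c1 and c' = c1' and b' = b0, OF mt2 _ _ b(1) J(4) _ N2(2) degf degf]
        by (auto simp: J_def)
      moreover have "no_cancel (\<lambda>i. tay (pderiv (f e')) c1' i * b0 ^ i) (Suc D)"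
      proof -
        have "degree (pderiv (f e)) \<le> Suc D" for e
          using degf[of e] by (simp add: degree_pderiv)
        thus ?thesis
          using tay_transfer(1)[where h = "\<lambda>e. pderiv (f e)" and e = e and e' = e' and c = c1 and c' = c1'
              and b' = b0, OF mt2 _ _ b(1) J(4) _ N2(2)]
            nc[OF f'_H] f'_H by (auto simp: J_def)
      qed
      ultimately obtain y where y: "poly (f e') (c1' + b0 * y) = 0" "v (y - 1) > 0"
        using simple_residual_root[OF b0(1) degf] by blast
      \<comment> \<open>Since \<open>y\<close> is congruent to \<open>1\<close>, passing from
        \<open>b0\<close> to \<open>b0 * y\<close> keeps the leading term.\<close>
      have vy: "v y = 0"
        using v_add_unit[of 1 "y - 1"] y(2) by simp
      moreover have "res y = 1"
        using res_add[of 1 "y - 1"] res_eq_0_iff[of "y - 1"] y(2) by simp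
      ultimately have "ac y = 1" "w y = 0" "y \<noteq> 0"
        by (auto simp: ac_unit w_def)
      hence "w (b0 * y) = h'" "ac (b0 * y) = ac b"
        using b0 by (simp_all add: w_mult ac_mult)
      hence "matched N2 G (insert (b, b0 * y) (value_pairs J e c1 e' c1'))"
        by (rule h'(2))
      hence "matched N3 G (value_pairs H e (c1 + b) e' (c1' + b0 * y))"
        using b(1) nc by (intro N2(3)) auto
      thus ?thesis
        using y(1) b(2) by auto
    qed
    thus ?thesis
      using reduce l c by blast
  qed
  thus "\<exists>N' T. finite T \<and> T \<subseteq> polyfun \<and>
       (\<forall>G e e' c. (eps, eps) \<in> G \<longrightarrow> matched N' G (fun_pairs T e e') \<longrightarrow> coeff (f e) (Suc D) \<noteq> 0 \<longrightarrow> poly (f e) c = 0 \<longrightarrow>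
         (\<exists>c'. matched N G (value_pairs F e c e' c')))"
    using T(1,2) unfolding l_def by blast
qed

lemma root_lift: "root_lift D"
proof (induction D rule: less_induct)
  case (less D)
  show ?case
  proof (cases D)
    case 0
    have "poly (f e) c \<noteq> 0" if "f \<in> polyfam 0" "coeff (f e) 0 \<noteq> 0" for f e c
      using polyfam_degree[OF that(1), of e] that(2) by (auto elim!: degree_eq_zeroE)
    thus ?thesis
      unfolding root_lift_def 0 by (metis empty_subsetI finite.emptyI)
  next
    case (Suc D')
    thus ?thesis
      using less root_lift_Suc[of D'] by simp
  qed
qed

text \<open>Once a center has been transported, any displacement \<open>b'\<close> with the right
  leading term gives a suitable point; Hensel's lemma enters through the center.\<close>

theorem field_step:
  assumes F: "finite F" "F \<subseteq> polyfam d"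
  shows "\<exists>N' T. finite T \<and> T \<subseteq> polyfun \<and> (\<forall>G e e' a. (eps, eps) \<in> G \<longrightarrow> matched N' G (fun_pairs T e e') \<longrightarrow>
    (\<exists>a'. matched N G (value_pairs F e a e' a')))"
proof -
  obtain H where H: "finite H" "F \<subseteq> H" "H \<subseteq> polyfam d" "pderiv_closed H"
    using pderiv_closure[OF F] by blast
  obtain N2 where N2: "N2 \<ge> N"
    "\<And>G Z e e' c c' b b'. matched N2 G Z \<Longrightarrow> value_pairs H e c e' c' \<subseteq> Z \<Longrightarrow> (b, b') \<in> Z \<Longrightarrow>
      b \<noteq> 0 \<Longrightarrow> \<forall>h\<in>H. no_cancel (\<lambda>i. tay (h e) c i * b ^ i) d \<Longrightarrow>
      matched N G (value_pairs H e (c + b) e' (c' + b'))"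
    using matched_move[OF H(1) order.refl H(3,4), of N] by blast
  obtain N1 where N1: "N1 \<ge> N2" "\<And>G Z b. matched N1 G Z \<Longrightarrow> (eps, eps) \<in> G \<Longrightarrow>
     \<exists>h'\<in>VG. \<forall>b'. w b' = h' \<longrightarrow> ac b' = ac b \<longrightarrow> matched N2 G (insert (b, b') Z)"
    using matched_extend[of N2] by blast
  obtain N0 T where T: "finite T" "T \<subseteq> polyfun" "\<And>G e e' a. (eps, eps) \<in> G \<Longrightarrow> matched N0 G (fun_pairs T e e') \<Longrightarrow>
    \<exists>c c'. (\<forall>h\<in>H. no_cancel (\<lambda>i. tay (h e) c i * (a - c) ^ i) d) \<and> matched N1 G (value_pairs H e c e' c')"
    using center_lift[OF root_lift H(1,3,4) H(1,3), of N1] by blast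
  have "\<exists>a'. matched N G (value_pairs F e a e' a')" if G: "(eps, eps) \<in> G" and mt0: "matched N0 G (fun_pairs T e e')" for G e e' a
  proof -
    obtain c c' where c: "\<forall>h\<in>H. no_cancel (\<lambda>i. tay (h e) c i * (a - c) ^ i) d" "matched N1 G (value_pairs H e c e' c')"
      using T(3)[OF G mt0, of a] by blast
    have "\<exists>a'. matched N G (value_pairs H e a e' a')"
    proof (cases "a = c")
      case True
      thus ?thesis
        using N1(1) N2(1) matched_mono[OF c(2) order.refl, of N] by auto
    next
      case False
      define b where "b = a - c"
      have b: "b \<noteq> 0" "c + b = a"
        using False by (simp_all add: b_def)
      obtain h' where h': "h' \<in> VG"
        "\<And>b'. w b' = h' \<Longrightarrow> ac b' = ac b \<Longrightarrow> matched N2 G (insert (b, b') (value_pairs H e c e' c'))"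
        using N1(2)[OF c(2) G, of b] by blast
      obtain b' where b': "w b' = h'" "ac b' = ac b"
        using ex_w_ac[OF h'(1) b(1)] by blast
      have "matched N G (value_pairs H e (c + b) e' (c' + b'))"
        using b(1) c(1) h'(2)[OF b'] unfolding b_def by (intro N2(2)) auto
      thus ?thesis
        using b(2) by auto
    qed
    moreover have "value_pairs F e a e' a' \<subseteq> value_pairs H e a e' a'" for a'
      using H(2) by (auto simp: value_pairs_def)
    ultimately show ?thesis
      using matched_mono by blast
  qed
  thus ?thesis
    using T(1,2) by blast
qed

end

section \<open>Tame predicates\<close>

lemma polyfun_as_polyfam:
  fixes t :: "(nat \<Rightarrow> 'a::{idom, semiring_char_0}) \<Rightarrow> 'a"
  shows "t \<in> polyfun \<Longrightarrow> \<exists>d. \<exists>p\<in>polyfam d. \<forall>e a. t (e(i := a)) = poly (p e) a"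
proof (induction rule: polyfun.induct)
  case (const a)
  show ?case
    by (intro exI[of _ 0] bexI[of _ "\<lambda>e. [:a:]"] polyfam_const polyfun.const) auto
next
  case (var j)
  show ?case
  proof (cases "j = i")
    case True
    have "(\<lambda>e. coeff [:0, 1::'a:] k) \<in> polyfun" for k
      by (rule polyfun.const)
    hence "(\<lambda>e. [:0, 1::'a:]) \<in> polyfam 1"
      by (intro polyfamI) auto
    thus ?thesis
      using True by (intro exI[of _ 1] bexI[of _ "\<lambda>e. [:0, 1:]"]) auto
  next
    case False
    thus ?thesis
      by (intro exI[of _ 0] bexI[of _ "\<lambda>e. [:e j:]"] polyfam_const polyfun.var) auto
  qed
next
  case (add f g)
  then obtain d p d' p' where p: "p \<in> polyfam d" "\<And>e a. f (e(i := a)) = poly (p e) a"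
    "p' \<in> polyfam d'" "\<And>e a. g (e(i := a)) = poly (p' e) a"
    by blast
  hence "(\<lambda>e. p e + p' e) \<in> polyfam (max d d')"
    using polyfam_mono[of d "max d d'"] polyfam_mono[of d' "max d d'"] by (intro polyfam_add) auto
  thus ?case
    using p by (intro exI[of _ "max d d'"] bexI[of _ "\<lambda>e. p e + p' e"]) (simp_all only: p(2,4) poly_add simp_thms)
next
  case (mult f g)
  then obtain d p d' p' where p: "p \<in> polyfam d" "\<And>e a. f (e(i := a)) = poly (p e) a"
    "p' \<in> polyfam d'" "\<And>e a. g (e(i := a)) = poly (p' e) a"
    by blast
  thus ?case
    by (intro exI[of _ "d + d'"] bexI[of _ "\<lambda>e. p e * p' e"] polyfam_mult)
      (simp_all only: p(2,4) poly_mult simp_thms)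
qed

lemma eval_k_polyfun: "(\<lambda>e. eval_k e t) \<in> polyfun"
  by (induction t) (auto intro: polyfun.intros polyfun_uminus)

context nontrivial_henselian_ac
begin

lemma ereal_VG: "h \<in> VG \<Longrightarrow> ereal h \<in> range v"
proof -
  assume "h \<in> VG"
  then obtain x where "x \<noteq> 0" "w x = h"
    using ex_w_ac[of h 1] by auto
  thus ?thesis
    using v_eq_w[of x] by (metis rangeI)
qed

lemma real_of_range: "g \<in> range v \<Longrightarrow> real_of_ereal g \<in> VG"
  by (auto simp: VG_def w_def)

lemma value_group_iff: "ereal g \<in> value_group v \<longleftrightarrow> g \<in> VG"
proof
  assume "g \<in> VG"
  then obtain x where "x \<noteq> 0" "w x = g"
    using ex_w_ac[of g 1] by auto
  thus "ereal g \<in> value_group v"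
    unfolding value_group_def using v_eq_w[of x] by (intro image_eqI[of _ _ x]) auto
next
  assume "ereal g \<in> value_group v"
  then obtain x where "v x = ereal g"
    unfolding value_group_def by (metis imageE)
  thus "g \<in> VG"
    using w_in_VG[of x] by (simp add: w_def)
qed

text \<open>The pair of \<open>eps\<close> is always present, as \<open>compat_extend\<close>
  requires it. An infinite value is recorded as \<open>0\<close>; \<open>sim\<close> separately
  matches infinity with infinity.\<close>

definition group_pairs :: "nat set \<Rightarrow> (nat \<Rightarrow> ereal) \<Rightarrow> (nat \<Rightarrow> ereal) \<Rightarrow> (real \<times> real) set" where
  "group_pairs I g g' = insert (eps, eps) ((\<lambda>i. (real_of_ereal (g i), real_of_ereal (g' i))) ` I)"

definition sim ::
  "nat \<Rightarrow> ((nat \<Rightarrow> 'k) \<Rightarrow> 'k) set \<Rightarrow> nat set \<Rightarrow> (nat \<Rightarrow> 'k) \<Rightarrow> (nat \<Rightarrow> ereal) \<Rightarrow> (nat \<Rightarrow> 'k) \<Rightarrow> (nat \<Rightarrow> ereal) \<Rightarrow> bool"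
where
  "sim N T I e g e' g' \<longleftrightarrow>
     (\<forall>i\<in>I. g i \<in> range v \<and> g' i \<in> range v \<and> (g i = \<infinity> \<longleftrightarrow> g' i = \<infinity>)) \<and>
     matched N (group_pairs I g g') (fun_pairs T e e')"

text \<open>A semantic substitute for definability. One implication suffices because similarity is
  symmetric, and the residue assignment \<open>r\<close> is common to both sides.\<close>

definition tame :: "((nat \<Rightarrow> 'k) \<Rightarrow> (nat \<Rightarrow> ereal) \<Rightarrow> (nat \<Rightarrow> 'f) \<Rightarrow> bool) \<Rightarrow> bool" where
  "tame Q \<longleftrightarrow> (\<exists>N T I. finite T \<and> T \<subseteq> polyfun \<and> finite I \<and>
     (\<forall>e g e' g' r. sim N T I e g e' g' \<longrightarrow> Q e g r \<longrightarrow> Q e' g' r))"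

lemma tameI:
  assumes "finite T" "T \<subseteq> polyfun" "finite I"
    and "\<And>e g e' g' r. sim N T I e g e' g' \<Longrightarrow> Q e g r \<Longrightarrow> Q e' g' r"
  shows "tame Q"
  unfolding tame_def
  by (rule exI[of _ N], rule exI[of _ T], rule exI[of _ I]) (simp add: assms)

lemma sim_mono: "sim N' T' I' e g e' g' \<Longrightarrow> N \<le> N' \<Longrightarrow> T \<subseteq> T' \<Longrightarrow> I \<subseteq> I' \<Longrightarrow> sim N T I e g e' g'"
proof -
  assume a: "sim N' T' I' e g e' g'" "N \<le> N'" "T \<subseteq> T'" "I \<subseteq> I'"
  have "compat N' (group_pairs I' g g' \<union> w_pair ` fun_pairs T' e e')"
    using a(1) by (simp add: sim_def matched_def)
  moreover have "group_pairs I g g' \<union> w_pair ` fun_pairs T e e' \<subseteq> group_pairs I' g g' \<union> w_pair ` fun_pairs T' e e'"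
    using a(3,4) by (auto simp: group_pairs_def fun_pairs_def)
  ultimately have "compat N (group_pairs I g g' \<union> w_pair ` fun_pairs T e e')"
    using a(2) by (rule compat_mono)
  moreover have "fun_pairs T e e' \<subseteq> fun_pairs T' e e'"
    using a(3) by (auto simp: fun_pairs_def)
  hence "finite (fun_pairs T e e')" "\<forall>(x, y)\<in>fun_pairs T e e'. ac x = ac y"
    using a(1) finite_subset by (auto simp: sim_def matched_def)
  ultimately show ?thesis
    using a(1,4) by (auto simp: sim_def matched_def)
qed

lemma sim_sym: "sim N T I e g e' g' \<Longrightarrow> sim N T I e' g' e g"
proof -
  assume a: "sim N T I e g e' g'"
  have "compat N (prod.swap ` (group_pairs I g g' \<union> w_pair ` fun_pairs T e e'))"
    using a by (intro compat_converse) (simp add: sim_def matched_def)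
  also have "prod.swap ` (group_pairs I g g' \<union> w_pair ` fun_pairs T e e') = group_pairs I g' g \<union> w_pair ` fun_pairs T e' e"
    by (simp add: group_pairs_def fun_pairs_def w_pair_def image_Un image_image)
  finally have "compat N (group_pairs I g' g \<union> w_pair ` fun_pairs T e' e)" .
  moreover have "finite (fun_pairs T e' e)"
    using a finite_imageI[of "fun_pairs T e e'" prod.swap] by (simp add: sim_def matched_def fun_pairs_def image_image)
  ultimately show ?thesis
    using a by (auto simp: sim_def matched_def fun_pairs_def)
qed

lemma sim_comb_mono:
  assumes "sim N T' I' e g e' g'" "T \<subseteq> T'" "I \<subseteq> I'" "A \<le> B"
  shows "comb A (group_pairs I g g' \<union> w_pair ` fun_pairs T e e') \<subseteq> comb B (group_pairs I' g g' \<union> w_pair ` fun_pairs T' e e')"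
proof -
  have "finite (group_pairs I' g g' \<union> w_pair ` fun_pairs T' e e')"
    by (rule compat_finite[of N]) (use assms(1) in \<open>simp add: sim_def matched_def\<close>)
  moreover have "group_pairs I g g' \<union> w_pair ` fun_pairs T e e' \<subseteq> group_pairs I' g g' \<union> w_pair ` fun_pairs T' e e'"
    using assms(2,3) by (auto simp: group_pairs_def fun_pairs_def)
  ultimately show ?thesis
    by (rule order.trans[OF comb_mono[OF assms(4)] comb_mono_set])
qed

lemma tame_not: "tame Q \<Longrightarrow> tame (\<lambda>e g r. \<not> Q e g r)"
  unfolding tame_def by (meson sim_sym)

lemma tame_conj:
  assumes "tame P" "tame Q"
  shows "tame (\<lambda>e g r. P e g r \<and> Q e g r)"
proof -
  obtain N T I where P: "finite T" "T \<subseteq> polyfun" "finite I"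
    "\<And>e g e' g' r. sim N T I e g e' g' \<Longrightarrow> P e g r \<Longrightarrow> P e' g' r"
    using assms(1) unfolding tame_def by blast
  obtain N' T' I' where Q: "finite T'" "T' \<subseteq> polyfun" "finite I'"
    "\<And>e g e' g' r. sim N' T' I' e g e' g' \<Longrightarrow> Q e g r \<Longrightarrow> Q e' g' r"
    using assms(2) unfolding tame_def by blast
  have "P e' g' r \<and> Q e' g' r"
    if s: "sim (max N N') (T \<union> T') (I \<union> I') e g e' g'" and pq: "P e g r \<and> Q e g r" for e g e' g' r
    using P(4)[OF sim_mono[OF s, of N T I], of r] Q(4)[OF sim_mono[OF s, of N' T' I'], of r] pq by simp
  thus ?thesis
    using P(1-3) Q(1-3) by (intro tameI[of "T \<union> T'" "I \<union> I'" "max N N'"]) auto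
qed

lemma tame_True: "tame (\<lambda>e g r. True)"
  unfolding tame_def by blast

lemma tame_Ball:
  assumes "finite X" "\<And>i. i \<in> X \<Longrightarrow> tame (Q i)"
  shows "tame (\<lambda>e g r. \<forall>i\<in>X. Q i e g r)"
  using assms by (induction X rule: finite_induct) (simp_all add: tame_True tame_conj)

lemma tame_ex_field:
  assumes "tame Q"
  shows "tame (\<lambda>e g r. \<exists>a. Q (e(i := a)) g r)"
proof -
  obtain N T I where Q: "finite T" "T \<subseteq> polyfun" "finite I"
    "\<And>e g e' g' r. sim N T I e g e' g' \<Longrightarrow> Q e g r \<Longrightarrow> Q e' g' r"
    using assms unfolding tame_def by blast
  have "\<forall>t\<in>T. \<exists>d p. p \<in> polyfam d \<and> (\<forall>e a. t (e(i := a)) = poly (p e) a)"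
    using Q(2) polyfun_as_polyfam by blast
  then obtain d p where p: "\<And>t. t \<in> T \<Longrightarrow> p t \<in> polyfam (d t)"
    "\<And>t e a. t \<in> T \<Longrightarrow> t (e(i := a)) = poly (p t e) a"
    by metis
  have "p t \<in> polyfam (\<Sum>t\<in>T. d t)" if "t \<in> T" for t
    using p(1)[OF that] polyfam_mono[OF member_le_sum[OF that, of d]] Q(1) by auto
  hence pT: "p ` T \<subseteq> polyfam (\<Sum>t\<in>T. d t)"
    by blast
  obtain N' T' where T': "finite T'" "T' \<subseteq> polyfun"
    "\<And>G e e' a. (eps, eps) \<in> G \<Longrightarrow> matched N' G (fun_pairs T' e e') \<Longrightarrow> \<exists>a'. matched N G (value_pairs (p ` T) e a e' a')"
    using field_step[OF finite_imageI[OF Q(1)] pT, of N] by blast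
  have "\<exists>a'. Q (e'(i := a')) g' r"
    if s: "sim N' T' I e g e' g'" and q: "Q (e(i := a)) g r" for e g e' g' r a
  proof -
    obtain a' where "matched N (group_pairs I g g') (value_pairs (p ` T) e a e' a')"
      using T'(3)[of "group_pairs I g g'" e e' a] s by (auto simp: sim_def group_pairs_def)
    moreover have "value_pairs (p ` T) e a e' a' = fun_pairs T (e(i := a)) (e'(i := a'))"
      using p(2) by (auto simp: value_pairs_def fun_pairs_def image_image)
    ultimately have "sim N T I (e(i := a)) g (e'(i := a')) g'"
      using s by (simp add: sim_def)
    thus ?thesis
      using Q(4) q by blast
  qed
  thus ?thesis
    by (intro tameI[OF T'(1,2) Q(3)]) auto
qed

lemma tame_ex_group:
  assumes "tame Q"
  shows "tame (\<lambda>e g r. \<exists>h\<in>range v. Q e (g(i := h)) r)"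
proof -
  obtain N T I where Q: "finite T" "T \<subseteq> polyfun" "finite I"
    "\<And>e g e' g' r. sim N T I e g e' g' \<Longrightarrow> Q e g r \<Longrightarrow> Q e' g' r"
    using assms unfolding tame_def by blast
  obtain N' where N': "N' \<ge> N"
    "\<And>S h. compat N' S \<Longrightarrow> (eps, eps) \<in> S \<Longrightarrow> h \<in> VG \<Longrightarrow> \<exists>h'\<in>VG. compat N (insert (h, h') S)"
    using compat_extend[of N] by blast
  have "\<exists>h'\<in>range v. Q e' (g'(i := h')) r"
    if s: "sim N' T (I - {i}) e g e' g'" and q: "Q e (g(i := v x)) r" for e g e' g' r x
  proof -
    define S where "S = group_pairs (I - {i}) g g' \<union> w_pair ` fun_pairs T e e'"
    have S: "compat N' S"
      using s by (simp add: S_def sim_def matched_def)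
    have "\<exists>h'\<in>range v. (v x = \<infinity> \<longleftrightarrow> h' = \<infinity>) \<and> compat N (insert (w x, real_of_ereal h') S)"
    proof (cases "x = 0")
      case True
      \<comment> \<open>The infinite value is represented by \<open>(0, 0)\<close>, which is a
        trivial combination.\<close>
      have "compat N (insert (0, 0) S)"
        using compat_mono[OF S order.refl N'(1)] compat_insert_comb[of N 0 S "(0, 0)"] comb_0 by simp
      thus ?thesis
        using True rangeI[of v 0] by (intro bexI[of _ \<infinity>]) auto
    next
      case False
      obtain h' where "h' \<in> VG" "compat N (insert (w x, h') S)"
        using N'(2)[OF S, of "w x"] by (auto simp: S_def group_pairs_def)
      thus ?thesis
        using False ereal_VG by (intro bexI[of _ "ereal h'"]) auto
    qed
    then obtain h' where h': "h' \<in> range v" "v x = \<infinity> \<longleftrightarrow> h' = \<infinity>"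
      "compat N (insert (w x, real_of_ereal h') S)"
      by blast
    have "group_pairs I (g(i := v x)) (g'(i := h')) \<union> w_pair ` fun_pairs T e e' \<subseteq> insert (w x, real_of_ereal h') S"
      by (auto simp: group_pairs_def S_def w_def)
    hence "compat N (group_pairs I (g(i := v x)) (g'(i := h')) \<union> w_pair ` fun_pairs T e e')"
      using compat_mono[OF h'(3)] by blast
    hence "sim N T I e (g(i := v x)) e' (g'(i := h'))"
      using s h'(1,2) by (auto simp: sim_def matched_def)
    thus ?thesis
      using Q(4) q h'(1) by blast
  qed
  thus ?thesis
    using Q(3) by (intro tameI[OF Q(1,2), of "I - {i}"]) auto
qed

lemma tame_ex_residue: "tame Q \<Longrightarrow> tame (\<lambda>e g r. \<exists>c. Q e g (r(i := c)))"
  unfolding tame_def by meson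

section \<open>Atomic formulas\<close>

lemma tame_eq_0:
  assumes "t \<in> polyfun"
  shows "tame (\<lambda>e g r. t e = 0)"
proof -
  have "t e' = 0" if "sim 0 {t} {} e g e' g'" "t e = 0" for e g e' g'
    using that matched_eq_0_iff[of 0 "group_pairs {} g g'" "fun_pairs {t} e e'" "t e" "t e'"] by (simp add: sim_def fun_pairs_def)
  thus ?thesis
    using assms by (intro tameI[of "{t}" "{}"]) auto
qed

text \<open>\<open>B\<close> is uniform in \<open>N\<close>: the strength of similarity is chosen
  only afterwards, according to the relation between the terms.\<close>

definition gterm_sim :: "gterm \<Rightarrow> nat \<Rightarrow> ((nat \<Rightarrow> 'k) \<Rightarrow> 'k) set \<Rightarrow> nat set \<Rightarrow> bool" where
  "gterm_sim s B T I \<longleftrightarrow> finite T \<and> T \<subseteq> polyfun \<and> finite I \<and>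
     (\<forall>N e g e' g'. sim N T I e g e' g' \<longrightarrow>
        (eval_g v e g s = \<infinity> \<and> eval_g v e' g' s = \<infinity>) \<or>
        (\<exists>x x'. eval_g v e g s = ereal x \<and> eval_g v e' g' s = ereal x' \<and>
           (x, x') \<in> comb B (group_pairs I g g' \<union> w_pair ` fun_pairs T e e')))"

lemma gterm_simI:
  assumes "finite T" "T \<subseteq> polyfun" "finite I"
    "\<And>N e g e' g'. sim N T I e g e' g' \<Longrightarrow>
        (eval_g v e g s = \<infinity> \<and> eval_g v e' g' s = \<infinity>) \<or>
        (\<exists>x x'. eval_g v e g s = ereal x \<and> eval_g v e' g' s = ereal x' \<and>
           (x, x') \<in> comb B (group_pairs I g g' \<union> w_pair ` fun_pairs T e e'))"
  shows "gterm_sim s B T I"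
  using assms unfolding gterm_sim_def by blast

lemma gterm_simD:
  assumes "gterm_sim s B T I" "sim N T' I' e g e' g'" "T \<subseteq> T'" "I \<subseteq> I'"
  shows "(eval_g v e g s = \<infinity> \<and> eval_g v e' g' s = \<infinity>) \<or>
        (\<exists>x x'. eval_g v e g s = ereal x \<and> eval_g v e' g' s = ereal x' \<and>
           (x, x') \<in> comb B (group_pairs I' g g' \<union> w_pair ` fun_pairs T' e e'))"
proof -
  have "sim N T I e g e' g'"
    using assms(2) by (rule sim_mono) (use assms in auto)
  thus ?thesis
    using assms(1) sim_comb_mono[OF assms(2-4) order.refl, of B] unfolding gterm_sim_def by blast
qed

lemma range_v_cases: "h \<in> range v \<Longrightarrow> h = \<infinity> \<or> h = ereal (real_of_ereal h)"
  by (metis ereal_infinity_cases ereal_real' rangeE v_not_minf)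

lemma ex_gterm_sim: "\<exists>B T I. gterm_sim s B T I"
proof (induction s)
  case (GVar i)
  have "gterm_sim (GVar i) 1 {} {i}"
  proof (rule gterm_simI)
    fix N e g e' g'
    assume s: "sim N {} {i} e g e' g'"
    hence *: "g i \<in> range v" "g' i \<in> range v" "g i = \<infinity> \<longleftrightarrow> g' i = \<infinity>"
      by (auto simp: sim_def)
    have "finite (group_pairs {i} g g' \<union> w_pair ` fun_pairs {} e e')"
      by (simp add: group_pairs_def fun_pairs_def)
    hence "(real_of_ereal (g i), real_of_ereal (g' i)) \<in> comb 1 (group_pairs {i} g g' \<union> w_pair ` fun_pairs {} e e')"
      by (rule comb_member) (simp_all add: group_pairs_def)
    thus "(eval_g v e g (GVar i) = \<infinity> \<and> eval_g v e' g' (GVar i) = \<infinity>) \<or>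
        (\<exists>x x'. eval_g v e g (GVar i) = ereal x \<and> eval_g v e' g' (GVar i) = ereal x' \<and>
           (x, x') \<in> comb 1 (group_pairs {i} g g' \<union> w_pair ` fun_pairs {} e e'))"
      using range_v_cases[OF *(1)] range_v_cases[OF *(2)] *(3) by (metis eval_g.simps(1))
  qed auto
  thus ?case by blast
next
  case GZero
  have "gterm_sim GZero 0 {} {}"
    by (rule gterm_simI) (auto simp: zero_ereal_def comb_0)
  thus ?case by blast
next
  case GInf
  have "gterm_sim GInf 0 {} {}"
    by (rule gterm_simI) auto
  thus ?case by blast
next
  case (GVal t)
  have "gterm_sim (GVal t) 1 {\<lambda>e. eval_k e t} {}"
  proof (rule gterm_simI)
    fix N e g e' g'
    assume s: "sim N {\<lambda>e. eval_k e t} {} e g e' g'"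
    hence 0: "eval_k e t = 0 \<longleftrightarrow> eval_k e' t = 0"
      using matched_eq_0_iff[of N "group_pairs {} g g'" "fun_pairs {\<lambda>e. eval_k e t} e e'"] by (simp add: sim_def fun_pairs_def)
    have "finite (group_pairs {} g g' \<union> w_pair ` fun_pairs {\<lambda>e. eval_k e t} e e')"
      by (simp add: group_pairs_def fun_pairs_def)
    hence "(w (eval_k e t), w (eval_k e' t)) \<in> comb 1 (group_pairs {} g g' \<union> w_pair ` fun_pairs {\<lambda>e. eval_k e t} e e')"
      by (rule comb_member) (simp_all add: fun_pairs_def w_pair_def)
    thus "(eval_g v e g (GVal t) = \<infinity> \<and> eval_g v e' g' (GVal t) = \<infinity>) \<or>
        (\<exists>x x'. eval_g v e g (GVal t) = ereal x \<and> eval_g v e' g' (GVal t) = ereal x' \<and>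
           (x, x') \<in> comb 1 (group_pairs {} g g' \<union> w_pair ` fun_pairs {\<lambda>e. eval_k e t} e e'))"
      using 0 by (cases "eval_k e t = 0") (auto simp: v_eq_w)
  qed (auto simp: eval_k_polyfun)
  thus ?case by blast
next
  case (GAdd s t)
  then obtain B T I B' T' I' where st: "gterm_sim s B T I" "gterm_sim t B' T' I'"
    by blast
  have "gterm_sim (GAdd s t) (B + B') (T \<union> T') (I \<union> I')"
  proof (rule gterm_simI)
    fix N e g e' g'
    assume s: "sim N (T \<union> T') (I \<union> I') e g e' g'"
    show "(eval_g v e g (GAdd s t) = \<infinity> \<and> eval_g v e' g' (GAdd s t) = \<infinity>) \<or>
        (\<exists>x x'. eval_g v e g (GAdd s t) = ereal x \<and> eval_g v e' g' (GAdd s t) = ereal x' \<and>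
           (x, x') \<in> comb (B + B') (group_pairs (I \<union> I') g g' \<union> w_pair ` fun_pairs (T \<union> T') e e'))"
      using gterm_simD[OF st(1) s] gterm_simD[OF st(2) s] by (auto intro: comb_add)
  qed (use st in \<open>auto simp: gterm_sim_def\<close>)
  thus ?case by blast
qed

lemma tame_gterm_rel:
  fixes P :: "ereal \<Rightarrow> ereal \<Rightarrow> bool"
  assumes inf: "\<And>x y y'. P \<infinity> (ereal y) \<longleftrightarrow> P \<infinity> (ereal y')" "\<And>x x'. P (ereal x) \<infinity> \<longleftrightarrow> P (ereal x') \<infinity>"
    and fin: "\<And>B. \<exists>N. \<forall>S x x' y y'. compat N S \<longrightarrow> (x, x') \<in> comb B S \<longrightarrow> (y, y') \<in> comb B S \<longrightarrow>
      P (ereal x) (ereal y) \<longrightarrow> P (ereal x') (ereal y')"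
  shows "tame (\<lambda>e g r. P (eval_g v e g s) (eval_g v e g t))"
proof -
  obtain B T I B' T' I' where st: "gterm_sim s B T I" "gterm_sim t B' T' I'"
    using ex_gterm_sim by blast
  define A where "A = max B B'"
  obtain N where N: "\<And>S x x' y y'. compat N S \<Longrightarrow> (x, x') \<in> comb A S \<Longrightarrow> (y, y') \<in> comb A S \<Longrightarrow>
      P (ereal x) (ereal y) \<Longrightarrow> P (ereal x') (ereal y')"
    using fin[of A] by blast
  have "P (eval_g v e' g' s) (eval_g v e' g' t)"
    if s: "sim N (T \<union> T') (I \<union> I') e g e' g'" and p: "P (eval_g v e g s) (eval_g v e g t)" for e g e' g'
  proof -
    let ?S = "group_pairs (I \<union> I') g g' \<union> w_pair ` fun_pairs (T \<union> T') e e'"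
    have S: "compat N ?S"
      using s by (simp add: sim_def matched_def)
    have sub: "comb B ?S \<subseteq> comb A ?S" "comb B' ?S \<subseteq> comb A ?S"
      by (intro comb_mono; simp add: A_def)+
    consider "eval_g v e g s = \<infinity>" "eval_g v e' g' s = \<infinity>"
      | x x' where "eval_g v e g s = ereal x" "eval_g v e' g' s = ereal x'" "(x, x') \<in> comb A ?S"
      using gterm_simD[OF st(1) s] sub(1) by blast
    note s_cases = this
    consider "eval_g v e g t = \<infinity>" "eval_g v e' g' t = \<infinity>"
      | y y' where "eval_g v e g t = ereal y" "eval_g v e' g' t = ereal y'" "(y, y') \<in> comb A ?S"
      using gterm_simD[OF st(2) s] sub(2) by blast
    note t_cases = this
    show ?thesis
    proof (cases rule: s_cases; cases rule: t_cases)
      fix x x' y y'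
      assume "eval_g v e g s = ereal x" "eval_g v e' g' s = ereal x'" "(x, x') \<in> comb A ?S"
        "eval_g v e g t = ereal y" "eval_g v e' g' t = ereal y'" "(y, y') \<in> comb A ?S"
      thus ?thesis
        using N[OF S, of x x' y y'] p by simp
    qed (use p inf in auto)
  qed
  thus ?thesis
    using st unfolding gterm_sim_def by (intro tameI[of "T \<union> T'" "I \<union> I'"]) auto
qed

text \<open>A combination and its counterpart differ by a multiple of \<open>fact ?N\<close>, hence
  of every nonzero \<open>n \<le> ?N\<close>. Congruence modulo \<open>0\<close> is
  equality.\<close>

lemma tame_gcong: "tame (\<lambda>e g r. gcong v n (eval_g v e g s) (eval_g v e g t))"
proof (rule tame_gterm_rel)
  fix B
  have "gcong v n (ereal x') (ereal y')"
    if S: "compat (n + (B + B)) S" and xy: "(x, x') \<in> comb B S" "(y, y') \<in> comb B S"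
      and c: "gcong v n (ereal x) (ereal y)" for S x x' y y'
  proof -
    let ?N = "n + (B + B)"
    have d: "(x - y, x' - y') \<in> comb (B + B) S"
      using xy by (rule comb_diff)
    show ?thesis
    proof (cases "x = y")
      case True
      hence "x' = y'"
        using compat_eq_0[OF S d] by simp
      thus ?thesis by (simp add: gcong_def)
    next
      case False
      then obtain u where u: "u \<in> VG" "x - y = real n * u"
        using c by (auto simp: gcong_def value_group_iff)
      have "n \<noteq> 0"
      proof
        assume "n = 0"
        with u(2) False show False by simp
      qed
      hence "n dvd fact ?N"
        by (intro dvd_fact) auto
      then obtain k where "fact ?N = n * k" by blast
      hence k: "(fact ?N :: real) = real n * real k"
        by (metis of_nat_fact of_nat_mult)
      obtain u' where u': "u' \<in> VG" "(x - y) - (x' - y') = fact ?N * u'"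
        using comb_cong[OF S d] by blast
      hence "x' - y' = real n * (u - real k * u')"
        using u(2) k by (simp add: algebra_simps)
      moreover have "u - real k * u' \<in> VG"
        using u(1) u'(1) by (intro VG_diff VG_of_nat_mult)
      ultimately show ?thesis
        unfolding gcong_def by (auto simp: value_group_iff)
    qed
  qed
  thus "\<exists>N. \<forall>S x x' y y'. compat N S \<longrightarrow> (x, x') \<in> comb B S \<longrightarrow> (y, y') \<in> comb B S \<longrightarrow>
      gcong v n (ereal x) (ereal y) \<longrightarrow> gcong v n (ereal x') (ereal y')"
    by blast
qed (auto simp: gcong_def)

lemma tame_geq: "tame (\<lambda>e g r. eval_g v e g s = eval_g v e g t)"
proof (rule tame_gterm_rel)
  fix B
  have "x' = y'" if "compat (B + B) S" "(x, x') \<in> comb B S" "(y, y') \<in> comb B S" "x = y" for S x x' y y'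
    using compat_eq_0[OF that(1) comb_diff[OF that(2,3)]] that(4) by simp
  thus "\<exists>N. \<forall>S x x' y y'. compat N S \<longrightarrow> (x, x') \<in> comb B S \<longrightarrow> (y, y') \<in> comb B S \<longrightarrow>
      ereal x = ereal y \<longrightarrow> ereal x' = ereal y'"
    unfolding ereal.inject by blast
qed auto

lemma tame_gless: "tame (\<lambda>e g r. eval_g v e g s < eval_g v e g t)"
proof (rule tame_gterm_rel)
  fix B
  have "x' < y'" if "compat (B + B) S" "(x, x') \<in> comb B S" "(y, y') \<in> comb B S" "x < y" for S x x' y y'
    using compat_pos[OF that(1) comb_diff[OF that(3,2)]] that(4) by simp
  thus "\<exists>N. \<forall>S x x' y y'. compat N S \<longrightarrow> (x, x') \<in> comb B S \<longrightarrow> (y, y') \<in> comb B S \<longrightarrow>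
      ereal x < ereal y \<longrightarrow> ereal x' < ereal y'"
    unfolding less_ereal.simps by blast
qed auto

lemma eval_r_cong:
  "\<exists>T. finite T \<and> T \<subseteq> polyfun \<and> (\<forall>e e' r. (\<forall>t\<in>T. ac (t e) = ac (t e')) \<longrightarrow> eval_r ac e r s = eval_r ac e' r s)"
proof (induction s)
  case (RAc t)
  show ?case
    by (intro exI[of _ "{\<lambda>e. eval_k e t}"]) (auto simp: eval_k_polyfun)
next
  case (RAdd s t)
  then obtain T T' where *: "finite T" "T \<subseteq> polyfun" "finite T'" "T' \<subseteq> polyfun"
    "\<And>e e' r. (\<forall>t\<in>T. ac (t e) = ac (t e')) \<Longrightarrow> eval_r ac e r s = eval_r ac e' r s"
    "\<And>e e' r. (\<forall>t\<in>T'. ac (t e) = ac (t e')) \<Longrightarrow> eval_r ac e r t = eval_r ac e' r t"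
    by blast
  have "eval_r ac e r (RAdd s t) = eval_r ac e' r (RAdd s t)"
    if "\<forall>u\<in>T \<union> T'. ac (u e) = ac (u e')" for e e' r
    using *(5)[of e e' r] *(6)[of e e' r] that by simp
  thus ?case
    using *(1-4) by (intro exI[of _ "T \<union> T'"] conjI allI impI) auto
next
  case (RMul s t)
  then obtain T T' where *: "finite T" "T \<subseteq> polyfun" "finite T'" "T' \<subseteq> polyfun"
    "\<And>e e' r. (\<forall>t\<in>T. ac (t e) = ac (t e')) \<Longrightarrow> eval_r ac e r s = eval_r ac e' r s"
    "\<And>e e' r. (\<forall>t\<in>T'. ac (t e) = ac (t e')) \<Longrightarrow> eval_r ac e r t = eval_r ac e' r t"
    by blast
  have "eval_r ac e r (RMul s t) = eval_r ac e' r (RMul s t)"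
    if "\<forall>u\<in>T \<union> T'. ac (u e) = ac (u e')" for e e' r
    using *(5)[of e e' r] *(6)[of e e' r] that by simp
  thus ?case
    using *(1-4) by (intro exI[of _ "T \<union> T'"] conjI allI impI) auto
next
  case (RNeg s)
  then obtain T where "finite T" "T \<subseteq> polyfun"
    "\<And>e e' r. (\<forall>t\<in>T. ac (t e) = ac (t e')) \<Longrightarrow> eval_r ac e r s = eval_r ac e' r s"
    by blast
  thus ?case
    by (intro exI[of _ T] conjI allI impI) simp_all
qed (auto intro: exI[of _ "{}"])

lemma tame_req: "tame (\<lambda>e g r. eval_r ac e r s = eval_r ac e r t)"
proof -
  obtain T where T: "finite T" "T \<subseteq> polyfun"
    "\<And>e e' r. (\<forall>t\<in>T. ac (t e) = ac (t e')) \<Longrightarrow> eval_r ac e r (RAdd s (RNeg t)) = eval_r ac e' r (RAdd s (RNeg t))"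
    using eval_r_cong[of "RAdd s (RNeg t)"] by blast
  have "eval_r ac e' r s = eval_r ac e' r t"
    if "sim 0 T {} e g e' g'" "eval_r ac e r s = eval_r ac e r t" for e g e' g' r
  proof -
    have "\<forall>t\<in>T. ac (t e) = ac (t e')"
      using that(1) by (auto simp: sim_def matched_def fun_pairs_def)
    thus ?thesis
      using T(3)[of e e' r] that(2) by simp
  qed
  thus ?thesis
    by (intro tameI[OF T(1,2) finite.emptyI])
qed

theorem tame_sat: "tame (\<lambda>e g r. sat v ac e g r \<phi>)"
proof (induction \<phi>)
  case (KEq s t)
  show ?case
    using tame_eq_0[OF polyfun_diff[OF eval_k_polyfun eval_k_polyfun], of s t] by simp
next
  case (ExK i \<phi>)
  show ?case
    unfolding sat.simps using ExK by (rule tame_ex_field)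
next
  case (ExG i \<phi>)
  show ?case
    unfolding sat.simps using ExG by (rule tame_ex_group)
next
  case (ExR i \<phi>)
  show ?case
    unfolding sat.simps using ExR by (rule tame_ex_residue)
qed (simp_all add: tame_geq tame_gless tame_gcong tame_req tame_not tame_conj)

section \<open>Definable compactness\<close>

lemma tame_ex_fields:
  assumes "finite X" "tame Q"
  shows "tame (\<lambda>e g r. \<exists>e'. (\<forall>i. i \<notin> X \<longrightarrow> e' i = e i) \<and> Q e' g r)"
  using assms(1)
proof (induction X rule: finite_induct)
  case empty
  have "(\<exists>e'. (\<forall>i. i \<notin> {} \<longrightarrow> e' i = e i) \<and> Q e' g r) \<longleftrightarrow> Q e g r" for e g r
    by (metis empty_iff ext)
  thus ?case
    using assms(2) by simp
next
  case (insert x X)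
  have "(\<exists>a e'. (\<forall>i. i \<notin> X \<longrightarrow> e' i = (e(x := a)) i) \<and> Q e' g r) \<longleftrightarrow>
      (\<exists>e'. (\<forall>i. i \<notin> insert x X \<longrightarrow> e' i = e i) \<and> Q e' g r)" for e g r
  proof
    assume "\<exists>e'. (\<forall>i. i \<notin> insert x X \<longrightarrow> e' i = e i) \<and> Q e' g r"
    then obtain e' where "\<forall>i. i \<notin> insert x X \<longrightarrow> e' i = e i" "Q e' g r" by blast
    thus "\<exists>a e'. (\<forall>i. i \<notin> X \<longrightarrow> e' i = (e(x := a)) i) \<and> Q e' g r"
      by (intro exI[of _ "e' x"] exI[of _ e']) auto
  next
    assume "\<exists>a e'. (\<forall>i. i \<notin> X \<longrightarrow> e' i = (e(x := a)) i) \<and> Q e' g r"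
    then obtain a e' where "\<forall>i. i \<notin> X \<longrightarrow> e' i = (e(x := a)) i" "Q e' g r" by blast
    thus "\<exists>e'. (\<forall>i. i \<notin> insert x X \<longrightarrow> e' i = e i) \<and> Q e' g r"
      by (intro exI[of _ e']) auto
  qed
  thus ?case
    using tame_ex_field[OF insert.IH, of x] by simp
qed

text \<open>Allows a neighbourhood condition to be added to a formula semantically, with the group
  variable \<open>k\<close> as its precision.\<close>

lemma tame_gvar_less:
  assumes "t \<in> polyfun"
  shows "tame (\<lambda>e g r. g k < v (t e))"
proof -
  have "g' k < v (t e')" if s: "sim 2 {t} {k} e g e' g'" and l: "g k < v (t e)" for e g e' g'
  proof -
    let ?S = "group_pairs {k} g g' \<union> w_pair ` fun_pairs {t} e e'"
    have r: "g k \<in> range v" "g' k \<in> range v" "g k = \<infinity> \<longleftrightarrow> g' k = \<infinity>" and matched: "matched 2 (group_pairs {k} g g') (fun_pairs {t} e e')"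
      using s by (auto simp: sim_def)
    have S: "compat 2 ?S"
      using matched by (rule matched_good)
    have "t e = 0 \<longleftrightarrow> t e' = 0"
      by (rule matched_eq_0_iff[OF matched]) (simp add: fun_pairs_def)
    moreover obtain a a' where aa: "g k = ereal a" "g' k = ereal a'"
      using range_v_cases[OF r(1)] range_v_cases[OF r(2)] r(3) l by fastforce
    have "(w (t e), w (t e')) \<in> comb 1 ?S" "(real_of_ereal (g k), real_of_ereal (g' k)) \<in> comb 1 ?S"
      using compat_finite[OF S] by (intro comb_member; simp add: group_pairs_def fun_pairs_def w_pair_def)+
    hence d: "(w (t e) - real_of_ereal (g k), w (t e') - real_of_ereal (g' k)) \<in> comb (1 + 1) ?S"
      by (rule comb_diff)
    have "a < w (t e) \<longleftrightarrow> a' < w (t e')"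
      using compat_pos[OF S d] by (simp add: aa)
    ultimately show ?thesis
      using l by (cases "t e = 0") (auto simp: aa v_eq_w)
  qed
  thus ?thesis
    using assms by (intro tameI[of "{t}" "{k}" 2]) auto
qed

text \<open>Beyond this bound, the sign of \<open>k * g + z\<close> with \<open>k \<noteq> 0\<close>
  is the sign of \<open>k\<close>; for \<open>k = 0\<close> both sides coincide, since all other
  pairs are diagonal.\<close>

lemma compat_diag:
  assumes A: "finite A" "A \<subseteq> VG"
    and g: "g \<in> VG" "g' \<in> VG" "g - g' = fact N * u" "u \<in> VG"
    and large: "N * (\<Sum>a\<in>A. \<bar>a\<bar>) < g" "N * (\<Sum>a\<in>A. \<bar>a\<bar>) < g'"
  shows "compat N (insert (g, g') ((\<lambda>a. (a, a)) ` A))"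
proof -
  let ?D = "(\<lambda>a. (a, a)) ` A"
  have D: "finite ?D" using A by simp
  have "x > 0 \<longleftrightarrow> y > 0" if xy: "(x, y) \<in> comb N (insert (g, g') ?D)" for x y
  proof -
    obtain k z z' where kz: "\<bar>k\<bar> \<le> int N" "(z, z') \<in> comb N ?D" "x = of_int k * g + z" "y = of_int k * g' + z'"
      using comb_insert[OF D xy] by blast
    obtain c where c: "\<forall>s\<in>?D. \<bar>c s\<bar> \<le> int N" "z = (\<Sum>s\<in>?D. of_int (c s) * fst s)"
      "z' = (\<Sum>s\<in>?D. of_int (c s) * snd s)"
      using kz(2) by (rule combE)
    have z: "z' = z"
      unfolding c by (intro sum.cong) auto
    have "z = (\<Sum>a\<in>A. of_int (c (a, a)) * a)"
      unfolding c by (subst sum.reindex) (auto simp: inj_on_def)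
    hence "\<bar>z\<bar> \<le> (\<Sum>a\<in>A. \<bar>of_int (c (a, a)) * a\<bar>)"
      by (simp add: sum_abs)
    also have "\<dots> \<le> (\<Sum>a\<in>A. N * \<bar>a\<bar>)"
    proof (rule sum_mono)
      fix a assume "a \<in> A"
      hence "\<bar>c (a, a)\<bar> \<le> int N"
        using c(1) by auto
      hence "\<bar>real_of_int (c (a, a))\<bar> \<le> real N"
        by linarith
      thus "\<bar>of_int (c (a, a)) * a\<bar> \<le> N * \<bar>a\<bar>"
        unfolding abs_mult by (intro mult_right_mono) auto
    qed
    finally have z_le: "\<bar>z\<bar> \<le> N * (\<Sum>a\<in>A. \<bar>a\<bar>)"
      by (simp add: sum_distrib_left)
    have pos: "0 \<le> N * (\<Sum>a\<in>A. \<bar>a\<bar>)"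
      by (simp add: sum_nonneg)
    have g_pos: "0 \<le> g" "0 \<le> g'"
      using large pos by linarith+
    consider "k = 0" | "k \<ge> 1" | "k \<le> - 1" by linarith
    thus ?thesis
    proof cases
      case 1
      thus ?thesis using kz z by simp
    next
      case 2
      hence "g \<le> of_int k * g" "g' \<le> of_int k * g'"
        using g_pos mult_right_mono[of 1 "real_of_int k" g] mult_right_mono[of 1 "real_of_int k" g'] by auto
      thus ?thesis
        unfolding kz z using z_le large by linarith
    next
      case 3
      hence "g \<le> of_int (- k) * g" "g' \<le> of_int (- k) * g'"
        using g_pos mult_right_mono[of 1 "real_of_int (- k)" g]
          mult_right_mono[of 1 "real_of_int (- k)" g'] by auto
      thus ?thesis
        unfolding kz z using z_le large by (simp, linarith)
    qed
  qed
  moreover have "\<exists>u\<in>VG. x - y = fact N * u" if "(x, y) \<in> insert (g, g') ?D" for x y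
    using that g(3,4) VG_0 by (auto intro: bexI[of _ 0])
  ultimately show ?thesis
    using A g(1,2) unfolding compat_def by blast
qed

text \<open>By the choice of a center, a large value of \<open>q\<close> at \<open>y\<close> forces \<open>y\<close> to be close to a root of \<open>q\<close>.\<close>

lemma poly_bound:
  assumes q: "q \<noteq> 0"
  shows "\<exists>M. \<forall>y. v y \<ge> 0 \<longrightarrow> (\<forall>c. poly q c = 0 \<longrightarrow> v (y - c) \<le> ereal \<delta>) \<longrightarrow>
    poly q y \<noteq> 0 \<and> \<bar>w (poly q y)\<bar> \<le> M"
proof -
  define d where "d = degree q"
  define F where "F = (\<lambda>j. (pderiv ^^ j) q) ` {..Suc d}"
  have closed: "pderiv f \<in> F" if "f \<in> F" for f
  proof -
    obtain j where j: "j \<le> Suc d" "f = (pderiv ^^ j) q"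
      using \<open>f \<in> F\<close> by (auto simp: F_def)
    show ?thesis
    proof (cases "j = Suc d")
      case True
      have "(pderiv ^^ Suc d) q = 0"
        by (rule higher_pderiv_eq_0) (simp add: d_def)
      hence "pderiv f = f"
        using j(2) True by simp
      thus ?thesis using \<open>f \<in> F\<close> by simp
    next
      case False
      thus ?thesis
        using j unfolding F_def by (intro image_eqI[of _ _ "Suc j"]) auto
    qed
  qed
  have qF: "q \<in> F"
    unfolding F_def by (intro image_eqI[of _ _ 0]) auto
  define C where "C = insert 0 (\<Union>g\<in>F - {0}. {c. poly g c = 0})"
  have C: "finite C"
    by (auto simp: C_def F_def poly_roots_finite)
  \<comment> \<open>\<open>M1\<close> bounds \<open>v (poly q y)\<close> from above: without
    cancellation at the center \<open>c\<close> it is at most the value of the constant Taylor term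
    \<open>poly q c\<close>, or, if that vanishes, of the leading one, where
    \<open>v (y - c) \<le> \<delta>\<close>. \<open>M2\<close> comes from the coefficients, as
    \<open>y\<close> is integral.\<close>
  define M1 where "M1 = (\<Sum>c\<in>C. \<bar>w (poly q c)\<bar>) + \<bar>w (lead_coeff q)\<bar> + d * \<bar>\<delta>\<bar>"
  define M2 where "M2 = (\<Sum>i\<le>d. \<bar>w (coeff q i)\<bar>)"
  have nn: "(\<Sum>c\<in>C. \<bar>w (poly q c)\<bar>) \<ge> 0" "M2 \<ge> 0" "0 \<le> d * \<bar>\<delta>\<bar>"
    by (auto simp: M2_def intro!: sum_nonneg)
  hence M1: "M1 \<ge> 0"
    unfolding M1_def by linarith
  have "poly q y \<noteq> 0 \<and> \<bar>w (poly q y)\<bar> \<le> M1 + M2"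
    if y: "v y \<ge> 0" and far: "\<And>c. poly q c = 0 \<Longrightarrow> v (y - c) \<le> ereal \<delta>" for y
  proof -
    have "\<exists>c. (c = 0 \<or> (\<exists>g\<in>F. g \<noteq> 0 \<and> poly g c = 0)) \<and>
        (\<forall>f\<in>F. \<forall>d\<ge>degree f. no_cancel (\<lambda>i. tay f c i * (y - c) ^ i) d)"
      using closed by (intro center) (auto simp: F_def)
    then obtain c where c: "c \<in> C" "no_cancel (\<lambda>i. tay q c i * (y - c) ^ i) d"
      using qF by (auto simp: C_def d_def)
    have nc: "v (poly q y) \<le> v (tay q c i * (y - c) ^ i)" if "i \<le> d" for i
      using c(2) that poly_tay[of q d y c] unfolding no_cancel_def d_def by simp
    have up: "v (poly q y) \<le> ereal M1"
    proof (cases "poly q c = 0")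
      case False
      have "\<bar>w (poly q c)\<bar> \<le> (\<Sum>c\<in>C. \<bar>w (poly q c)\<bar>)"
        using c(1) C by (intro member_le_sum) auto
      hence "w (poly q c) \<le> M1"
        unfolding M1_def using nn(3) by linarith
      thus ?thesis
        using nc[of 0] False by (simp add: tay_0 v_eq_w) (metis ereal_less_eq(3) order.trans)
    next
      case True
      hence "v (y - c) \<le> ereal \<delta>"
        by (rule far)
      moreover from this have yc: "y - c \<noteq> 0"
        by auto
      ultimately have wyc: "w (y - c) \<le> \<delta>"
        using v_eq_w[of "y - c"] by simp
      have "tay q c d = lead_coeff q"
        using lead_coeff_comp[of "[:c, 1:]" q] by (simp add: tay_def d_def degree_pcompose)
      moreover have "d * w (y - c) \<le> d * \<bar>\<delta>\<bar>"
        using wyc by (intro mult_left_mono) auto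
      ultimately have "v (poly q y) \<le> ereal (w (lead_coeff q) + d * w (y - c))"
        using nc[of d] yc q by (simp add: v_eq_w w_mult w_power)
      also have "w (lead_coeff q) + d * w (y - c) \<le> M1"
        unfolding M1_def using nn(1) \<open>d * w (y - c) \<le> d * \<bar>\<delta>\<bar>\<close> by linarith
      finally show ?thesis
        by simp
    qed
    have "ereal (- M2) \<le> v (\<Sum>i\<le>d. coeff q i * y ^ i)"
    proof (rule v_sum_ge)
      fix i assume i: "i \<in> {..d}"
      show "ereal (- M2) \<le> v (coeff q i * y ^ i)"
      proof (cases "coeff q i = 0")
        case False
        have "\<bar>w (coeff q i)\<bar> \<le> M2"
          unfolding M2_def using i by (intro member_le_sum) auto
        hence "ereal (- M2) \<le> v (coeff q i)"
          using False by (simp add: v_eq_w)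
        thus ?thesis
          using v_power_ge_0[OF y, of i] unfolding v_mult by (metis add.right_neutral add_mono)
      qed simp
    qed simp
    hence low: "ereal (- M2) \<le> v (poly q y)"
      by (simp add: poly_altdef d_def)
    have "poly q y \<noteq> 0"
      using up by auto
    moreover from this have "w (poly q y) \<le> M1" "- M2 \<le> w (poly q y)"
      using up low by (simp_all add: v_eq_w)
    ultimately show ?thesis
      using nn M1 by simp
  qed
  thus ?thesis by blast
qed

text \<open>The factor \<open>1 + card I + card T\<close> counts the values to be dominated:
  \<open>eps\<close>, those of the group variables and those of the polynomials.\<close>

lemma sim_diag:
  fixes M x x' u :: real
  assumes T: "finite T" and I: "finite I" and g: "range g \<subseteq> range v" and k: "x \<in> VG" "x' \<in> VG"
    and cong: "x - x' = fact N * u" "u \<in> VG"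
    and M: "\<And>t. t \<in> T \<Longrightarrow> \<bar>w (t e)\<bar> \<le> M" "\<And>i. i \<in> I \<Longrightarrow> \<bar>real_of_ereal (g i)\<bar> \<le> M" "eps \<le> M"
    and large: "N * ((1 + card I + card T) * M) < x" "N * ((1 + card I + card T) * M) < x'"
  shows "sim N T I e (g(k := ereal x)) e (g(k := ereal x'))"
proof -
  define A where "A = insert eps ((\<lambda>i. real_of_ereal (g i)) ` I \<union> (\<lambda>t. w (t e)) ` T)"
  have A: "finite A" "A \<subseteq> VG"
    using T I g real_of_range eps_VG by (auto simp: A_def)
  have "card A \<le> Suc (card ((\<lambda>i. real_of_ereal (g i)) ` I \<union> (\<lambda>t. w (t e)) ` T))"
    unfolding A_def by (rule card_insert_le_m1) auto
  also have "card ((\<lambda>i. real_of_ereal (g i)) ` I \<union> (\<lambda>t. w (t e)) ` T) \<le> card I + card T"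
    by (rule order.trans[OF card_Un_le]) (intro add_mono card_image_le I T)
  finally have cA: "card A \<le> 1 + card I + card T"
    by simp
  have M0: "M \<ge> 0"
    using M(3) eps_ge_0 by linarith
  have "(\<Sum>a\<in>A. \<bar>a\<bar>) \<le> of_nat (card A) * M"
    using M eps_ge_0 by (intro sum_bounded_above) (auto simp: A_def)
  also have "\<dots> \<le> (1 + card I + card T) * M"
    using cA M0 by (intro mult_right_mono) auto
  finally have "N * (\<Sum>a\<in>A. \<bar>a\<bar>) \<le> N * ((1 + card I + card T) * M)"
    by (intro mult_left_mono) auto
  hence "compat N (insert (x, x') ((\<lambda>a. (a, a)) ` A))"
    using large by (intro compat_diag[OF A k cong]) linarith+
  moreover have "group_pairs I (g(k := ereal x)) (g(k := ereal x')) \<union> w_pair ` fun_pairs T e e \<subseteq> insert (x, x') ((\<lambda>a. (a, a)) ` A)"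
    by (auto simp: group_pairs_def fun_pairs_def w_pair_def A_def)
  ultimately have "compat N (group_pairs I (g(k := ereal x)) (g(k := ereal x')) \<union> w_pair ` fun_pairs T e e)"
    using compat_mono by blast
  thus ?thesis
    using g T ereal_VG[OF k(1)] ereal_VG[OF k(2)] by (auto simp: sim_def matched_def fun_pairs_def)
qed

lemma VG_unbounded: "\<exists>g\<in>VG. g > B"
proof -
  obtain g where g: "g \<in> VG" "g > 0"
    using VG_pos_ex by blast
  obtain n where "real n * g > B"
    using reals_Archimedean3[OF g(2)] by blast
  thus ?thesis
    using VG_of_nat_mult[OF g(1)] by blast
qed

text \<open>Choose points of the family along an arithmetic progression of
  indices tending to infinity: either they accumulate at a root of one of the polynomials
  controlling the family, or the values of these polynomials stay bounded, and then one point
  belongs to all members of the family, since far out their indices cannot be told apart.\<close>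

lemma common_adherent_point:
  assumes P: "tame P" and g0: "range g \<subseteq> range v"
    and ne: "\<And>x. x \<in> VG \<Longrightarrow> \<exists>y. v y \<ge> 0 \<and> P (e(j := y)) (g(k := ereal x)) r"
    and anti: "\<And>x x' y. x \<in> VG \<Longrightarrow> x' \<in> VG \<Longrightarrow> x \<le> x' \<Longrightarrow> P (e(j := y)) (g(k := ereal x')) r \<Longrightarrow>
      P (e(j := y)) (g(k := ereal x)) r"
  shows "\<exists>b. v b \<ge> 0 \<and> (\<forall>\<delta>::real. \<forall>x\<in>VG. \<exists>y. v (y - b) > ereal \<delta> \<and> P (e(j := y)) (g(k := ereal x)) r)"
proof -
  obtain N T I where NTI: "finite T" "T \<subseteq> polyfun" "finite I"
    "\<And>e g e' g' r. sim N T I e g e' g' \<Longrightarrow> P e g r \<Longrightarrow> P e' g' r"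
    using P unfolding tame_def by blast
  have "\<forall>t\<in>T. \<exists>q. \<forall>a. t (e(j := a)) = poly q a"
    using NTI(2) polyfun_as_polyfam by blast
  then obtain q where q: "\<And>t a. t \<in> T \<Longrightarrow> t (e(j := a)) = poly (q t) a"
    by metis
  obtain g1 where g1: "g1 \<in> VG" "g1 > 0"
    using VG_pos_ex by blast
  \<comment> \<open>The factor \<open>fact N\<close> puts all indices into one congruence
    class.\<close>
  define x where "x i = real i * (fact N * g1)" for i :: nat
  have x_VG: "x i \<in> VG" for i
    using VG_of_nat_mult[OF g1(1), of "i * fact N"] by (simp add: x_def mult.assoc)
  have x_mono: "x i \<le> x i'" if "i \<le> i'" for i i'
    using that g1 unfolding x_def by (intro mult_right_mono) auto
  have x_unbounded: "\<exists>i. B < x i" for B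
    using reals_Archimedean3[of "fact N * g1"] g1(2) unfolding x_def by simp
  have x_cong: "\<exists>u\<in>VG. x i - x i' = fact N * u" for i i'
    using VG_of_int_mult[OF g1(1), of "int i - int i'"]
    by (intro bexI[of _ "of_int (int i - int i') * g1"]) (simp_all add: x_def algebra_simps)
  obtain y where y: "\<And>i. v (y i) \<ge> 0" "\<And>i. P (e(j := y i)) (g(k := ereal (x i))) r"
    using ne[OF x_VG] by metis
  define C where "C = (\<Union>t\<in>{t \<in> T. q t \<noteq> 0}. {c. poly (q t) c = 0})"
  have C: "finite C"
    using NTI(1) by (auto simp: C_def poly_roots_finite)
  show ?thesis
  \<comment> \<open>The first case admits any accumulation point \<open>c\<close>. In the second,
    each \<open>v (y i - c)\<close> is eventually bounded, hence uniformly so over the finite set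
    \<open>C\<close> of roots.\<close>
  proof (cases "\<exists>c. \<forall>\<delta>::real. \<forall>i0. \<exists>i\<ge>i0. v (y i - c) > ereal \<delta>")
    case True
    then obtain c where c: "\<And>\<delta> i0. \<exists>i\<ge>i0. v (y i - c) > ereal \<delta>"
      by blast
    obtain i where "v (y i - c) > ereal 0"
      using c by blast
    hence "v c \<ge> 0"
      using v_diff[of "y i" "y i - c"] y(1)[of i] by (auto simp: min_def zero_ereal_def split: if_splits)
    moreover have "\<exists>y. v (y - c) > ereal \<delta> \<and> P (e(j := y)) (g(k := ereal z)) r" if "z \<in> VG" for \<delta> z
    proof -
      obtain i0 where "z < x i0"
        using x_unbounded by blast
      moreover obtain i where "i \<ge> i0" "v (y i - c) > ereal \<delta>"
        using c by blast
      ultimately show ?thesis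
        using anti[OF that x_VG, of i] y(2)[of i] x_mono[of i0 i] by auto
    qed
    ultimately show ?thesis by blast
  next
    case False
    hence "\<forall>c. \<exists>\<delta>::real. \<exists>i0. \<forall>i\<ge>i0. v (y i - c) \<le> ereal \<delta>"
      by (meson not_le)
    then obtain \<delta> i0 where far: "\<And>c i. i \<ge> i0 c \<Longrightarrow> v (y i - c) \<le> ereal (\<delta> c)"
      by metis
    define \<delta>1 where "\<delta>1 = (\<Sum>c\<in>C. \<bar>\<delta> c\<bar>)"
    define i1 where "i1 = (\<Sum>c\<in>C. i0 c)"
    have far1: "v (y i - c) \<le> ereal \<delta>1" if "c \<in> C" "i \<ge> i1" for c i
    proof -
      have "i0 c \<le> i1"
        unfolding i1_def using that C by (intro member_le_sum) auto
      moreover have "\<bar>\<delta> c\<bar> \<le> \<delta>1"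
        unfolding \<delta>1_def using that C by (intro member_le_sum) auto
      ultimately show ?thesis
        using far[of c i] that(2) by (auto intro: order.trans)
    qed
    have "\<forall>t\<in>T. \<exists>M. \<forall>i\<ge>i1. \<bar>w (t (e(j := y i)))\<bar> \<le> M"
    proof
      fix t assume t: "t \<in> T"
      show "\<exists>M. \<forall>i\<ge>i1. \<bar>w (t (e(j := y i)))\<bar> \<le> M"
      proof (cases "q t = 0")
        case True
        thus ?thesis
          using q[OF t] by (intro exI[of _ 0]) simp
      next
        case False
        obtain M where M: "\<And>y. v y \<ge> 0 \<Longrightarrow> (\<And>c. poly (q t) c = 0 \<Longrightarrow> v (y - c) \<le> ereal \<delta>1) \<Longrightarrow>
            \<bar>w (poly (q t) y)\<bar> \<le> M"
          using poly_bound[OF False, of \<delta>1] by blast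
        have "\<bar>w (t (e(j := y i)))\<bar> \<le> M" if "i \<ge> i1" for i
          unfolding q[OF t] using False t that by (intro M y far1) (auto simp: C_def)
        thus ?thesis by blast
      qed
    qed
    then obtain M where M: "\<And>t i. t \<in> T \<Longrightarrow> i \<ge> i1 \<Longrightarrow> \<bar>w (t (e(j := y i)))\<bar> \<le> M t"
      by metis
    define M1 where "M1 = (\<Sum>t\<in>T. \<bar>M t\<bar>) + (\<Sum>i\<in>I. \<bar>real_of_ereal (g i)\<bar>) + eps"
    have nn: "(\<Sum>t\<in>T. \<bar>M t\<bar>) \<ge> 0" "(\<Sum>i\<in>I. \<bar>real_of_ereal (g i)\<bar>) \<ge> 0"
      by (intro sum_nonneg abs_ge_zero)+
    have M1: "\<bar>w (t (e(j := y i)))\<bar> \<le> M1" if "t \<in> T" "i \<ge> i1" for t i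
    proof -
      have "\<bar>M t\<bar> \<le> (\<Sum>t\<in>T. \<bar>M t\<bar>)"
        using that NTI(1) by (intro member_le_sum) auto
      thus ?thesis
        using M[OF that] nn eps_ge_0 unfolding M1_def by linarith
    qed
    have M1': "\<bar>real_of_ereal (g i)\<bar> \<le> M1" if "i \<in> I" for i
    proof -
      have "\<bar>real_of_ereal (g i)\<bar> \<le> (\<Sum>i\<in>I. \<bar>real_of_ereal (g i)\<bar>)"
        using that NTI(3) by (intro member_le_sum abs_ge_zero)
      thus ?thesis
        using nn eps_ge_0 unfolding M1_def by linarith
    qed
    have M1'': "eps \<le> M1"
      using nn unfolding M1_def by linarith
    obtain i2 where i2: "N * ((1 + card I + card T) * M1) < x i2"
      using x_unbounded by blast
    define i where "i = max i1 i2"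
    have big: "N * ((1 + card I + card T) * M1) < x i'" if "i' \<ge> i" for i'
      using i2 x_mono[of i2 i'] that by (simp add: i_def)
    \<comment> \<open>With \<open>y i\<close> kept fixed, \<open>x i\<close> and \<open>x i'\<close>
      are congruent and both dominate the bounded values, so the two assignments are
      similar.\<close>
    have all: "P (e(j := y i)) (g(k := ereal (x i'))) r" if i': "i' \<ge> i" for i'
    proof -
      obtain u where u: "u \<in> VG" "x i - x i' = fact N * u"
        using x_cong by blast
      have "sim N T I (e(j := y i)) (g(k := ereal (x i))) (e(j := y i)) (g(k := ereal (x i')))"
        using M1 M1' M1'' big i' i_def u
        by (intro sim_diag[OF NTI(1,3) g0 x_VG x_VG, of _ _ _ u _ M1]) auto
      thus ?thesis
        using NTI(4) y(2) by blast
    qed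
    have "P (e(j := y i)) (g(k := ereal z)) r" if "z \<in> VG" for z
    proof -
      obtain i' where "z < x i'"
        using x_unbounded by blast
      hence "z \<le> x (max i i')"
        using x_mono[of i' "max i i'"] by simp
      thus ?thesis
        using anti[OF that x_VG] all by simp
    qed
    thus ?thesis
      using y(1)[of i] by (intro exI[of _ "y i"] conjI allI ballI exI[of _ "y i"]) auto
  qed
qed

text \<open>Adherence of the new coordinate to all members of the family gives simultaneous
  approximation: one point of \<open>B\<close> is close to it and, for a large index, also close to
  the earlier coordinates.\<close>

lemma definable_compactness:
  fixes p :: "'k list" and eK :: "nat \<Rightarrow> 'k"
  assumes eG: "range eG \<subseteq> range v" and B: "B = {xs. length xs = n + m \<and> sat v ac (coord_env eK xs) eG eR \<phi>}"
    and int: "\<And>z i. z \<in> B \<Longrightarrow> n \<le> i \<Longrightarrow> i < n + m \<Longrightarrow> v (z ! i) \<ge> 0"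
    and p: "length p = n" and adh: "\<And>\<gamma>::real. \<exists>z\<in>B. \<forall>i<n. v (z ! i - p ! i) > ereal \<gamma>"
  shows "l \<le> m \<Longrightarrow> \<exists>ys. length ys = l \<and> (\<forall>y\<in>set ys. v y \<ge> 0) \<and>
    (\<forall>\<gamma>::real. \<exists>z\<in>B. \<forall>i<n + l. v (z ! i - (p @ ys) ! i) > ereal \<gamma>)"
proof (induction l)
  case 0
  thus ?case
    using adh by (intro exI[of _ "[]"]) simp
next
  case (Suc l)
  then obtain ys where ys: "length ys = l" "\<forall>y\<in>set ys. v y \<ge> 0"
    "\<And>\<gamma>::real. \<exists>z\<in>B. \<forall>i<n + l. v (z ! i - (p @ ys) ! i) > ereal \<gamma>"
    by auto
  define c where "c = n + l"
  define a where "a = p @ ys"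
  have c: "c < n + m" "length a = c"
    using Suc.prems ys(1) p by (simp_all add: c_def a_def)
  obtain N T I where NTI: "finite T" "T \<subseteq> polyfun" "finite I"
    "\<And>e g e' g' r. sim N T I e g e' g' \<Longrightarrow> sat v ac e g r \<phi> \<Longrightarrow> sat v ac e' g' r \<phi>"
    using tame_sat[of \<phi>] unfolding tame_def by blast
  \<comment> \<open>Even if \<open>k\<close> occurs in \<open>\<phi>\<close>, a variable outside the
    controlling set \<open>I\<close> cannot affect its truth, so it is free to carry the
    precision.\<close>
  obtain k where k: "k \<notin> I"
    using NTI(3) ex_new_if_finite[OF infinite_UNIV_nat] by blast
  have fresh: "sat v ac e (eG(k := ereal x)) eR \<phi> \<longleftrightarrow> sat v ac e eG eR \<phi>" for e x
  proof -
    define M where "M = (\<Sum>t\<in>T. \<bar>w (t e)\<bar>) + (\<Sum>i\<in>I. \<bar>real_of_ereal (eG i)\<bar>) + eps"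
    have nn: "(\<Sum>t\<in>T. \<bar>w (t e)\<bar>) \<ge> 0" "(\<Sum>i\<in>I. \<bar>real_of_ereal (eG i)\<bar>) \<ge> 0"
      by (intro sum_nonneg abs_ge_zero)+
    have M: "\<bar>w (t e)\<bar> \<le> M" if "t \<in> T" for t
    proof -
      have "\<bar>w (t e)\<bar> \<le> (\<Sum>t\<in>T. \<bar>w (t e)\<bar>)"
        using that NTI(1) by (intro member_le_sum) auto
      thus ?thesis
        using nn eps_ge_0 unfolding M_def by linarith
    qed
    have M': "\<bar>real_of_ereal (eG i)\<bar> \<le> M" if "i \<in> I" for i
    proof -
      have "\<bar>real_of_ereal (eG i)\<bar> \<le> (\<Sum>i\<in>I. \<bar>real_of_ereal (eG i)\<bar>)"
        using that NTI(3) by (intro member_le_sum abs_ge_zero)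
      thus ?thesis
        using nn eps_ge_0 unfolding M_def by linarith
    qed
    \<comment> \<open>The aim is reflexivity of similarity. \<open>sim_diag\<close> supplies it with
      a large value at \<open>k\<close>, which may then be replaced by any other because
      \<open>k \<notin> I\<close>.\<close>
    obtain h where h: "h \<in> VG" "N * ((1 + card I + card T) * M) < h"
      using VG_unbounded by blast
    have sim_h: "sim N T I e (eG(k := ereal h)) e (eG(k := ereal h))"
      using M M' nn h by (intro sim_diag[OF NTI(1,3) eG, of _ _ _ 0 _ M]) (auto simp: M_def)
    have group_pairs_k: "group_pairs I (eG(k := s)) (eG(k := s')) = group_pairs I (eG(k := ereal h)) (eG(k := ereal h))" for s s'
      using k by (auto simp: group_pairs_def intro!: image_cong)
    have "sim N T I e (eG(k := s)) e (eG(k := s'))" for s s'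
      unfolding sim_def group_pairs_k[of s s'] using sim_h k eG by (auto simp: sim_def)
    from this[of "ereal x" "eG k"] this[of "eG k" "ereal x"] show ?thesis
      using NTI(4)[of e "eG(k := ereal x)" e "eG(k := eG k)"] NTI(4)[of e "eG(k := eG k)" e "eG(k := ereal x)"]
      by auto
  qed
  \<comment> \<open>Coordinate \<open>c\<close> stays free and the other coordinates are quantified;
    those before \<open>c\<close> must approximate \<open>a\<close> with precision
    \<open>g k\<close>.\<close>
  define P where "P e g r \<longleftrightarrow> (\<exists>e'. (\<forall>i. i \<notin> {..<n + m} - {c} \<longrightarrow> e' i = e i) \<and>
      sat v ac e' g r \<phi> \<and> (\<forall>i\<in>{..<c}. g k < v (e' i - a ! i)))" for e g r
  have "tame P"
    unfolding P_def
    by (intro tame_ex_fields tame_conj tame_sat tame_Ball tame_gvar_less polyfun_diff polyfun.var polyfun.const) auto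
  have P_iff: "P (eK(c := y)) (eG(k := ereal x)) eR \<longleftrightarrow> (\<exists>z\<in>B. z ! c = y \<and> (\<forall>i<c. v (z ! i - a ! i) > ereal x))"
    for y x
  proof
    assume "P (eK(c := y)) (eG(k := ereal x)) eR"
    then obtain e' where e': "\<And>i. i \<notin> {..<n + m} - {c} \<Longrightarrow> e' i = (eK(c := y)) i"
      "sat v ac e' eG eR \<phi>" "\<forall>i\<in>{..<c}. ereal x < v (e' i - a ! i)"
      unfolding P_def fresh by auto
    define z where "z = map e' [0..<n + m]"
    have "coord_env eK z = e'"
      using e'(1) c(1) by (auto simp: coord_env_def z_def fun_eq_iff)
    hence "z \<in> B"
      using e'(2) by (simp add: B z_def)
    moreover have "z ! i = e' i" if "i \<le> c" for i
      using that c(1) by (simp add: z_def)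
    ultimately show "\<exists>z\<in>B. z ! c = y \<and> (\<forall>i<c. v (z ! i - a ! i) > ereal x)"
      using e'(1)[of c] e'(3) by (intro bexI[of _ z]) auto
  next
    assume "\<exists>z\<in>B. z ! c = y \<and> (\<forall>i<c. v (z ! i - a ! i) > ereal x)"
    then obtain z where z: "z \<in> B" "z ! c = y" "\<forall>i<c. v (z ! i - a ! i) > ereal x"
      by blast
    have len: "length z = n + m" "sat v ac (coord_env eK z) eG eR \<phi>"
      using z(1) by (simp_all add: B)
    show "P (eK(c := y)) (eG(k := ereal x)) eR"
      unfolding P_def fresh
    proof (intro exI[of _ "coord_env eK z"] conjI allI impI)
      fix i assume "i \<notin> {..<n + m} - {c}"
      hence "i = c \<or> \<not> i < n + m" by auto
      thus "coord_env eK z i = (eK(c := y)) i"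
        unfolding coord_env_def len(1) using z(2) c(1) by (elim disjE) simp_all
    next
      have "coord_env eK z i = z ! i" if "i < c" for i
        using that c(1) by (simp add: coord_env_def len(1))
      thus "\<forall>i\<in>{..<c}. (eG(k := ereal x)) k < v (coord_env eK z i - a ! i)"
        using z(3) by simp
    qed (rule len(2))
  qed
  have "\<exists>b. v b \<ge> 0 \<and> (\<forall>\<delta>::real. \<forall>x\<in>VG. \<exists>y. v (y - b) > ereal \<delta> \<and> P (eK(c := y)) (eG(k := ereal x)) eR)"
  proof (rule common_adherent_point[OF \<open>tame P\<close> eG])
    fix x
    obtain z where "z \<in> B" "\<forall>i<n + l. v (z ! i - (p @ ys) ! i) > ereal x"
      using ys(3) by blast
    thus "\<exists>y. v y \<ge> 0 \<and> P (eK(c := y)) (eG(k := ereal x)) eR"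
      unfolding P_iff using int[of z c] c(1) by (intro exI[of _ "z ! c"]) (auto simp: c_def a_def)
  next
    fix x x' y
    assume "x \<le> x'" "P (eK(c := y)) (eG(k := ereal x')) eR"
    thus "P (eK(c := y)) (eG(k := ereal x)) eR"
      unfolding P_iff by (meson ereal_less_eq(3) order.strict_trans1)
  qed
  then obtain b where b: "v b \<ge> 0"
    "\<And>\<delta> x. x \<in> VG \<Longrightarrow> \<exists>y. v (y - b) > ereal \<delta> \<and> P (eK(c := y)) (eG(k := ereal x)) eR"
    by blast
  have "\<exists>z\<in>B. \<forall>i<n + Suc l. v (z ! i - (p @ ys @ [b]) ! i) > ereal \<gamma>" for \<gamma> :: real
  proof -
    obtain x where x: "x \<in> VG" "\<gamma> < x"
      using VG_unbounded by blast
    obtain y where "v (y - b) > ereal \<gamma>" "P (eK(c := y)) (eG(k := ereal x)) eR"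
      using b(2)[OF x(1)] by blast
    then obtain z where z: "z \<in> B" "v (z ! c - b) > ereal \<gamma>" "\<forall>i<c. v (z ! i - a ! i) > ereal x"
      unfolding P_iff by blast
    have "v (z ! i - (a @ [b]) ! i) > ereal \<gamma>" if "i < Suc c" for i
    proof (cases "i = c")
      case True
      thus ?thesis using z(2) c(2) by (simp add: nth_append)
    next
      case False
      hence "i < c" using that by simp
      have "ereal \<gamma> < ereal x" using x(2) by simp
      also have "\<dots> < v (z ! i - a ! i)" using z(3) \<open>i < c\<close> by blast
      finally show ?thesis
        using c(2) \<open>i < c\<close> by (simp add: nth_append)
    qed
    thus ?thesis
      using z(1) by (intro bexI[of _ z]) (simp_all add: c_def a_def)
  qed
  thus ?case
    using ys(1,2) b(1) by (intro exI[of _ "ys @ [b]"]) auto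
qed

end

theorem theorem3p1:
  fixes v :: "'k::field_char_0 \<Rightarrow> ereal"
    and res :: "'k \<Rightarrow> 'f::field_char_0"
    and ac :: "'k \<Rightarrow> 'f"
    and n m :: nat
    and D B :: "'k list set"
  assumes "henselian_ac_field v res ac"
    and "dp_definable v ac n D"
    and "m \<ge> 1"
    and "dp_definable v ac (n + m) B"
    and "K_closed_in v (prod_Rm v D m) B"
  shows "K_closed_in v D (take n ` B)"
proof -
  interpret henselian_ac v res ac
    by unfold_locales (rule assms(1))
  have D: "length xs = n" if "xs \<in> D" for xs
    using that assms(2) by (auto simp: dp_definable_def)
  have B_prod: "B \<subseteq> prod_Rm v D m"
    using assms(5) by (simp add: K_closed_in_def)
  have B_int: "v (z ! i) \<ge> 0" if "z \<in> B" "n \<le> i" "i < n + m" for z i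
  proof -
    obtain xs ys where "z = xs @ ys" "xs \<in> D" "length ys = m" "\<forall>y\<in>set ys. v y \<ge> 0"
      using B_prod \<open>z \<in> B\<close> by (auto simp: prod_Rm_def)
    thus ?thesis
      using that D[of xs] by (simp add: nth_append)
  qed
  have sub: "take n ` B \<subseteq> D"
    using B_prod D by (fastforce simp: prod_Rm_def)
  have "p \<in> take n ` B"
    if p: "p \<in> D" and adh: "\<And>\<gamma>::real. \<exists>q\<in>take n ` B. length q = length p \<and>
      (\<forall>i<length p. v (q ! i - p ! i) > ereal \<gamma>)" for p
  proof (cases "\<exists>x. w x \<noteq> 0")
    case False
    \<comment> \<open>All nonzero elements have valuation \<open>0\<close>, so precision
      \<open>0\<close> already forces equality.\<close>
    obtain q where q: "q \<in> take n ` B" "length q = length p" "\<forall>i<length p. v (q ! i - p ! i) > ereal 0"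
      using adh by blast
    have "q ! i = p ! i" if "i < length p" for i
      using q(3) False that v_eq_w[of "q ! i - p ! i"] by force
    hence "q = p"
      using q(2) by (intro nth_equalityI) auto
    thus ?thesis
      using q(1) by simp
  next
    case True
    interpret nontrivial_henselian_ac v res ac
      by unfold_locales (rule True)
    obtain \<phi> eK eG eR where eG: "range eG \<subseteq> range v"
      and B: "B = {xs. length xs = n + m \<and> sat v ac (coord_env eK xs) eG eR \<phi>}"
      using assms(4) unfolding dp_definable_def by blast
    have len: "length p = n"
      using D p by blast
    have "\<exists>z\<in>B. \<forall>i<n. v (z ! i - p ! i) > ereal \<gamma>" for \<gamma> :: real
      using adh[of \<gamma>] len by auto
    then obtain ys where ys: "length ys = m" "\<forall>y\<in>set ys. v y \<ge> 0"
      "\<And>\<gamma>::real. \<exists>z\<in>B. \<forall>i<n + m. v (z ! i - (p @ ys) ! i) > ereal \<gamma>"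
      using definable_compactness[OF eG B B_int len _ order.refl] by blast
    have "p @ ys \<in> prod_Rm v D m"
      using p ys by (auto simp: prod_Rm_def)
    moreover have "\<exists>z\<in>B. length z = length (p @ ys) \<and> (\<forall>i<length (p @ ys). v (z ! i - (p @ ys) ! i) > ereal \<gamma>)"
      for \<gamma> :: real
    proof -
      obtain z where "z \<in> B" "\<forall>i<n + m. v (z ! i - (p @ ys) ! i) > ereal \<gamma>"
        using ys(3) by blast
      thus ?thesis
        using len ys(1) by (intro bexI[of _ z]) (simp_all add: B)
    qed
    ultimately have "p @ ys \<in> B"
      using assms(5) unfolding K_closed_in_def by blast
    thus ?thesis
      using len by (intro image_eqI[of _ _ "p @ ys"]) auto
  qed
  thus ?thesis
    using sub unfolding K_closed_in_def by blast
qed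

end
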